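(* Let $(P_t)_{t\ge0}$ be a non-explosive homogeneous PDMP semigroup on $\mathsf M$ with characteristics $(\varphi,\lambda,Q)$ satisfying the stability property (defined in the context). Then for all $i\in\{0,1\}$, $f\in C^i(\mathsf M)$ and $T\in\mathbb R_+$, $P_Tf\in C^i(\mathsf M)$. In addition, for any $f\in C^1(\mathsf M)$, any compact set $K\subset\mathsf M$ and any $T\in\mathbb R_+$, there exists $C\ge0$ such that for all $t\in[0,T]$, $$\sup_{x\in K}\big\{|P_tf(x)|+\|\nabla(P_tf)(x)\|\big\}\le C.$$
   Context: $\mathsf M$ is a smooth closed Riemannian submanifold of $\mathbb R^N$ with Borel $\sigma$-field $\mathcal B(\mathsf M)$; $\infty\notin\mathsf M$ is a cemetery point; $\inf\emptyset=+\infty$; $C^0(\mathsf M)=C(\mathsf M)$ and $C^1(\mathsf M)$ are the continuous, resp. continuously differentiable, real functions on $\mathsf M$; $\|F\|_{\infty,K}=\sup_{x\in K}|F(x)|$. A homogeneous differential flow is a measurable map $(t,x)\mapsto\varphi_t(x)$ from $\mathbb R_+\times\mathsf M$ to $\mathsf M$ with $\varphi_0=\mathrm{Id}$, $\varphi_{t+s}=\varphi_s\circ\varphi_t$, $t\mapsto\varphi_t(x)$ continuously differentiable for all $x$, and each $\varphi_t$ a $C^1$-diffeomorphism of $\mathsf M$. A homogeneous jump rate is a measurable $\lambda:\mathsf M\to\mathbb R_+$ bounded on compact sets, and a homogeneous Markov kernel $Q$ is a Markov kernel on $(\mathsf M,\mathcal B(\mathsf M))$; $Qf(x)=\int f(y)Q(x,dy)$.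 Together $(\varphi,\lambda,Q)$ are homogeneous characteristics. A PDMP with these characteristics and initial law $\mu_0$ is a process with the law of the following one. Let $G:\mathsf M\times[0,1]\to\mathsf M$ be measurable with $Q(x,A)=\mathbb P(G(x,U)\in A)$, $U$ uniform on $[0,1]$; let $W_0\sim\mu_0$ and, independently, $(E_k,U_k)_{k\ge1}$ i.i.d., $E_k$ exponential with parameter $1$, $U_k$ uniform on $[0,1]$, independent. Set $S_0=0$, $X_0=X'_0=W_0$; given $X_k'\in\mathsf M$, $S_k<\infty$, set $S_{k+1}=\inf\{t\ge S_k:E_{k+1}<\int_{S_k}^t\lambda(\varphi_{s-S_k}(X'_k))\,ds\}$; if $S_{k+1}=+\infty$, set $S_m=+\infty$ for $m>k$ and $X_t=\varphi_{t-S_k}(X_k')$ for $t\ge S_k$; otherwise $X_t=\varphi_{t-S_k}(X'_k)$ for $t\in(S_k,S_{k+1})$ and $X_{S_{k+1}}=X'_{k+1}=G(\varphi_{S_{k+1}-S_k}(X'_k),U_{k+1})$. For $t\ge\sup_kS_k$, $X_t=\infty$. The characteristics (and semigroup) are non-explosive if for every initial law $\inf\{t:X_t=\infty\}=+\infty$ a.s. The semigroup is $P_t(x,A)=\mathbb P(X_t\in A)$ with $X_0=x$, and $P_tf(x)=\mathbb E[f(X_t)]$. Compact compatibility: $\varphi$ and $Q$ are compactly compatible if for all compact $K\subset\mathsf M$ and $T\ge0$ there exists a compact set $\tilde K\subset\mathsf M$ such that: for all $n\in\{1,2,\dots\}$ and $(t_i)_{1\le i\le n}\in\mathbb R_+^n$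 with $\sum_{i=1}^nt_i\le T$, there exist compact sets $(K_i)_{1\le i\le n}$ of $\mathsf M$ such that, setting $K_0=K$: (1) for all $i\in\{1,\dots,n\}$, $K_i$ only depends on $(t_j)_{1\le j\le i}$, and $\bigcup_{i=0}^nK_i\subset\tilde K$; (2) for all $i\in\{0,\dots,n-1\}$, $s_{i+1}\in[0,t_{i+1}]$ and $s_{n+1}\in[0,T-\sum_{j=1}^nt_j]$, $\bigcup_{x\in K_i}\mathrm{supp}\,Q(\varphi_{t_{i+1}}(x),\cdot)\subset K_{i+1}$, $\varphi_{s_{i+1}}(K_i)\subset\tilde K$ and $\varphi_{s_{n+1}}(K_n)\subset\tilde K$. Stability property of $(\varphi,\lambda,Q)$: (i) $\varphi$ and $Q$ are compactly compatible; (ii) $\lambda\in C^1(\mathsf M)$, $\lambda Qf\in C^1(\mathsf M)$ for all $f\in C^1(\mathsf M)$, and there exists a locally bounded function $\Psi:\mathsf M\to\mathbb R_+$ such that for all $f\in C^1(\mathsf M)$, all compact $K\subset\mathsf M$ and all $x\in K$, $\|\nabla(\lambda Qf)(x)\|\le\|\Psi\|_{\infty,K}\sup\{|f(y)|+\|\nabla f(y)\|:y\in\mathrm{supp}\,Q(x,\cdot)\}$; (iii) $(t,x)\mapsto\varphi_t(x)$ is $C^1$ on $\mathbb R_+\times\mathsf M$ and for all compact $K\subset\mathsf M$ and $t\ge0$, $\sup\{\|\nabla\varphi_s(x)\|:s\in[0,t],x\in K\}<+\infty$. *)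

theory Defs
  imports "HOL-Probability.Probability"
begin

section \<open>Differential calculus on closed submanifolds\<close>

text \<open>On an open set, continuity of all iterated directional derivatives up to order \<open>k\<close>
  is the usual notion of being of class \<open>C\<^sup>k\<close>.\<close>

primrec Ck_open :: "nat \<Rightarrow> 'a::euclidean_space set \<Rightarrow> ('a \<Rightarrow> 'b::real_normed_vector) \<Rightarrow> bool" where
  "Ck_open 0 U f \<longleftrightarrow> continuous_on U f"
| "Ck_open (Suc k) U f \<longleftrightarrow>
     f differentiable_on U \<and> (\<forall>v. Ck_open k U (\<lambda>x. frechet_derivative f (at x) v))"

definition smooth_open :: "'a::euclidean_space set \<Rightarrow> ('a \<Rightarrow> 'b::real_normed_vector) \<Rightarrow> bool" where
  "smooth_open U f \<longleftrightarrow> (\<forall>k. Ck_open k U f)"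

text \<open>Class \<open>C\<^sup>1\<close> on an arbitrary subset of a Euclidean space, in the sense of local
  \<open>C\<^sup>1\<close> extensions. On an embedded submanifold \<open>M\<close> this is the class \<open>C\<^sup>1(M)\<close>; it is also
  used for the half-line \<open>{0..}\<close> and for the manifold with boundary \<open>{0..} \<times> M\<close>.\<close>

definition C1_on :: "'a::euclidean_space set \<Rightarrow> ('a \<Rightarrow> 'b::real_normed_vector) \<Rightarrow> bool" where
  "C1_on S f \<longleftrightarrow>
     (\<forall>p\<in>S. \<exists>U g. open U \<and> p \<in> U \<and> Ck_open 1 U g \<and> (\<forall>x\<in>S \<inter> U. f x = g x))"

text \<open>Smooth embedded submanifolds (of constant dimension \<open>dim L\<close>), by slice charts, that are
  closed subsets of the ambient space. They carry the Riemannian metric induced by \<open>\<bullet>\<close>.\<close>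

definition closed_submanifold :: "'a::euclidean_space set \<Rightarrow> bool" where
  "closed_submanifold M \<longleftrightarrow> closed M \<and>
     (\<exists>L. subspace L \<and>
       (\<forall>p\<in>M. \<exists>U V h h'. open U \<and> p \<in> U \<and> open V \<and>
          homeomorphism U V h h' \<and> smooth_open U h \<and> smooth_open V h' \<and>
          h ` (M \<inter> U) = (L::'a set) \<inter> V))"

definition tangent_space :: "'a::euclidean_space set \<Rightarrow> 'a \<Rightarrow> 'a set" where
  "tangent_space M x =
     {v. \<exists>(\<gamma>::real \<Rightarrow> 'a) \<epsilon>. \<epsilon> > 0 \<and> smooth_open {-\<epsilon><..<\<epsilon>} \<gamma> \<and> \<gamma> ` {-\<epsilon><..<\<epsilon>} \<subseteq> M \<and>
        \<gamma> 0 = x \<and> (\<gamma> has_vector_derivative v) (at 0)}"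

text \<open>The derivative within \<open>M\<close> is determined on the tangent space only; the gradient is the
  tangent vector representing it, and the differential of a vector-valued map is extended by zero
  to the normal space, so that its operator norm on the ambient space is that of the tangent
  map.\<close>

definition grad :: "'a::euclidean_space set \<Rightarrow> ('a \<Rightarrow> real) \<Rightarrow> 'a \<Rightarrow> 'a" where
  "grad M f x =
     (THE v. v \<in> tangent_space M x \<and> (f has_derivative (\<lambda>w. v \<bullet> w)) (at x within M))"

definition tangent_map ::
  "'a::euclidean_space set \<Rightarrow> ('a \<Rightarrow> 'b::real_normed_vector) \<Rightarrow> 'a \<Rightarrow> 'a \<Rightarrow> 'b" where
  "tangent_map M f x =
     (THE D. (f has_derivative D) (at x within M) \<and>
        (\<forall>w. (\<forall>v\<in>tangent_space M x. v \<bullet> w = 0) \<longrightarrow> D w = 0))"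


section \<open>Homogeneous characteristics\<close>

abbreviation borel_of :: "'a::euclidean_space set \<Rightarrow> 'a measure" where
  "borel_of M \<equiv> restrict_space borel M"

definition homogeneous_flow :: "'a::euclidean_space set \<Rightarrow> (real \<Rightarrow> 'a \<Rightarrow> 'a) \<Rightarrow> bool" where
  "homogeneous_flow M \<phi> \<longleftrightarrow>
     (\<lambda>(t, x). \<phi> t x) \<in> borel_of {0..} \<Otimes>\<^sub>M borel_of M \<rightarrow>\<^sub>M borel_of M \<and>
     (\<forall>x\<in>M. \<phi> 0 x = x) \<and>
     (\<forall>t\<ge>0. \<forall>s\<ge>0. \<forall>x\<in>M. \<phi> (t + s) x = \<phi> s (\<phi> t x)) \<and>
     (\<forall>x\<in>M. C1_on {0..} (\<lambda>t. \<phi> t x)) \<and>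
     (\<forall>t\<ge>0. bij_betw (\<phi> t) M M \<and> C1_on M (\<phi> t) \<and> C1_on M (inv_into M (\<phi> t)))"

definition jump_rate :: "'a::euclidean_space set \<Rightarrow> ('a \<Rightarrow> real) \<Rightarrow> bool" where
  "jump_rate M lam \<longleftrightarrow>
     lam \<in> borel_measurable (borel_of M) \<and> (\<forall>x\<in>M. 0 \<le> lam x) \<and>
     (\<forall>K. compact K \<and> K \<subseteq> M \<longrightarrow> bounded (lam ` K))"

definition markov_kernel :: "'a::euclidean_space set \<Rightarrow> ('a \<Rightarrow> 'a measure) \<Rightarrow> bool" where
  "markov_kernel M Q \<longleftrightarrow> Q \<in> borel_of M \<rightarrow>\<^sub>M prob_algebra (borel_of M)"

definition kernel_op :: "('a \<Rightarrow> 'a measure) \<Rightarrow> ('a \<Rightarrow> real) \<Rightarrow> 'a \<Rightarrow> real" where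
  "kernel_op Q f x = (\<integral>y. f y \<partial>Q x)"

definition homogeneous_characteristics ::
  "'a::euclidean_space set \<Rightarrow> (real \<Rightarrow> 'a \<Rightarrow> 'a) \<Rightarrow> ('a \<Rightarrow> real) \<Rightarrow> ('a \<Rightarrow> 'a measure) \<Rightarrow> bool" where
  "homogeneous_characteristics M \<phi> lam Q \<longleftrightarrow>
     homogeneous_flow M \<phi> \<and> jump_rate M lam \<and> markov_kernel M Q"


section \<open>Construction of the process\<close>

abbreviation uniform01 :: "real measure" where
  "uniform01 \<equiv> restrict_space lborel {0..1}"

definition represents_kernel ::
  "'a::euclidean_space set \<Rightarrow> ('a \<Rightarrow> 'a measure) \<Rightarrow> ('a \<times> real \<Rightarrow> 'a) \<Rightarrow> bool" where
  "represents_kernel M Q G \<longleftrightarrow>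
     G \<in> borel_of M \<Otimes>\<^sub>M borel_of {0..1} \<rightarrow>\<^sub>M borel_of M \<and>
     (\<forall>x\<in>M. \<forall>A\<in>sets (borel_of M).
        emeasure (Q x) A = emeasure uniform01 {u\<in>{0..1}. G (x, u) \<in> A})"

text \<open>Canonical space of the i.i.d. pairs \<open>(E\<^sub>k, U\<^sub>k)\<close>, \<open>k \<ge> 1\<close>; the coordinate with index \<open>k\<close>
  is \<open>(E\<^bsub>k+1\<^esub>, U\<^bsub>k+1\<^esub>)\<close>.\<close>

definition noise :: "(nat \<Rightarrow> real \<times> real) measure" where
  "noise = (\<Pi>\<^sub>M k\<in>UNIV. density lborel (exponential_density 1) \<Otimes>\<^sub>M uniform01)"

definition next_jump ::
  "(real \<Rightarrow> 'a \<Rightarrow> 'a) \<Rightarrow> ('a \<Rightarrow> real) \<Rightarrow> real \<Rightarrow> 'a \<Rightarrow> real \<Rightarrow> ereal" where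
  "next_jump \<phi> lam S x e =
     Inf {ereal t | t. S \<le> t \<and> e < (LBINT s:{S..t}. lam (\<phi> (s - S) x))}"

text \<open>The sequence \<open>(S\<^sub>k, X'\<^sub>k)\<close> started from \<open>x\<close>. Once \<open>S\<^sub>k = \<infinity>\<close>, the second component is
  irrelevant.\<close>

primrec jump_chain ::
  "(real \<Rightarrow> 'a \<Rightarrow> 'a) \<Rightarrow> ('a \<Rightarrow> real) \<Rightarrow> ('a \<times> real \<Rightarrow> 'a) \<Rightarrow> 'a \<Rightarrow> (nat \<Rightarrow> real \<times> real) \<Rightarrow>
     nat \<Rightarrow> ereal \<times> 'a" where
  "jump_chain \<phi> lam G x \<omega> 0 = (0, x)"
| "jump_chain \<phi> lam G x \<omega> (Suc k) =
     (let (S, y) = jump_chain \<phi> lam G x \<omega> k in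
      if S = \<infinity> then (\<infinity>, y)
      else let S' = next_jump \<phi> lam (real_of_ereal S) y (fst (\<omega> k)) in
        if S' = \<infinity> then (\<infinity>, y)
        else (S', G (\<phi> (real_of_ereal S' - real_of_ereal S) y, snd (\<omega> k))))"

text \<open>The cemetery point is \<open>None\<close>. The intervals \<open>[S\<^sub>k, S\<^bsub>k+1\<^esub>)\<close> are pairwise disjoint, so
  that at most one \<open>k\<close> satisfies the condition.\<close>

definition pdmp ::
  "(real \<Rightarrow> 'a \<Rightarrow> 'a) \<Rightarrow> ('a \<Rightarrow> real) \<Rightarrow> ('a \<times> real \<Rightarrow> 'a) \<Rightarrow> 'a \<Rightarrow> (nat \<Rightarrow> real \<times> real) \<Rightarrow>
     real \<Rightarrow> 'a option" where
  "pdmp \<phi> lam G x \<omega> t =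
     (let S = (\<lambda>k. fst (jump_chain \<phi> lam G x \<omega> k));
          X' = (\<lambda>k. snd (jump_chain \<phi> lam G x \<omega> k));
          active = (\<lambda>k. S k \<le> ereal t \<and> ereal t < S (Suc k))
      in if \<exists>k. active k
         then let k = (LEAST k. active k) in Some (\<phi> (t - real_of_ereal (S k)) (X' k))
         else None)"

definition non_explosive ::
  "'a::euclidean_space set \<Rightarrow> (real \<Rightarrow> 'a \<Rightarrow> 'a) \<Rightarrow> ('a \<Rightarrow> real) \<Rightarrow> ('a \<times> real \<Rightarrow> 'a) \<Rightarrow> bool" where
  "non_explosive M \<phi> lam G \<longleftrightarrow>
     (\<forall>\<mu>\<^sub>0\<in>space (prob_algebra (borel_of M)).
        AE p in \<mu>\<^sub>0 \<Otimes>\<^sub>M noise.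
          Inf {ereal t | t. 0 \<le> t \<and> pdmp \<phi> lam G (fst p) (snd p) t = None} = \<infinity>)"

text \<open>Functions on \<open>M\<close> are extended by \<open>0\<close> to the cemetery point.\<close>

definition pdmp_obs ::
  "(real \<Rightarrow> 'a \<Rightarrow> 'a) \<Rightarrow> ('a \<Rightarrow> real) \<Rightarrow> ('a \<times> real \<Rightarrow> 'a) \<Rightarrow> real \<Rightarrow> ('a \<Rightarrow> real) \<Rightarrow> 'a \<Rightarrow>
     (nat \<Rightarrow> real \<times> real) \<Rightarrow> real" where
  "pdmp_obs \<phi> lam G t f x \<omega> = case_option 0 f (pdmp \<phi> lam G x \<omega> t)"

definition pdmp_semigroup ::
  "(real \<Rightarrow> 'a \<Rightarrow> 'a) \<Rightarrow> ('a \<Rightarrow> real) \<Rightarrow> ('a \<times> real \<Rightarrow> 'a) \<Rightarrow> real \<Rightarrow> ('a \<Rightarrow> real) \<Rightarrow> 'a \<Rightarrow> real" where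
  "pdmp_semigroup \<phi> lam G t f x = (\<integral>\<omega>. pdmp_obs \<phi> lam G t f x \<omega> \<partial>noise)"


section \<open>Stability property\<close>

definition measure_support :: "'a::topological_space set \<Rightarrow> 'a measure \<Rightarrow> 'a set" where
  "measure_support M \<mu> = {y\<in>M. \<forall>U. open U \<and> y \<in> U \<longrightarrow> emeasure \<mu> (U \<inter> M) > 0}"

text \<open>The compact set \<open>K\<^sub>i\<close> attached to \<open>t\<^sub>1, \<dots>, t\<^sub>n\<close> depends on \<open>t\<^sub>1, \<dots>, t\<^sub>i\<close> only: it is
  \<open>\<K> [t\<^sub>1, \<dots>, t\<^sub>i]\<close> for a function \<open>\<K>\<close> of finite sequences. List positions start at \<open>0\<close>, so
  \<open>t\<^bsub>i+1\<^esub>\<close> is \<open>ts ! i\<close>.\<close>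

definition compactly_compatible ::
  "'a::euclidean_space set \<Rightarrow> (real \<Rightarrow> 'a \<Rightarrow> 'a) \<Rightarrow> ('a \<Rightarrow> 'a measure) \<Rightarrow> bool" where
  "compactly_compatible M \<phi> Q \<longleftrightarrow>
     (\<forall>K T. compact K \<and> K \<subseteq> M \<and> 0 \<le> T \<longrightarrow>
       (\<exists>K' \<K>. compact K' \<and> K' \<subseteq> M \<and> \<K> [] = K \<and>
         (\<forall>ts::real list. ts \<noteq> [] \<and> (\<forall>t\<in>set ts. 0 \<le> t) \<and> sum_list ts \<le> T \<longrightarrow>
           (\<forall>i\<le>length ts. compact (\<K> (take i ts)) \<and> \<K> (take i ts) \<subseteq> K') \<and>
           (\<forall>i<length ts.
              (\<Union>x\<in>\<K> (take i ts). measure_support M (Q (\<phi> (ts ! i) x))) \<subseteq> \<K> (take (Suc i) ts) \<and>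
              (\<forall>s\<in>{0..ts ! i}. \<phi> s ` \<K> (take i ts) \<subseteq> K')) \<and>
           (\<forall>s\<in>{0..T - sum_list ts}. \<phi> s ` \<K> ts \<subseteq> K'))))"

definition locally_bounded_on :: "'a::topological_space set \<Rightarrow> ('a \<Rightarrow> real) \<Rightarrow> bool" where
  "locally_bounded_on M \<Psi> \<longleftrightarrow> (\<forall>x\<in>M. \<exists>U. open U \<and> x \<in> U \<and> bounded (\<Psi> ` (M \<inter> U)))"

text \<open>In the presence of \<open>compactly_compatible\<close> the supports of \<open>Q\<close> are compact and nonempty, so
  that the real suprema below are taken over bounded nonempty sets.\<close>

definition stability_property ::
  "'a::euclidean_space set \<Rightarrow> (real \<Rightarrow> 'a \<Rightarrow> 'a) \<Rightarrow> ('a \<Rightarrow> real) \<Rightarrow> ('a \<Rightarrow> 'a measure) \<Rightarrow> bool" where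
  "stability_property M \<phi> lam Q \<longleftrightarrow>
     compactly_compatible M \<phi> Q \<and>
     (C1_on M lam \<and>
      (\<forall>f. C1_on M f \<longrightarrow> C1_on M (\<lambda>x. lam x * kernel_op Q f x)) \<and>
      (\<exists>\<Psi>. (\<forall>x\<in>M. 0 \<le> \<Psi> x) \<and> locally_bounded_on M \<Psi> \<and>
        (\<forall>f K x. C1_on M f \<and> compact K \<and> K \<subseteq> M \<and> x \<in> K \<longrightarrow>
           norm (grad M (\<lambda>x. lam x * kernel_op Q f x) x)
             \<le> (SUP z\<in>K. \<bar>\<Psi> z\<bar>) *
                (SUP y\<in>measure_support M (Q x). \<bar>f y\<bar> + norm (grad M f y))))) \<and>
     (C1_on ({0..} \<times> M) (\<lambda>(t, x). \<phi> t x) \<and>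
      (\<forall>K t. compact K \<and> K \<subseteq> M \<and> 0 \<le> t \<longrightarrow>
         bdd_above ((\<lambda>(s, x). onorm (tangent_map M (\<phi> s) x)) ` ({0..t} \<times> K))))"

end

theory Submission
  imports Defs
begin

text \<open>Splitting according to the number \<open>n\<close> of jumps before time \<open>t\<close> gives \<open>P\<^sub>t f = (\<Sum>n. v\<^sub>n(t))\<close> with
  \<open>v\<^sub>0(t) = exp (- \<Lambda>\<^sub>t) * (f \<circ> \<phi>\<^sub>t)\<close>, where \<open>\<Lambda>\<^sub>t\<close> is the integral of \<open>\<lambda>\<close> along the flow, and
  \<open>v\<^sub>n\<^sub>+\<^sub>1(t)\<close> the integral of \<open>exp (- \<Lambda>\<^sub>s) * (\<lambda> Q v\<^sub>n(t - s) \<circ> \<phi>\<^sub>s)\<close> over \<open>s \<in> [0, t]\<close>.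
  The hypothesis on \<open>\<lambda> Q\<close> propagates joint continuity of \<open>(t, x) \<mapsto> v\<^sub>n(t)(x)\<close> and of its gradient, and along
  the compact sets of the compatibility condition it yields
  \<open>|v\<^sub>n(t)| + |\<nabla>v\<^sub>n(t)| \<le> c (C t)\<^sup>n / n!\<close>, so that the series converges in \<open>C\<^sup>1\<close> on compact sets.
  On the manifold, derivatives are taken within \<open>M\<close>; smooth local retractions onto \<open>M\<close> transfer the
  theorems on differentiation of integrals and series from open balls. For
  continuous \<open>f\<close>, the process started in a compact set stays in a compact set up to time \<open>t\<close>, on which
  \<open>f\<close> is a uniform limit of polynomials.\<close>

subsection \<open>Orthogonal projections\<close>

text \<open>The gradient is the tangent representative of a derivative within \<open>M\<close>,
  whereas integrals, series and the chain rule produce mere ambient vectors. Hence every gradient is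
  obtained through the orthogonal projection onto the tangent space, and the geometric input is that
  this projection depends continuously on the base point. Time integrals are rescaled to the
  interval [0, 1], so that the time enters as a parameter of the integrand and one statement on
  parameter integrals gives joint continuity and differentiability. The compact set reached changes
  with each jump, while the constants must not; the estimates are therefore proved along lists of
  past waiting times, whose sets all lie in one compact set. The probabilistic identity is proved
  with nonnegative integrals, for nonnegative functions. As the positive part of a C1 function need
  not be C1, a general function is written as a difference of two squares.\<close>

definition orth_proj :: "'a::euclidean_space set \<Rightarrow> 'a \<Rightarrow> 'a" where
  "orth_proj S x = (SOME y. y \<in> S \<and> (\<forall>z\<in>S. (x - y) \<bullet> z = 0))"

context
  fixes S :: "'a::euclidean_space set"
  assumes S: "subspace S"
begin

lemma orth_proj_props: "orth_proj S x \<in> S" "z \<in> S \<Longrightarrow> (x - orth_proj S x) \<bullet> z = 0"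
proof -
  obtain y w where "y \<in> span S" "\<And>v. v \<in> span S \<Longrightarrow> orthogonal w v" "x = y + w"
    using orthogonal_subspace_decomp_exists[of S x] by metis
  then have "\<exists>y. y \<in> S \<and> (\<forall>z\<in>S. (x - y) \<bullet> z = 0)"
    by (intro exI[of _ y]) (auto simp: orthogonal_def span_eq_iff[THEN iffD2, OF S])
  from someI_ex[OF this] show "orth_proj S x \<in> S" "z \<in> S \<Longrightarrow> (x - orth_proj S x) \<bullet> z = 0"
    by (auto simp: orth_proj_def)
qed

lemma orth_proj_unique:
  assumes "y \<in> S" "\<And>z. z \<in> S \<Longrightarrow> (x - y) \<bullet> z = 0"
  shows "orth_proj S x = y"
proof -
  let ?d = "orth_proj S x - y"
  have d: "?d \<in> S" using orth_proj_props(1) assms(1) S by (simp add: subspace_diff)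
  have "?d \<bullet> ?d = (x - y) \<bullet> ?d - (x - orth_proj S x) \<bullet> ?d" by (simp add: algebra_simps)
  also have "\<dots> = 0" using assms(2)[OF d] orth_proj_props(2)[OF d] by simp
  finally show ?thesis by simp
qed

lemma orth_proj_fixed: "x \<in> S \<Longrightarrow> orth_proj S x = x"
  by (rule orth_proj_unique) auto

lemma orth_proj_inner: "z \<in> S \<Longrightarrow> orth_proj S x \<bullet> z = x \<bullet> z"
  using orth_proj_props(2)[of z x] by (simp add: inner_diff_left)

lemma orth_proj_selfadjoint: "orth_proj S x \<bullet> y = x \<bullet> orth_proj S y"
  by (metis inner_commute orth_proj_inner orth_proj_props(1))

lemma orth_proj_linear: "linear (orth_proj S)"
  by (intro linearI orth_proj_unique)
    (simp_all add: orth_proj_props subspace_add subspace_scale S inner_diff_left inner_add_left orth_proj_inner)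

lemma norm_orth_proj_le: "norm (orth_proj S x) \<le> norm x"
proof -
  have "(norm (orth_proj S x))\<^sup>2 = x \<bullet> orth_proj S x"
    by (metis dot_square_norm orth_proj_inner orth_proj_props(1))
  also have "\<dots> \<le> norm x * norm (orth_proj S x)" by (rule norm_cauchy_schwarz)
  finally show ?thesis
    by (cases "norm (orth_proj S x) = 0") (auto simp: power2_eq_square)
qed

end

text \<open>Take \<open>u = z\<close>. The criterion lets an operator be estimated through its
  adjoint.\<close>

lemma norm_le_if_inner_le:
  fixes z :: "'a::real_inner"
  assumes "\<And>u. u \<bullet> z \<le> c * norm u" "0 \<le> c"
  shows "norm z \<le> c"
proof -
  have "norm z * norm z \<le> c * norm z" using assms(1)[of z] by (simp add: dot_square_norm power2_eq_square)
  then show ?thesis using assms(2) by (cases "norm z = 0") auto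
qed

text \<open>\<open>A\<close> and \<open>B\<close> are oblique projections. For the orthogonal
  projections P and R onto their ranges, P - R = (P - R P) + (R P - R). A vector of
  \<open>range A\<close> is fixed by \<open>A\<close>, so its image under \<open>B\<close> is a
  point of \<open>range B\<close> within \<open>d\<close> times its norm; this bounds the first
  summand. The second is the adjoint of P R - R, which up to sign is the first with \<open>A\<close>
  and \<open>B\<close> exchanged. Each costs \<open>d\<close>.\<close>

lemma orth_proj_range_diff:
  fixes A B :: "'a::euclidean_space \<Rightarrow> 'a"
  assumes A: "linear A" "\<And>x. A (A x) = A x" and B: "linear B" "\<And>x. B (B x) = B x"
    and d: "\<And>x. norm (A x - B x) \<le> d * norm x" "0 \<le> d"
  shows "norm (orth_proj (range A) w - orth_proj (range B) w) \<le> 2 * d * norm w"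
proof -
  let ?P = "orth_proj (range A)" and ?R = "orth_proj (range B)"
  have SA: "subspace (range A)" and SB: "subspace (range B)"
    using A(1) B(1) by (auto simp: linear_subspace_image)
  note pA = orth_proj_props[OF SA] orth_proj_inner[OF SA] orth_proj_selfadjoint[OF SA]
    norm_orth_proj_le[OF SA] orth_proj_fixed[OF SA]
  note pB = orth_proj_props[OF SB] orth_proj_inner[OF SB] orth_proj_selfadjoint[OF SB]
    norm_orth_proj_le[OF SB] orth_proj_fixed[OF SB]
  have key: "norm (orth_proj (range C) v - orth_proj (range D) (orth_proj (range C) v)) \<le> d * norm v"
    if C: "linear C" "\<And>x. C (C x) = C x" and D: "linear D" and e: "\<And>x. norm (C x - D x) \<le> d * norm x"
    for C D :: "'a \<Rightarrow> 'a" and v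
  proof -
    have SC: "subspace (range C)" and SD: "subspace (range D)"
      using C(1) D(1) by (auto simp: linear_subspace_image)
    let ?y = "orth_proj (range C) v"
    have "C ?y = ?y" using orth_proj_props(1)[OF SC, of v] C(2) by auto
    moreover have "orth_proj (range D) (D ?y) = D ?y" by (rule orth_proj_fixed[OF SD]) simp
    \<comment> \<open>The vector \<open>D ?y\<close> is fixed by the projection onto
      \<open>range D\<close>, so subtracting it in both places changes nothing.\<close>
    ultimately have eq: "?y - orth_proj (range D) ?y
        = (C ?y - D ?y) - orth_proj (range D) (C ?y - D ?y)"
      by (simp add: linear_diff[OF orth_proj_linear[OF SD]])
    have "norm (z - orth_proj (range D) z) \<le> norm z" for z
    proof -
      have "orthogonal (z - orth_proj (range D) z) (orth_proj (range D) z)"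
        unfolding orthogonal_def by (rule orth_proj_props(2)[OF SD orth_proj_props(1)[OF SD]])
      from norm_add_Pythagorean[OF this] have "(norm (z - orth_proj (range D) z))\<^sup>2 \<le> (norm z)\<^sup>2"
        by simp
      then show ?thesis by (rule power2_le_imp_le) simp
    qed
    then have "norm (?y - orth_proj (range D) ?y) \<le> norm (C ?y - D ?y)" unfolding eq .
    also have "\<dots> \<le> d * norm ?y" by (rule e)
    also have "\<dots> \<le> d * norm v" using norm_orth_proj_le[OF SC, of v] d(2) by (rule mult_left_mono)
    finally show ?thesis .
  qed
  have 1: "norm (?P w - ?R (?P w)) \<le> d * norm w" by (rule key[OF A B(1) d(1)])
  have 2: "norm (?R (?P w) - ?R w) \<le> d * norm w"
  proof (rule norm_le_if_inner_le)
    fix u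
    have "u \<bullet> (?R (?P w) - ?R w) = (?P (?R u) - ?R u) \<bullet> w"
      using pA(4)[of "?R u" w] pB(4)[of u "?P w"] pB(4)[of u w] by (simp add: inner_diff_left inner_diff_right)
    also have "\<dots> \<le> norm (?P (?R u) - ?R u) * norm w" by (rule norm_cauchy_schwarz)
    also have "\<dots> \<le> d * norm u * norm w"
      using key[OF B A(1), of u] d(1) by (intro mult_right_mono) (simp_all add: norm_minus_commute)
    finally show "u \<bullet> (?R (?P w) - ?R w) \<le> d * norm w * norm u" by (simp add: mult_ac)
  qed (use d in auto)
  have "norm (?P w - ?R w) \<le> norm (?P w - ?R (?P w)) + norm (?R (?P w) - ?R w)"
    using norm_triangle_ineq[of "?P w - ?R (?P w)" "?R (?P w) - ?R w"] by simp
  with 1 2 show ?thesis by simp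
qed


subsection \<open>Local retractions and gradients\<close>

lemma Ck_open_cong:
  assumes "open U" "\<And>x. x \<in> U \<Longrightarrow> f x = g x"
  shows "Ck_open k U f \<longleftrightarrow> Ck_open k U g"
  using assms(2)
proof (induction k arbitrary: f g)
  case 0
  then show ?case using continuous_on_cong by auto
next
  case (Suc k)
  have "f differentiable at x \<longleftrightarrow> g differentiable at x" if "x \<in> U" for x
  proof -
    have "(f has_derivative D) (at x) \<longleftrightarrow> (g has_derivative D) (at x)" for D
      using has_derivative_transform_within_open[OF _ assms(1) that] Suc.prems by metis
    then show ?thesis by (simp add: differentiable_def)
  qed
  then have 1: "f differentiable_on U \<longleftrightarrow> g differentiable_on U"
    by (simp add: differentiable_on_def at_within_open[OF _ assms(1)])
  have "frechet_derivative f (at x) = frechet_derivative g (at x)" if "x \<in> U" for x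
  proof -
    have "(f has_derivative D) (at x) \<longleftrightarrow> (g has_derivative D) (at x)" for D
      using has_derivative_transform_within_open[OF _ assms(1) that] Suc.prems by metis
    then show ?thesis by (simp add: frechet_derivative_def)
  qed
  then have "Ck_open k U (\<lambda>x. frechet_derivative f (at x) v) \<longleftrightarrow> Ck_open k U (\<lambda>x. frechet_derivative g (at x) v)" for v
    by (intro Suc.IH) simp
  with 1 show ?case by simp
qed

lemma Ck_open_1I:
  assumes "open U" "\<And>x. x \<in> U \<Longrightarrow> (f has_derivative f' x) (at x)" "\<And>w. continuous_on U (\<lambda>x. f' x w)"
  shows "Ck_open 1 U f"
proof -
  have "frechet_derivative f (at x) = f' x" if "x \<in> U" for x
    using frechet_derivative_at[OF assms(2)[OF that]] by simp
  then have "continuous_on U (\<lambda>x. frechet_derivative f (at x) w)" for w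
    using assms(3)[of w] by (simp cong: continuous_on_cong)
  moreover have "f differentiable_on U"
    using assms(2) by (auto simp: differentiable_on_def differentiable_def intro: has_derivative_at_withinI)
  ultimately show ?thesis by simp
qed

lemma Ck_open_1D:
  assumes "open U" "Ck_open 1 U f"
  shows "\<And>x. x \<in> U \<Longrightarrow> (f has_derivative frechet_derivative f (at x)) (at x)"
    "\<And>w. continuous_on U (\<lambda>x. frechet_derivative f (at x) w)"
proof -
  have "f differentiable (at x)" if "x \<in> U" for x
    using assms that at_within_open[OF that assms(1)] by (auto simp: differentiable_on_def)
  then show "\<And>x. x \<in> U \<Longrightarrow> (f has_derivative frechet_derivative f (at x)) (at x)"
    by (simp only: frechet_derivative_works)
qed (use assms(2) in simp)

text \<open>Induction on \<open>k\<close>: the derivative of the restriction in direction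
  \<open>v\<close> is the derivative of \<open>F\<close> in the fixed direction
  \<open>v *\<^sub>R u\<close>, restricted to the same line. Segments carried over by an inverse
  chart thus become the smooth curves demanded by \<open>tangent_space\<close>.\<close>

lemma Ck_open_line:
  fixes F :: "'a::euclidean_space \<Rightarrow> 'b::real_normed_vector" and c u :: 'a
  assumes "open V" "open W" "\<And>s. s \<in> W \<Longrightarrow> c + s *\<^sub>R u \<in> V" "Ck_open k V F"
  shows "Ck_open k W (\<lambda>s::real. F (c + s *\<^sub>R u))"
  using assms(4)
proof (induction k arbitrary: F)
  case 0
  have "continuous_on W (\<lambda>s::real. c + s *\<^sub>R u)" by (intro continuous_intros)
  then show ?case using 0 assms(3) continuous_on_compose2[of V F W "\<lambda>s. c + s *\<^sub>R u"] by auto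
next
  case (Suc k)
  have der: "((\<lambda>s. F (c + s *\<^sub>R u)) has_derivative (\<lambda>v. frechet_derivative F (at (c + s *\<^sub>R u)) (v *\<^sub>R u))) (at s)"
    if "s \<in> W" for s
  proof -
    have "(F has_derivative frechet_derivative F (at (c + s *\<^sub>R u))) (at (c + s *\<^sub>R u))"
      using Suc.prems assms(3)[OF that] at_within_open[OF assms(3)[OF that] assms(1)]
      unfolding frechet_derivative_works[symmetric] by (auto simp: differentiable_on_def)
    moreover have "((\<lambda>s. c + s *\<^sub>R u) has_derivative (\<lambda>v. v *\<^sub>R u)) (at s)"
      by (auto intro!: derivative_eq_intros)
    ultimately show ?thesis using diff_chain_at[of "\<lambda>s. c + s *\<^sub>R u"] by (fastforce simp: o_def)
  qed
  have "Ck_open k W (\<lambda>s. frechet_derivative F (at (c + s *\<^sub>R u)) (v *\<^sub>R u))" for v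
    using Suc by (intro Suc.IH) simp
  then have "Ck_open k W (\<lambda>s. frechet_derivative (\<lambda>s. F (c + s *\<^sub>R u)) (at s) v)" for v
    using Ck_open_cong[OF assms(2), of "\<lambda>s. frechet_derivative (\<lambda>s. F (c + s *\<^sub>R u)) (at s) v"
        "\<lambda>s. frechet_derivative F (at (c + s *\<^sub>R u)) (v *\<^sub>R u)" k]
      frechet_derivative_at[OF der] by metis
  moreover have "(\<lambda>s. F (c + s *\<^sub>R u)) differentiable_on W"
    using der by (auto simp: differentiable_on_def differentiable_def intro: has_derivative_at_withinI)
  ultimately show ?case by simp
qed

lemma linear_euclidean_sum:
  fixes f :: "'a::euclidean_space \<Rightarrow> 'b::real_vector"
  assumes "linear f"
  shows "f x = (\<Sum>b\<in>Basis. (x \<bullet> b) *\<^sub>R f b)"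
proof -
  have "f x = f (\<Sum>b\<in>Basis. (x \<bullet> b) *\<^sub>R b)" by (simp add: euclidean_representation)
  then show ?thesis by (simp add: linear_sum[OF assms] linear_scale[OF assms])
qed

text \<open>Expand \<open>z x\<close> in the basis: in finite dimension continuity of
  \<open>D\<close> at each fixed vector is enough, and \<open>Ck_open\<close> supplies exactly this
  vectorwise continuity.\<close>

lemma continuous_on_linear_apply:
  fixes D :: "'c::topological_space \<Rightarrow> 'a::euclidean_space \<Rightarrow> 'b::real_normed_vector"
  assumes "\<And>x. x \<in> S \<Longrightarrow> linear (D x)" "\<And>w. continuous_on S (\<lambda>x. D x w)" "continuous_on S z"
  shows "continuous_on S (\<lambda>x. D x (z x))"
proof -
  have "continuous_on S (\<lambda>x. \<Sum>b\<in>Basis. (z x \<bullet> b) *\<^sub>R D x b)"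
    using assms(2,3) by (intro continuous_intros) auto
  then show ?thesis using linear_euclidean_sum[OF assms(1)] by (simp cong: continuous_on_cong)
qed

text \<open>In a slice chart \<open>h\<close> the retraction is \<open>r = h\<inverse> \<circ> P\<^sub>L \<circ> h\<close>.\<close>

lemma local_retraction:
  fixes M :: "'a::euclidean_space set"
  assumes M: "closed_submanifold M" and p: "p \<in> M"
  obtains U r r' where "open U" "p \<in> U" "\<And>u. u \<in> U \<Longrightarrow> r u \<in> M \<inter> U" "\<And>u. u \<in> M \<inter> U \<Longrightarrow> r u = u"
    "\<And>u. u \<in> U \<Longrightarrow> (r has_derivative r' u) (at u)" "\<And>w. continuous_on U (\<lambda>u. r' u w)"
    "\<And>x. x \<in> M \<inter> U \<Longrightarrow> tangent_space M x = range (r' x)"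
proof -
  obtain L :: "'a set" where L: "subspace L" and ch: "\<forall>p\<in>M. \<exists>U V h h'. open U \<and> p \<in> U \<and> open V \<and>
          homeomorphism U V h h' \<and> smooth_open U h \<and> smooth_open V h' \<and> h ` (M \<inter> U) = L \<inter> V"
    using M unfolding closed_submanifold_def by blast
  from ch p obtain U V h h' where U: "open U" "p \<in> U" and V: "open V" and hom: "homeomorphism U V h h'"
    and sm: "smooth_open U h" "smooth_open V h'" and im: "h ` (M \<inter> U) = L \<inter> V"
    by metis
  define P where "P = orth_proj L"
  note Pp = orth_proj_props[OF L, folded P_def] orth_proj_fixed[OF L, folded P_def] orth_proj_linear[OF L, folded P_def]
  have blP: "bounded_linear P" using Pp(4) linear_conv_bounded_linear by blast
  have Ck: "Ck_open 1 U h" "Ck_open 1 V h'" using sm unfolding smooth_open_def by blast+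
  define Dh where "Dh x = frechet_derivative h (at x)" for x
  define Dh' where "Dh' x = frechet_derivative h' (at x)" for x
  note dh = Ck_open_1D[OF U(1) Ck(1), folded Dh_def] and dh' = Ck_open_1D[OF V Ck(2), folded Dh'_def]
  have hV: "h x \<in> V" "h' (h x) = x" if "x \<in> U" for x using hom that by (auto simp: homeomorphism_def)
  have hU: "h' y \<in> U" "h (h' y) = y" if "y \<in> V" for y using hom that by (auto simp: homeomorphism_def)
  have linDh: "linear (Dh x)" if "x \<in> U" for x using dh(1)[OF that] has_derivative_linear by blast
  have linDh': "linear (Dh' x)" if "x \<in> V" for x using dh'(1)[OF that] has_derivative_linear by blast
  have inM: "h' y \<in> M" if "y \<in> L \<inter> V" for y using that im hV by (metis IntD1 IntD2 imageE)
  have conth: "continuous_on U h" "continuous_on V h'" using hom by (auto simp: homeomorphism_def)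
  \<comment> \<open>The projected chart image may leave \<open>V\<close>; shrinking to
    \<open>U'\<close> keeps \<open>r\<close> meaningful. No point of \<open>M\<close> is lost,
    because \<open>P\<close> fixes the chart images of \<open>M\<close>.\<close>
  define U' where "U' = U \<inter> (\<lambda>x. P (h x)) -` V"
  define r where "r x = h' (P (h x))" for x
  define r' where "r' x = (\<lambda>w. Dh' (P (h x)) (P (Dh x w)))" for x
  have contPh: "continuous_on U (\<lambda>x. P (h x))"
    using conth(1) by (intro bounded_linear.continuous_on[OF blP])
  have oU': "open U'" unfolding U'_def
    using contPh U(1) V by (rule continuous_open_preimage)
  have U'U: "U' \<subseteq> U" and U'V: "\<And>x. x \<in> U' \<Longrightarrow> P (h x) \<in> V" by (auto simp: U'_def)
  have Ph: "P (h x) = h x" if "x \<in> M \<inter> U" for x using im that by (intro Pp(3)) auto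
  have MU': "M \<inter> U' = M \<inter> U" using Ph hV(1) by (auto simp: U'_def)
  have rfix: "r u = u" if "u \<in> M \<inter> U'" for u using that Ph hV(2) MU' by (simp add: r_def)
  have rin: "r u \<in> M \<inter> U'" if "u \<in> U'" for u
    using that MU' hU(1)[OF U'V[OF that]] inM[of "P (h u)"] U'V[OF that] Pp(1) unfolding r_def by auto
  have dr: "(r has_derivative r' u) (at u)" if "u \<in> U'" for u
  proof -
    have "((\<lambda>x. P (h x)) has_derivative (\<lambda>w. P (Dh u w))) (at u)"
      using dh(1)[of u] that U'U by (intro bounded_linear.has_derivative[OF blP]) auto
    from diff_chain_at[OF this dh'(1)[OF U'V[OF that]]]
    show ?thesis unfolding r_def r'_def o_def .
  qed
  have cr': "continuous_on U' (\<lambda>u. r' u w)" for w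
    unfolding r'_def
  proof (rule continuous_on_linear_apply[where D = "\<lambda>x. Dh' (P (h x))" and z = "\<lambda>x. P (Dh x w)"])
    show "linear (Dh' (P (h x)))" if "x \<in> U'" for x using U'V[OF that] by (rule linDh')
    show "continuous_on U' (\<lambda>x. Dh' (P (h x)) w)" for w
      by (rule continuous_on_compose2[OF dh'(2)]) (use U'V continuous_on_subset[OF contPh U'U] in auto)
    show "continuous_on U' (\<lambda>x. P (Dh x w))"
      using continuous_on_subset[OF dh(2) U'U] by (intro bounded_linear.continuous_on[OF blP])
  qed
  have rr': "r' x = (\<lambda>w. Dh' (h x) (P (Dh x w)))" if "x \<in> M \<inter> U'" for x
    using Ph that MU' by (auto simp: r'_def)
  have surj: "Dh x (Dh' (h x) w) = w" if "x \<in> U" for x w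
  proof -
    have "((h \<circ> h') has_derivative (Dh x \<circ> Dh' (h x))) (at (h x))"
      by (rule diff_chain_at) (use dh(1)[OF that] dh'(1)[OF hV(1)[OF that]] hV(2)[OF that] in auto)
    then have "((\<lambda>y. y) has_derivative (Dh x \<circ> Dh' (h x))) (at (h x))"
      using has_derivative_transform_within_open[OF _ V hV(1)[OF that], of "h \<circ> h'" _ UNIV "\<lambda>y. y"] hU(2)
      by fastforce
    from has_derivative_unique[OF this has_derivative_ident] show ?thesis by (simp add: fun_eq_iff)
  qed
  have tan: "tangent_space M x = range (r' x)" if x: "x \<in> M \<inter> U'" for x
  proof safe
    fix v assume "v \<in> tangent_space M x"
    then obtain \<gamma> \<epsilon> where g: "\<epsilon> > 0" "\<gamma> ` {-\<epsilon><..<\<epsilon>} \<subseteq> M" "\<gamma> 0 = x" "(\<gamma> has_vector_derivative v) (at (0::real))"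
      by (auto simp: tangent_space_def)
    have "continuous (at 0) \<gamma>" using g(4) has_vector_derivative_continuous by blast
    then have "eventually (\<lambda>s. \<gamma> s \<in> U') (at 0)"
      using oU' x g(3) by (auto simp: continuous_at dest!: topological_tendstoD)
    then obtain \<delta> where \<delta>0: "\<delta> > 0" "\<And>s. s \<noteq> 0 \<Longrightarrow> dist s 0 < \<delta> \<Longrightarrow> \<gamma> s \<in> U'"
      unfolding eventually_at by auto
    have \<delta>: "\<delta> > 0" "\<And>s. \<bar>s\<bar> < \<delta> \<Longrightarrow> \<gamma> s \<in> U'"
      using \<delta>0 x g(3) by (metis IntD2 dist_0_norm dist_commute real_norm_def)+
    let ?W = "{- min \<epsilon> \<delta><..<min \<epsilon> \<delta>}"
    \<comment> \<open>Near 0 the curve lies in \<open>M\<close>, where \<open>r\<close> is the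
      identity, so \<open>r \<circ> \<gamma>\<close> and \<open>\<gamma>\<close> have the same
      derivative: \<open>v = r' x v\<close>.\<close>
    have "((r \<circ> \<gamma>) has_derivative (r' x \<circ> (\<lambda>s. s *\<^sub>R v))) (at 0)"
      using g(4) dr[of x] x unfolding has_vector_derivative_def by (intro diff_chain_at) (auto simp: g(3))
    moreover have "(r \<circ> \<gamma>) s = \<gamma> s" if "s \<in> ?W" for s
    proof -
      have "s \<in> {-\<epsilon><..<\<epsilon>}" "\<bar>s\<bar> < \<delta>" using that by auto
      then have "\<gamma> s \<in> M \<inter> U'" using \<delta>(2)[of s] g(2) by blast
      then show ?thesis by (simp add: rfix)
    qed
    ultimately have "(\<gamma> has_derivative (r' x \<circ> (\<lambda>s. s *\<^sub>R v))) (at 0)"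
      using has_derivative_transform_within_open[of "r \<circ> \<gamma>" _ 0 UNIV ?W \<gamma>] g(1) \<delta>(1) by auto
    with g(4) have "(\<lambda>s. s *\<^sub>R v) = r' x \<circ> (\<lambda>s. s *\<^sub>R v)"
      unfolding has_vector_derivative_def by (rule has_derivative_unique)
    then have "v = r' x v" by (metis comp_apply scaleR_one)
    then show "v \<in> range (r' x)" by blast
  next
    fix w
    \<comment> \<open>The segment from \<open>h x\<close> in direction \<open>u\<close> stays in
      \<open>L\<close>, and its image under \<open>h'\<close> is a curve in \<open>M\<close> with
      velocity \<open>r' x w\<close>.\<close>
    define u where "u = P (Dh x w)"
    have u: "u \<in> L" by (simp add: u_def Pp(1))
    have xU: "x \<in> U" using x U'U by auto
    have hxL: "h x \<in> L" using Ph[of x] Pp(1) x xU by (metis IntD1 IntI)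
    obtain e where e: "e > 0" "ball (h x) e \<subseteq> V" using V hV(1)[OF xU] open_contains_ball by blast
    \<comment> \<open>Short enough for the segment to stay in the ball inside \<open>V\<close>; the
      added 1 avoids a division by zero when \<open>u = 0\<close>.\<close>
    define \<epsilon> where "\<epsilon> = e / (norm u + 1)"
    have \<epsilon>: "\<epsilon> > 0" using e(1) by (simp add: \<epsilon>_def add_nonneg_pos)
    have inV: "h x + s *\<^sub>R u \<in> V" if "s \<in> {-\<epsilon><..<\<epsilon>}" for s
    proof -
      have "\<bar>s\<bar> * norm u \<le> \<epsilon> * norm u" using that by (intro mult_right_mono) auto
      also have "\<dots> < \<epsilon> * (norm u + 1)" using \<epsilon> by simp
      also have "\<dots> = e" using norm_ge_zero[of u] by (simp add: \<epsilon>_def del: norm_ge_zero)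
      finally show ?thesis using e(2) by (auto simp: dist_norm)
    qed
    define \<gamma> where "\<gamma> s = h' (h x + s *\<^sub>R u)" for s :: real
    have "smooth_open {-\<epsilon><..<\<epsilon>} \<gamma>"
      unfolding smooth_open_def \<gamma>_def using sm(2) inV V
      by (auto intro!: Ck_open_line[of V] simp: smooth_open_def)
    moreover have "\<gamma> ` {-\<epsilon><..<\<epsilon>} \<subseteq> M"
      using inV u hxL L by (auto simp: \<gamma>_def subspace_add subspace_scale intro!: inM)
    moreover have "\<gamma> 0 = x" using hV(2)[OF xU] by (simp add: \<gamma>_def)
    moreover have "(\<gamma> has_vector_derivative r' x w) (at 0)"
    proof -
      have "((\<lambda>s::real. h x + s *\<^sub>R u) has_derivative (\<lambda>s. s *\<^sub>R u)) (at 0)"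
        by (auto intro!: derivative_eq_intros)
      moreover have "(h' has_derivative Dh' (h x)) (at (h x + 0 *\<^sub>R u))" using dh'(1)[OF hV(1)[OF xU]] by simp
      ultimately have "((h' \<circ> (\<lambda>s::real. h x + s *\<^sub>R u)) has_derivative (Dh' (h x) \<circ> (\<lambda>s. s *\<^sub>R u))) (at 0)"
        by (rule diff_chain_at)
      then show ?thesis
        using linear_scale[OF linDh'[OF hV(1)[OF xU]]] rr'[OF x]
        by (simp add: has_vector_derivative_def \<gamma>_def[abs_def] o_def u_def)
    qed
    ultimately show "r' x w \<in> tangent_space M x"
      using \<epsilon> unfolding tangent_space_def by blast
  qed
  have "p \<in> U'" using U(2) p MU' by blast
  from that[OF oU' this rin rfix dr cr' tan] show thesis .
qed

lemma continuous_on_locally: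
  fixes f :: "'a::t2_space \<Rightarrow> 'b::topological_space"
  assumes "\<And>p. p \<in> S \<Longrightarrow> \<exists>U. open U \<and> p \<in> U \<and> continuous_on (S \<inter> U) f"
  shows "continuous_on S f"
  unfolding continuous_on_eq_continuous_within
proof
  fix p assume p: "p \<in> S"
  then obtain U where U: "open U" "p \<in> U" "continuous_on (S \<inter> U) f" using assms by blast
  then have "continuous (at p within S \<inter> U) f" using p by (simp add: continuous_on_eq_continuous_within)
  moreover have "at p within S \<inter> U = at p within S"
    using U by (intro at_within_nhd[of p U]) auto
  ultimately show "continuous (at p within S) f" by simp
qed

lemma has_derivative_transform_locally:
  assumes "(f has_derivative D) (at x within S)" "open U" "x \<in> U" "x \<in> S" "\<And>y. y \<in> S \<inter> U \<Longrightarrow> f y = g y"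
  shows "(g has_derivative D) (at x within S)"
proof -
  obtain e where e: "e > 0" "ball x e \<subseteq> U" using assms(2,3) open_contains_ball by blast
  show ?thesis
    by (rule has_derivative_transform_within[OF assms(1) e(1) assms(4)])
      (use e(2) assms(5) in \<open>auto simp: dist_commute subset_eq\<close>)
qed

section \<open>Differentiation within the submanifold\<close>

locale submanifold =
  fixes M :: "'a::euclidean_space set"
  assumes submanifold: "closed_submanifold M"
begin

lemma closed_M: "closed M"
  using submanifold by (simp add: closed_submanifold_def)

lemma M_borel: "M \<in> sets borel"
  using closed_M by simp

lemma compact_cball_Int: "compact (cball p r \<inter> M)"
  using closed_M by (simp add: compact_Int_closed)

lemma retraction:
  assumes "p \<in> M"
  obtains U r r' where "open U" "p \<in> U" "\<And>u. u \<in> U \<Longrightarrow> r u \<in> M \<inter> U" "\<And>u. u \<in> M \<inter> U \<Longrightarrow> r u = u"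
    "\<And>u. u \<in> U \<Longrightarrow> (r has_derivative r' u) (at u)" "\<And>w. continuous_on U (\<lambda>u. r' u w)"
    "\<And>x. x \<in> M \<inter> U \<Longrightarrow> tangent_space M x = range (r' x)"
  using local_retraction[OF submanifold assms] by metis

definition tproj :: "'a \<Rightarrow> 'a \<Rightarrow> 'a" where "tproj x = orth_proj (tangent_space M x)"

text \<open>Tangent vectors are velocities of curves, for which sums are not evident; as the range
  of the derivative of a local retraction the tangent space is visibly linear.\<close>

lemma subspace_tangent_space: "x \<in> M \<Longrightarrow> subspace (tangent_space M x)"
  by (rule retraction[of x]) (auto intro!: linear_subspace_image dest!: has_derivative_linear)

lemmas tproj_in = orth_proj_props(1)[OF subspace_tangent_space, folded tproj_def]
  and tproj_unique = orth_proj_unique[OF subspace_tangent_space, folded tproj_def]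
  and tproj_fixed = orth_proj_fixed[OF subspace_tangent_space, folded tproj_def]
  and tproj_selfadjoint = orth_proj_selfadjoint[OF subspace_tangent_space, folded tproj_def]
  and tproj_linear = orth_proj_linear[OF subspace_tangent_space, folded tproj_def]
  and norm_tproj_le = norm_orth_proj_le[OF subspace_tangent_space, folded tproj_def]

text \<open>Differentiate \<open>r \<circ> r = r\<close> at a fixed point of \<open>r\<close>. The
  derivative is an oblique projection onto the tangent space, the situation of
  \<open>orth_proj_range_diff\<close>.\<close>

lemma retraction_derivative_idem:
  assumes "open U" "\<And>u. u \<in> U \<Longrightarrow> r u \<in> M \<inter> U" "\<And>u. u \<in> M \<inter> U \<Longrightarrow> r u = u"
    "\<And>u. u \<in> U \<Longrightarrow> (r has_derivative r' u) (at u)" "x \<in> M \<inter> U"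
  shows "r' x (r' x w) = r' x w"
proof -
  have "(r has_derivative r' x) (at (r x))" using assms(3-5) by auto
  from diff_chain_at[OF assms(4) this] assms(5) have "(r \<circ> r has_derivative r' x \<circ> r' x) (at x)" by auto
  then have "(r has_derivative r' x \<circ> r' x) (at x)"
    by (rule has_derivative_transform_locally[of _ _ _ _ U]) (use assms in auto)
  from has_derivative_unique[OF this assms(4)] assms(5) show ?thesis by (auto simp: fun_eq_iff)
qed

text \<open>Locally the tangent space is the range of \<open>r' x\<close>, which varies continuously
  with \<open>x\<close>; \<open>orth_proj_range_diff\<close> transfers this to the orthogonal
  projections.\<close>

lemma continuous_tproj: "continuous_on M (\<lambda>x. tproj x w)"
proof (rule continuous_on_locally)
  fix p assume "p \<in> M"
  then obtain U r r' where U: "open U" "p \<in> U" "\<And>u. u \<in> U \<Longrightarrow> r u \<in> M \<inter> U" "\<And>u. u \<in> M \<inter> U \<Longrightarrow> r u = u"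
    "\<And>u. u \<in> U \<Longrightarrow> (r has_derivative r' u) (at u)" "\<And>w. continuous_on U (\<lambda>u. r' u w)"
    "\<And>x. x \<in> M \<inter> U \<Longrightarrow> tangent_space M x = range (r' x)" using retraction by metis
  note lin = has_derivative_linear[OF U(5)]
  have "continuous_on (M \<inter> U) (\<lambda>x. tproj x w)"
    unfolding continuous_on_def
  proof
    fix q assume q: "q \<in> M \<inter> U"
    \<comment> \<open>A bound for the operator norm of \<open>r' x - r' q\<close>, built from
      finitely many vectors so that vectorwise continuity gives the limit 0.\<close>
    define d where "d x = (\<Sum>b\<in>Basis. norm (r' x b - r' q b))" for x
    have bd: "norm (r' x z - r' q z) \<le> d x * norm z" if "x \<in> M \<inter> U" for x z
    proof -
      have "r' x z - r' q z = (\<Sum>b\<in>Basis. (z \<bullet> b) *\<^sub>R (r' x b - r' q b))"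
        using linear_euclidean_sum[OF lin, of x z] linear_euclidean_sum[OF lin, of q z] that q
        by (simp add: algebra_simps sum_subtractf)
      also have "norm \<dots> \<le> (\<Sum>b\<in>Basis. \<bar>z \<bullet> b\<bar> * norm (r' x b - r' q b))"
        by (rule order_trans[OF norm_sum]) simp
      also have "\<dots> \<le> (\<Sum>b\<in>Basis. norm z * norm (r' x b - r' q b))"
        by (intro sum_mono mult_right_mono Basis_le_norm) auto
      finally show ?thesis by (simp add: d_def sum_distrib_left mult.commute)
    qed
    have "continuous_on U d" unfolding d_def by (intro continuous_intros U(6))
    then have "continuous_on (M \<inter> U) d" by (rule continuous_on_subset) auto
    moreover have "d q = 0" by (simp add: d_def)
    ultimately have lim: "(d \<longlongrightarrow> 0) (at q within M \<inter> U)" using q unfolding continuous_on_def by metis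
    have "\<forall>\<^sub>F x in at q within M \<inter> U. dist (tproj x w) (tproj q w) \<le> 2 * d x * norm w"
      unfolding eventually_at_filter
    proof (intro always_eventually allI impI)
      fix x assume x: "x \<in> M \<inter> U"
      note idem = retraction_derivative_idem[OF U(1,3,4,5)]
      show "dist (tproj x w) (tproj q w) \<le> 2 * d x * norm w"
        unfolding dist_norm tproj_def U(7)[OF x] U(7)[OF q]
        by (rule orth_proj_range_diff) (use x q lin idem bd in \<open>auto simp: d_def sum_nonneg\<close>)
    qed
    then have ev: "\<forall>\<^sub>F x in at q within M \<inter> U. dist (tproj x w) (tproj q w) \<le> dist (2 * d x * norm w) 0"
      by (rule eventually_mono) (simp add: dist_real_def)
    have "((\<lambda>x. 2 * d x * norm w) \<longlongrightarrow> 2 * 0 * norm w) (at q within M \<inter> U)"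
      by (intro tendsto_intros lim)
    then have "((\<lambda>x. 2 * d x * norm w) \<longlongrightarrow> 0) (at q within M \<inter> U)" by simp
    from metric_tendsto_imp_tendsto[OF this ev]
    show "((\<lambda>x. tproj x w) \<longlongrightarrow> tproj q w) (at q within M \<inter> U)" .
  qed
  with U(1,2) show "\<exists>U. open U \<and> p \<in> U \<and> continuous_on (M \<inter> U) (\<lambda>x. tproj x w)" by blast
qed

lemma continuous_on_tproj:
  assumes "continuous_on S \<xi>" "\<xi> ` S \<subseteq> M" "continuous_on S z"
  shows "continuous_on S (\<lambda>s. tproj (\<xi> s) (z s))"
  by (rule continuous_on_linear_apply[where D = "\<lambda>s. tproj (\<xi> s)" and z = z])
    (use assms tproj_linear in \<open>auto intro: continuous_on_compose2[OF continuous_tproj]\<close>)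

text \<open>Composition with a retraction replaces a derivative within \<open>M\<close> by an
  ordinary one on an open set, where derivatives are unique and the standard theorems apply.\<close>

lemma retraction_derivative_within:
  assumes "open U" "\<And>u. u \<in> U \<Longrightarrow> r u \<in> M \<inter> U" "\<And>u. u \<in> M \<inter> U \<Longrightarrow> r u = u"
    "\<And>u. u \<in> U \<Longrightarrow> (r has_derivative r' u) (at u)" "x \<in> U"
    "(f has_derivative D) (at (r x) within M)"
  shows "((\<lambda>u. f (r u)) has_derivative (\<lambda>w. D (r' x w))) (at x)"
proof -
  have "(f \<circ> r has_derivative D \<circ> r' x) (at x within U)"
    by (rule diff_chain_within) (use assms in \<open>auto intro: has_derivative_at_withinI has_derivative_subset\<close>)
  then show ?thesis using at_within_open[OF assms(5,1)] by (simp add: o_def)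
qed

text \<open>The transfer back to \<open>M\<close>. There \<open>f\<close> and
  \<open>f \<circ> r\<close> agree near \<open>x\<close>, which gives the derivative
  \<open>D (r' x w)\<close>; it remains to remove \<open>r' x\<close>.\<close>

lemma has_derivative_within_iff_retraction:
  assumes "open U" "\<And>u. u \<in> U \<Longrightarrow> r u \<in> M \<inter> U" "\<And>u. u \<in> M \<inter> U \<Longrightarrow> r u = u"
    "\<And>u. u \<in> U \<Longrightarrow> (r has_derivative r' u) (at u)" "x \<in> M \<inter> U"
    "((\<lambda>u. f (r u)) has_derivative (\<lambda>w. D (r' x w))) (at x)" "bounded_linear D"
  shows "(f has_derivative D) (at x within M)"
proof -
  \<comment> \<open>Since \<open>r u - u\<close> vanishes on \<open>M\<close> near \<open>x\<close>,
    the nonzero map \<open>r' x w - w\<close> is also a derivative of 0 within \<open>M\<close>; its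
    image under \<open>D\<close> is the correction to subtract.\<close>
  have "((\<lambda>u. r u - u) has_derivative (\<lambda>w. r' x w - w)) (at x within M)"
    using assms(5) by (intro has_derivative_diff has_derivative_ident has_derivative_at_withinI[OF assms(4)]) simp
  then have "((\<lambda>u. 0) has_derivative (\<lambda>w. r' x w - w)) (at x within M)"
    by (rule has_derivative_transform_locally[OF _ assms(1)]) (use assms(5) in \<open>simp_all add: assms(3)\<close>)
  from bounded_linear.has_derivative[OF assms(7) this]
  have 1: "((\<lambda>u. D 0) has_derivative (\<lambda>w. D (r' x w - w))) (at x within M)" .
  have "(f has_derivative (\<lambda>w. D (r' x w))) (at x within M)"
    by (rule has_derivative_transform_locally[OF has_derivative_at_withinI[OF assms(6)] assms(1)])
      (use assms(5) in \<open>simp_all add: assms(3)\<close>)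
  from has_derivative_diff[OF this 1] have "((\<lambda>u. f u - D 0) has_derivative D) (at x within M)"
    using linear_diff[OF bounded_linear.linear[OF assms(7)]] by simp
  then show ?thesis using linear_0[OF bounded_linear.linear[OF assms(7)]] by simp
qed

text \<open>Tangent vectors have the form \<open>r' x w\<close>, and \<open>f \<circ> r\<close> has
  only one derivative at the interior point \<open>x\<close>.\<close>

lemma has_derivative_within_unique:
  assumes "x \<in> M" "(f has_derivative D) (at x within M)" "(f has_derivative D') (at x within M)"
    "v \<in> tangent_space M x"
  shows "D v = D' v"
proof -
  obtain U r r' where U: "open U" "x \<in> U" "\<And>u. u \<in> U \<Longrightarrow> r u \<in> M \<inter> U" "\<And>u. u \<in> M \<inter> U \<Longrightarrow> r u = u"
    "\<And>u. u \<in> U \<Longrightarrow> (r has_derivative r' u) (at u)" "\<And>w. continuous_on U (\<lambda>u. r' u w)"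
    "\<And>x. x \<in> M \<inter> U \<Longrightarrow> tangent_space M x = range (r' x)" using retraction[OF assms(1)] by metis
  have rx: "r x = x" using U assms(1) by auto
  obtain w where "v = r' x w" using U(7)[of x] U(2) assms(1,4) by auto
  moreover have "(\<lambda>w. D (r' x w)) = (\<lambda>w. D' (r' x w))"
    using retraction_derivative_within[OF U(1,3-5,2), unfolded rx] assms(2,3)
    by (intro has_derivative_unique[of "\<lambda>u. f (r u)"]) blast+
  ultimately show ?thesis by metis
qed

text \<open>As \<open>tproj x\<close> fixes the vectors \<open>r' x w\<close>, the maps
  \<open>D\<close> and \<open>D \<circ> tproj x\<close> induce the same derivative of
  \<open>f \<circ> r\<close>.\<close>

lemma has_derivative_within_tproj:
  assumes "x \<in> M" "(f has_derivative D) (at x within M)"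
  shows "(f has_derivative (\<lambda>w. D (tproj x w))) (at x within M)"
proof -
  obtain U r r' where U: "open U" "x \<in> U" "\<And>u. u \<in> U \<Longrightarrow> r u \<in> M \<inter> U" "\<And>u. u \<in> M \<inter> U \<Longrightarrow> r u = u"
    "\<And>u. u \<in> U \<Longrightarrow> (r has_derivative r' u) (at u)" "\<And>w. continuous_on U (\<lambda>u. r' u w)"
    "\<And>x. x \<in> M \<inter> U \<Longrightarrow> tangent_space M x = range (r' x)" using retraction[OF assms(1)] by metis
  have rx: "r x = x" using U assms(1) by auto
  have "tproj x (r' x w) = r' x w" for w using U(7)[of x] U(2) assms(1) by (intro tproj_fixed) auto
  then have 1: "((\<lambda>u. f (r u)) has_derivative (\<lambda>w. D (tproj x (r' x w)))) (at x)"
    using retraction_derivative_within[OF U(1,3-5,2), unfolded rx, OF _ _ _ assms(2)] by simp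
  have 2: "bounded_linear (\<lambda>w. D (tproj x w))"
    using tproj_linear[OF assms(1)] linear_conv_bounded_linear
    by (intro bounded_linear_compose[OF has_derivative_bounded_linear[OF assms(2)]]) blast
  show ?thesis
    by (rule has_derivative_within_iff_retraction[OF U(1,3-5) IntI[OF assms(1) U(2)] 1 2])
qed

abbreviation C1_size :: "('a \<Rightarrow> real) \<Rightarrow> 'a \<Rightarrow> real" where
  "C1_size g y \<equiv> \<bar>g y\<bar> + norm (grad M g y)"

text \<open>The vector is any representative of the differential, not necessarily tangent and hence
  not unique; \<open>grad\<close> is its tangential part.\<close>

abbreviation has_grad :: "('a \<Rightarrow> real) \<Rightarrow> 'a \<Rightarrow> 'a \<Rightarrow> bool" where
  "has_grad f v x \<equiv> (f has_derivative (\<lambda>w. v \<bullet> w)) (at x within M)"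

text \<open>This evaluates the definite description in \<open>grad\<close>: two tangent
  representatives agree on tangent vectors, so whatever representative a calculation yields,
  projecting it gives the gradient.\<close>

lemma grad_eq:
  assumes "x \<in> M" "has_grad f u x"
  shows "grad M f x = tproj x u"
  unfolding grad_def
proof (rule the_equality)
  show "tproj x u \<in> tangent_space M x \<and> (f has_derivative (\<bullet>) (tproj x u)) (at x within M)"
    using has_derivative_within_tproj[OF assms] tproj_in[OF assms(1)]
    unfolding tproj_selfadjoint[OF assms(1), symmetric] by blast
next
  fix v assume v: "v \<in> tangent_space M x \<and> (f has_derivative (\<bullet>) v) (at x within M)"
  have "u \<bullet> z = v \<bullet> z" if "z \<in> tangent_space M x" for z
    using has_derivative_within_unique[OF assms(1,2) _ that] v by blast
  then have "tproj x u = v" using v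
    by (intro tproj_unique[OF assms(1)]) (simp_all add: inner_diff_left)
  then show "v = tproj x u" by simp
qed

lemma has_derivative_grad:
  assumes "x \<in> M" "has_grad f u x"
  shows "has_grad f (grad M f x) x"
proof -
  have "(\<lambda>w. u \<bullet> tproj x w) = (\<lambda>w. grad M f x \<bullet> w)"
    by (simp only: grad_eq[OF assms] tproj_selfadjoint[OF assms(1)])
  with has_derivative_within_tproj[OF assms] show ?thesis by metis
qed

lemma norm_grad_le:
  assumes "x \<in> M" "has_grad f u x"
  shows "norm (grad M f x) \<le> norm u"
  using norm_tproj_le[OF assms(1)] by (simp only: grad_eq[OF assms])

text \<open>The composition \<open>f \<circ> r\<close> is the local extension that
  \<open>C1_on\<close> asks for; the representatives \<open>v\<close> have to be continuous but not
  tangent.\<close>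

lemma C1_onI:
  assumes v: "\<And>x. x \<in> M \<Longrightarrow> has_grad f (v x) x" "continuous_on M v"
  shows "C1_on M (f :: 'a \<Rightarrow> real)"
  unfolding C1_on_def
proof
  fix p assume "p \<in> M"
  then obtain U r r' where U: "open U" "p \<in> U" "\<And>u. u \<in> U \<Longrightarrow> r u \<in> M \<inter> U" "\<And>u. u \<in> M \<inter> U \<Longrightarrow> r u = u"
    "\<And>u. u \<in> U \<Longrightarrow> (r has_derivative r' u) (at u)" "\<And>w. continuous_on U (\<lambda>u. r' u w)"
    "\<And>x. x \<in> M \<inter> U \<Longrightarrow> tangent_space M x = range (r' x)" using retraction by metis
  have "continuous_on U r"
    using U(5) by (auto intro!: continuous_at_imp_continuous_on has_derivative_continuous)
  then have "continuous_on U (\<lambda>u. v (r u))"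
    by (rule continuous_on_compose2[OF v(2)]) (use U(3) in auto)
  then have Ck: "Ck_open 1 U (\<lambda>u. f (r u))"
    using U(3,6)
    by (intro Ck_open_1I[OF U(1) retraction_derivative_within[OF U(1,3-5)], where D1 = "\<lambda>u w. v (r u) \<bullet> w"]
        v continuous_intros) auto
  have "\<forall>x\<in>M \<inter> U. f x = f (r x)" by (intro ballI) (simp only: U(4))
  with U(1,2) Ck show "\<exists>U g. open U \<and> p \<in> U \<and> Ck_open 1 U g \<and> (\<forall>x\<in>M \<inter> U. f x = g x)"
    by blast
qed

end

lemma linear_functional_inner:
  fixes D :: "'a::euclidean_space \<Rightarrow> real"
  assumes "linear D"
  shows "D w = (\<Sum>b\<in>Basis. D b *\<^sub>R b) \<bullet> w"
  unfolding linear_euclidean_sum[OF assms, of w] inner_sum_left by (simp add: inner_commute mult.commute)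

context submanifold
begin

text \<open>The ambient gradient of a local extension is continuous and represents the differential
  within \<open>M\<close>; its tangential part is \<open>grad\<close>, continuous by
  \<open>continuous_on_tproj\<close>.\<close>

lemma C1_onD:
  assumes "C1_on M (f :: 'a \<Rightarrow> real)"
  shows "\<And>x. x \<in> M \<Longrightarrow> has_grad f (grad M f x) x"
    "continuous_on M (grad M f)"
proof -
  have *: "\<exists>U v. open U \<and> p \<in> U \<and> continuous_on U v \<and>
      (\<forall>x\<in>M \<inter> U. has_grad f (v x) x)" if pM: "p \<in> M" for p
  proof -
    obtain U g where U: "open U" "p \<in> U" "Ck_open 1 U g" "\<forall>x\<in>M \<inter> U. f x = g x"
      using assms[unfolded C1_on_def, rule_format, OF pM] by (elim exE conjE) (rule that)
    note d = Ck_open_1D[OF U(1,3)]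
    define v where "v x = (\<Sum>b\<in>Basis. frechet_derivative g (at x) b *\<^sub>R b)" for x
    have "continuous_on U v" unfolding v_def by (intro continuous_intros d)
    moreover have "has_grad f (v x) x" if x: "x \<in> M \<inter> U" for x
    proof -
      have lin: "linear (frechet_derivative g (at x))" using has_derivative_linear[OF d(1)] x by blast
      have "frechet_derivative g (at x) = (\<lambda>w. v x \<bullet> w)"
        unfolding v_def using linear_functional_inner[OF lin] by blast
      then have "has_grad g (v x) x"
        using has_derivative_at_withinI[OF d(1), of x M] x by (metis IntD2)
      then show ?thesis using x U(1,4) by (intro has_derivative_transform_locally[of g _ x M U f]) auto
    qed
    ultimately show ?thesis using U(1,2) by blast
  qed
  show "has_grad f (grad M f x) x" if xM: "x \<in> M" for x
  proof -
    obtain U v where "x \<in> U" "\<forall>x\<in>M \<inter> U. has_grad f (v x) x"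
      using *[OF xM] by blast
    with xM show ?thesis by (intro has_derivative_grad[of x f "v x"]) auto
  qed
  show "continuous_on M (grad M f)"
  proof (rule continuous_on_locally)
    fix p assume "p \<in> M"
    then obtain U v where U: "open U" "p \<in> U" "continuous_on U v"
      "\<forall>x\<in>M \<inter> U. has_grad f (v x) x" using * by blast
    have "continuous_on (M \<inter> U) (\<lambda>x. tproj x (v x))"
      by (rule continuous_on_tproj) (use U in \<open>auto intro: continuous_on_subset\<close>)
    moreover have "grad M f x = tproj x (v x)" if "x \<in> M \<inter> U" for x using that U(4) by (auto intro: grad_eq)
    ultimately have "continuous_on (M \<inter> U) (grad M f)"
      using continuous_on_cong[of "M \<inter> U" "M \<inter> U" "grad M f" "\<lambda>x. tproj x (v x)"] by blast
    with U(1,2) show "\<exists>U. open U \<and> p \<in> U \<and> continuous_on (M \<inter> U) (grad M f)" by blast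
  qed
qed

lemma C1_on_continuous: "C1_on M (f :: 'a \<Rightarrow> real) \<Longrightarrow> continuous_on M f"
  using C1_onD(1) has_derivative_continuous by (fastforce simp: continuous_on_eq_continuous_within)

subsection \<open>Continuous families of continuously differentiable functions\<close>

text \<open>Joint continuity of values and gradients in parameter and point is what survives
  integration over a parameter; \<open>C1_on\<close> for each single parameter would be too
  weak.\<close>

definition C1_family :: "'p::topological_space set \<Rightarrow> ('p \<Rightarrow> 'a \<Rightarrow> real) \<Rightarrow> bool" where
  "C1_family A g \<longleftrightarrow> continuous_on (A \<times> M) (\<lambda>p. g (fst p) (snd p)) \<and>
     continuous_on (A \<times> M) (\<lambda>p. grad M (g (fst p)) (snd p)) \<and>
     (\<forall>a\<in>A. \<forall>x\<in>M. has_grad (g a) (grad M (g a) x) x)"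

text \<open>Any jointly continuous choice of representatives is enough, as \<open>tproj\<close>
  turns it continuously into the gradient.\<close>

lemma C1_familyI:
  assumes "continuous_on (A \<times> M) (\<lambda>p. g (fst p) (snd p))" "continuous_on (A \<times> M) (\<lambda>p. v (fst p) (snd p))"
    "\<And>a x. a \<in> A \<Longrightarrow> x \<in> M \<Longrightarrow> has_grad (g a) (v a x) x"
  shows "C1_family A g"
proof -
  have "continuous_on (A \<times> M) (\<lambda>p. tproj (snd p) (v (fst p) (snd p)))"
    by (rule continuous_on_tproj) (use assms(2) in \<open>auto intro: continuous_intros\<close>)
  moreover have "grad M (g (fst p)) (snd p) = tproj (snd p) (v (fst p) (snd p))" if "p \<in> A \<times> M" for p
    using that assms(3) by (auto intro!: grad_eq)
  ultimately have "continuous_on (A \<times> M) (\<lambda>p. grad M (g (fst p)) (snd p))" by (simp cong: continuous_on_cong)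
  then show ?thesis using assms(1,3) by (auto simp: C1_family_def intro: has_derivative_grad)
qed

lemma C1_familyD:
  assumes "C1_family A g"
  shows "\<And>a x. a \<in> A \<Longrightarrow> x \<in> M \<Longrightarrow> has_grad (g a) (grad M (g a) x) x"
    "\<And>(S :: 's::topological_space set) \<alpha> \<xi>. continuous_on S \<alpha> \<Longrightarrow> continuous_on S \<xi> \<Longrightarrow> \<alpha> ` S \<subseteq> A \<Longrightarrow> \<xi> ` S \<subseteq> M \<Longrightarrow>
       continuous_on S (\<lambda>s. g (\<alpha> s) (\<xi> s))"
    "\<And>(S :: 's::topological_space set) \<alpha> \<xi>. continuous_on S \<alpha> \<Longrightarrow> continuous_on S \<xi> \<Longrightarrow> \<alpha> ` S \<subseteq> A \<Longrightarrow> \<xi> ` S \<subseteq> M \<Longrightarrow>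
       continuous_on S (\<lambda>s. grad M (g (\<alpha> s)) (\<xi> s))"
proof -
  fix S :: "'s set" and \<alpha> \<xi>
  assume *: "continuous_on S \<alpha>" "continuous_on S \<xi>" "\<alpha> ` S \<subseteq> A" "\<xi> ` S \<subseteq> M"
  then have c: "continuous_on S (\<lambda>s. (\<alpha> s, \<xi> s))" "(\<lambda>s. (\<alpha> s, \<xi> s)) ` S \<subseteq> A \<times> M"
    by (auto intro: continuous_intros)
  show "continuous_on S (\<lambda>s. g (\<alpha> s) (\<xi> s))" "continuous_on S (\<lambda>s. grad M (g (\<alpha> s)) (\<xi> s))"
    using assms continuous_on_compose2[OF _ c] unfolding C1_family_def by fastforce+
qed (use assms in \<open>auto simp: C1_family_def\<close>)

lemma C1_family_imp_C1_on:
  assumes "C1_family A g" "a \<in> A"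
  shows "C1_on M (g a)"
  using C1_familyD(1,3)[OF assms(1)] assms(2)
  by (intro C1_onI[where v = "grad M (g a)"]) (auto intro!: C1_familyD(3)[OF assms(1)] continuous_intros)

lemma C1_on_imp_C1_family:
  assumes "C1_on M f"
  shows "C1_family A (\<lambda>_. f)"
  using C1_onD[OF assms] C1_on_continuous[OF assms]
  by (intro C1_familyI[where v = "\<lambda>_. grad M f"])
    (auto intro: continuous_on_compose2[OF _ continuous_on_snd[OF continuous_on_id]])

lemma C1_family_compose_param:
  assumes "C1_family A g" "continuous_on B \<alpha>" "\<alpha> ` B \<subseteq> A"
  shows "C1_family B (\<lambda>b. g (\<alpha> b))"
  using assms(3)
  by (intro C1_familyI[where v = "\<lambda>b. grad M (g (\<alpha> b))"] C1_familyD[OF assms(1)])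
    (auto intro!: continuous_intros continuous_on_compose2[OF assms(2)])

lemma has_derivative_mult_grad:
  assumes "x \<in> M" "has_grad f u x" "has_grad g v x"
  shows "has_grad (\<lambda>x. f x * g x) (f x *\<^sub>R v + g x *\<^sub>R u) x"
  using assms(2,3) by (auto intro!: derivative_eq_intros simp: inner_add_left)

lemma C1_family_mult:
  assumes "C1_family A f" "C1_family A g"
  shows "C1_family A (\<lambda>a x. f a x * g a x)"
proof (rule C1_familyI[where v = "\<lambda>a x. f a x *\<^sub>R grad M (g a) x + g a x *\<^sub>R grad M (f a) x"])
  show "has_grad (\<lambda>x. f a x * g a x) (f a x *\<^sub>R grad M (g a) x + g a x *\<^sub>R grad M (f a) x) x"
    if "a \<in> A" "x \<in> M" for a x
    by (rule has_derivative_mult_grad[OF that(2) C1_familyD(1)[OF assms(1) that] C1_familyD(1)[OF assms(2) that]])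
qed (use assms in \<open>auto simp: C1_family_def intro!: continuous_intros\<close>)

lemma norm_grad_mult_le:
  assumes "C1_on M f" "C1_on M g" "x \<in> M"
  shows "norm (grad M (\<lambda>x. f x * g x) x) \<le> \<bar>f x\<bar> * norm (grad M g x) + \<bar>g x\<bar> * norm (grad M f x)"
  by (rule order_trans[OF norm_grad_le[OF assms(3) has_derivative_mult_grad[OF assms(3) C1_onD(1)[OF assms(1,3)] C1_onD(1)[OF assms(2,3)]]]])
    (rule norm_triangle_le, simp)

lemma C1_family_add:
  assumes "C1_family A f" "C1_family A g"
  shows "C1_family A (\<lambda>a x. f a x + g a x)"
  using assms
  by (intro C1_familyI[where v = "\<lambda>a x. grad M (f a) x + grad M (g a) x"])
    (auto simp: C1_family_def inner_add_left intro!: continuous_intros derivative_eq_intros)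

lemma C1_family_scale:
  assumes "C1_family A f" "continuous_on A c"
  shows "C1_family A (\<lambda>a x. c a * f a x)"
  using assms
  by (intro C1_familyI[where v = "\<lambda>a x. c a *\<^sub>R grad M (f a) x"])
    (auto simp: C1_family_def intro!: continuous_intros derivative_eq_intros continuous_on_compose2[OF assms(2)])

lemma has_derivative_exp_grad:
  assumes "x \<in> M" "has_grad f u x"
  shows "has_grad (\<lambda>x. exp (- f x)) ((- exp (- f x)) *\<^sub>R u) x"
  using assms(2) by (auto intro!: derivative_eq_intros)

lemma C1_family_exp:
  assumes "C1_family A f"
  shows "C1_family A (\<lambda>a x. exp (- f a x))"
proof (rule C1_familyI[where v = "\<lambda>a x. (- exp (- f a x)) *\<^sub>R grad M (f a) x"])
  show "has_grad (\<lambda>x. exp (- f a x)) ((- exp (- f a x)) *\<^sub>R grad M (f a) x) x"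
    if "a \<in> A" "x \<in> M" for a x
    by (rule has_derivative_exp_grad[OF that(2) C1_familyD(1)[OF assms that]])
qed (use assms in \<open>auto simp: C1_family_def intro!: continuous_intros\<close>)

lemma norm_grad_exp_le:
  assumes "C1_on M f" "x \<in> M" "0 \<le> f x"
  shows "norm (grad M (\<lambda>x. exp (- f x)) x) \<le> norm (grad M f x)"
proof -
  have "norm (grad M (\<lambda>x. exp (- f x)) x) \<le> exp (- f x) * norm (grad M f x)"
    using norm_grad_le[OF assms(2) has_derivative_exp_grad[OF assms(2) C1_onD(1)[OF assms(1,2)]]] by simp
  also have "\<dots> \<le> 1 * norm (grad M f x)" using assms(3) by (intro mult_right_mono) auto
  finally show ?thesis by simp
qed

section \<open>Algebraic operations, integrals and series\<close>

lemma C1_on_const: "C1_on M (\<lambda>x. c :: real)"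
  by (intro C1_onI[where v = "\<lambda>_. 0"]) auto

lemma C1_on_add: "C1_on M f \<Longrightarrow> C1_on M g \<Longrightarrow> C1_on M (\<lambda>x. f x + g x :: real)"
  using C1_family_imp_C1_on[OF C1_family_add[OF C1_on_imp_C1_family C1_on_imp_C1_family], of f g "0::nat" UNIV] by auto

lemma C1_on_mult: "C1_on M f \<Longrightarrow> C1_on M g \<Longrightarrow> C1_on M (\<lambda>x. f x * g x :: real)"
  using C1_family_imp_C1_on[OF C1_family_mult[OF C1_on_imp_C1_family C1_on_imp_C1_family], of f g "0::nat" UNIV] by auto

lemma C1_on_diff: "C1_on M f \<Longrightarrow> C1_on M g \<Longrightarrow> C1_on M (\<lambda>x. f x - g x :: real)"
  using C1_on_add[of f "\<lambda>x. -1 * g x"] C1_on_mult[OF C1_on_const, of g "-1"] by simp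

text \<open>A difference of tangent vectors is tangent, so the projection in \<open>grad_eq\<close>
  leaves it unchanged.\<close>

lemma grad_diff:
  assumes "C1_on M f" "C1_on M g" "x \<in> M"
  shows "grad M (\<lambda>x. f x - g x) x = grad M f x - grad M g x"
proof -
  have d: "has_grad (\<lambda>x. f x - g x) (grad M f x - grad M g x) x"
    using C1_onD(1)[OF assms(1,3)] C1_onD(1)[OF assms(2,3)]
    by (auto intro!: derivative_eq_intros simp: inner_diff_left)
  have "tproj x (grad M h x) = grad M h x" if "C1_on M h" for h
    by (metis C1_onD(1)[OF that assms(3)] assms(3) grad_eq)
  then show ?thesis unfolding grad_eq[OF assms(3) d] using assms
    by (simp add: linear_diff[OF tproj_linear])
qed

lemma C1_on_polynomial: "real_polynomial_function f \<Longrightarrow> C1_on M f"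
proof (induction rule: real_polynomial_function.induct)
  case (linear f)
  let ?v = "\<Sum>b\<in>Basis. f b *\<^sub>R b"
  have "f = (\<lambda>w. ?v \<bullet> w)" using linear_functional_inner[of f] linear bounded_linear.linear by blast
  then have "has_grad f (?v) x" for x
    using bounded_linear_imp_has_derivative[OF linear] by metis
  then show ?case by (intro C1_onI[where v = "\<lambda>_. ?v"]) auto
qed (auto intro: C1_on_const C1_on_add C1_on_mult)

text \<open>The Leibniz rule is applied to \<open>g a s \<circ> r\<close> on a ball of the ambient
  space, and the result is brought back by \<open>has_derivative_within_iff_retraction\<close>. The
  norm bound uses that the projection onto the tangent space does not increase norms.\<close>

lemma C1_family_integral:
  fixes g :: "'p::topological_space \<Rightarrow> real \<Rightarrow> 'a \<Rightarrow> real"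
  assumes "C1_family (A \<times> {0..1}) (\<lambda>p. g (fst p) (snd p))"
  shows "C1_family A (\<lambda>a x. integral {0..1} (\<lambda>s. g a s x))"
    "\<And>a x. a \<in> A \<Longrightarrow> x \<in> M \<Longrightarrow>
       norm (grad M (\<lambda>x. integral {0..1} (\<lambda>s. g a s x)) x) \<le> integral {0..1} (\<lambda>s. norm (grad M (g a s) x))"
proof -
  have cont: "continuous_on S (\<lambda>p. g (\<alpha> p) (\<sigma> p) (\<xi> p))" "continuous_on S (\<lambda>p. grad M (g (\<alpha> p) (\<sigma> p)) (\<xi> p))"
    if "continuous_on S \<alpha>" "continuous_on S \<sigma>" "continuous_on S \<xi>" "\<alpha> ` S \<subseteq> A" "\<sigma> ` S \<subseteq> {0..1}" "\<xi> ` S \<subseteq> M"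
    for S :: "'c::topological_space set" and \<alpha> \<sigma> \<xi>
    using C1_familyD(2,3)[OF assms, of S "\<lambda>s. (\<alpha> s, \<sigma> s)" \<xi>] that by (auto intro: continuous_on_Pair)
  define I where "I a x = integral {0..1} (\<lambda>s. grad M (g a s) x)" for a x
  have der: "has_grad (\<lambda>x. integral {0..1} (\<lambda>s. g a s x)) (I a p) p"
    if a: "a \<in> A" and p: "p \<in> M" for a p
  proof -
    obtain U r r' where U: "open U" "p \<in> U" "\<And>u. u \<in> U \<Longrightarrow> r u \<in> M \<inter> U" "\<And>u. u \<in> M \<inter> U \<Longrightarrow> r u = u"
      "\<And>u. u \<in> U \<Longrightarrow> (r has_derivative r' u) (at u)" "\<And>w. continuous_on U (\<lambda>u. r' u w)"
      "\<And>x. x \<in> M \<inter> U \<Longrightarrow> tangent_space M x = range (r' x)" using retraction[OF p] by metis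
    obtain e where e: "e > 0" "ball p e \<subseteq> U" using U(1,2) open_contains_ball by blast
    let ?B = "ball p e"
    have cr: "continuous_on ?B r" using U(5) e(2)
      by (auto intro!: continuous_at_imp_continuous_on has_derivative_continuous)
    have rB: "r u \<in> M" if "u \<in> ?B" for u using that U(3) e(2) by auto
    \<comment> \<open>The vector representing the linear form
      \<open>grad M (g a s) (r u) \<bullet> r' u w\<close> in \<open>w\<close>. As an inner product
      with \<open>F u s\<close>, the derivative becomes a bounded linear function that is continuous
      in \<open>(u, s)\<close> for the operator norm, as \<open>leibniz_rule\<close>
      requires.\<close>
    define F where "F u s = (\<Sum>b\<in>Basis. (grad M (g a s) (r u) \<bullet> r' u b) *\<^sub>R b)" for u s
    have F: "F u s \<bullet> w = grad M (g a s) (r u) \<bullet> r' u w" if "u \<in> ?B" for u s w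
    proof -
      have "linear (\<lambda>w. grad M (g a s) (r u) \<bullet> r' u w)"
        using has_derivative_linear[OF U(5)[of u]] that e(2)
        by (intro linear_compose[of "r' u" "\<lambda>w. grad M (g a s) (r u) \<bullet> w", unfolded o_def])
          (auto intro: bounded_linear.linear bounded_linear_inner_right)
      from linear_functional_inner[OF this, of w] show ?thesis by (simp add: F_def)
    qed
    have "((\<lambda>u. integral (cbox 0 1) (\<lambda>s. g a s (r u))) has_derivative
        integral (cbox 0 1) (\<lambda>s. blinfun_inner_left (F p s))) (at p within ?B)"
    proof (rule leibniz_rule)
      fix u s assume us: "u \<in> ?B" "s \<in> cbox 0 (1::real)"
      then have "((\<lambda>u. g a s (r u)) has_derivative (\<lambda>w. grad M (g a s) (r u) \<bullet> r' u w)) (at u)"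
        using a e(2) U(3)[of u] C1_familyD(1)[OF assms, of "(a, s)"]
        by (intro retraction_derivative_within[OF U(1,3-5)]) auto
      then show "((\<lambda>u. g a s (r u)) has_derivative blinfun_apply (blinfun_inner_left (F u s))) (at u within ?B)"
        unfolding blinfun_inner_left.rep_eq inner_commute[of _ "F u s"] F[OF us(1)]
        by (rule has_derivative_at_withinI)
    next
      fix u assume "u \<in> ?B"
      then show "(\<lambda>s. g a s (r u)) integrable_on cbox 0 1"
        using a rB by (intro integrable_continuous cont) auto
    next
      have "continuous_on (?B \<times> cbox 0 1) (\<lambda>q. F (fst q) (snd q))"
        unfolding F_def
        using a rB e(2)
        by (intro continuous_intros cont)
          (auto intro!: continuous_on_compose2[OF cr] continuous_on_compose2[OF U(6)] continuous_intros)
      then show "continuous_on (?B \<times> cbox 0 1) (\<lambda>(u, s). blinfun_inner_left (F u s))"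
        unfolding case_prod_unfold
        by (rule bounded_linear.continuous_on[OF bounded_linear_blinfun_inner_left])
    qed (use e(1) in auto)
    then have d: "((\<lambda>u. integral {0..1} (\<lambda>s. g a s (r u))) has_derivative
        integral {0..1} (\<lambda>s. blinfun_inner_left (F p s))) (at p)"
      using e(1) by (simp add: at_within_open[of p ?B])
    have "blinfun_apply (integral {0..1} (\<lambda>s. blinfun_inner_left (F p s))) w = I a p \<bullet> r' p w" for w
    proof -
      have pp: "r p = p" "p \<in> ?B" using p U(2,4) e(1) by auto
      have int: "(\<lambda>s. grad M (g a s) p) integrable_on {0..1}"
        using a p by (intro integrable_continuous_interval cont) auto
      have "continuous_on {0..1} (F p)"
        unfolding F_def pp(1) using a p by (intro continuous_intros cont) auto
      then have "(\<lambda>s. blinfun_inner_left (F p s)) integrable_on {0..1}"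
        by (intro integrable_continuous_interval bounded_linear.continuous_on[OF bounded_linear_blinfun_inner_left])
      from blinfun_apply_integral[OF this, of w]
      have "blinfun_apply (integral {0..1} (\<lambda>s. blinfun_inner_left (F p s))) w = integral {0..1} (\<lambda>s. F p s \<bullet> w)"
        by (simp add: blinfun_inner_left.rep_eq inner_commute)
      also have "\<dots> = integral {0..1} (\<lambda>s. grad M (g a s) p \<bullet> r' p w)" using F[OF pp(2)] pp(1) by simp
      also have "\<dots> = I a p \<bullet> r' p w"
        unfolding I_def using integral_linear[OF int bounded_linear_inner_left] by (simp add: o_def)
      finally show ?thesis .
    qed
    then have "blinfun_apply (integral {0..1} (\<lambda>s. blinfun_inner_left (F p s))) = (\<lambda>w. I a p \<bullet> r' p w)" by blast
    with d have 1: "((\<lambda>u. integral {0..1} (\<lambda>s. g a s (r u))) has_derivative (\<lambda>w. I a p \<bullet> r' p w)) (at p)"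
      by metis
    show ?thesis
      by (rule has_derivative_within_iff_retraction[OF U(1,3-5) IntI[OF p U(2)] 1 bounded_linear_inner_right])
  qed
  have "continuous_on (A \<times> M) (\<lambda>q. integral (cbox 0 1) (\<lambda>s. g (fst q) s (snd q)))"
    "continuous_on (A \<times> M) (\<lambda>q. integral (cbox 0 1) (\<lambda>s. grad M (g (fst q) s) (snd q)))"
    by (rule integral_continuous_on_param, unfold case_prod_unfold, rule cont; auto intro!: continuous_intros)+
  then show "C1_family A (\<lambda>a x. integral {0..1} (\<lambda>s. g a s x))"
    by (intro C1_familyI[where v = I] der) (auto simp: I_def)
  fix a x assume ax: "a \<in> A" "x \<in> M"
  have "norm (grad M (\<lambda>x. integral {0..1} (\<lambda>s. g a s x)) x) \<le> norm (I a x)"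
    using der[OF ax] by (rule norm_grad_le[OF ax(2)])
  also have "\<dots> \<le> integral {0..1} (\<lambda>s. norm (grad M (g a s) x))"
    unfolding I_def using ax
    by (intro integral_norm_bound_integral integrable_continuous_interval continuous_intros cont) auto
  finally show "norm (grad M (\<lambda>x. integral {0..1} (\<lambda>s. g a s x)) x) \<le> integral {0..1} (\<lambda>s. norm (grad M (g a s) x))" .
qed


text \<open>The gradients are summed first, uniformly on compact sets by the M-test; their sum is
  then identified as a derivative on a ball, through a retraction.\<close>

lemma C1_on_series:
  fixes u :: "nat \<Rightarrow> 'a \<Rightarrow> real"
  assumes u: "\<And>n. C1_on M (u n)"
    and bd: "\<And>K. compact K \<Longrightarrow> K \<subseteq> M \<Longrightarrow>
      \<exists>B. summable B \<and> (\<forall>n. \<forall>x\<in>K. C1_size (u n) x \<le> B n)"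
  shows "C1_on M (\<lambda>x. \<Sum>n. u n x)"
    "x \<in> M \<Longrightarrow> norm (grad M (\<lambda>x. \<Sum>n. u n x) x) \<le> (\<Sum>n. norm (grad M (u n) x))"
proof -
  define V where "V x = (\<Sum>n. grad M (u n) x)" for x
  have sums: "summable (\<lambda>n. u n x)" "summable (\<lambda>n. norm (grad M (u n) x))" "summable (\<lambda>n. grad M (u n) x)"
    if xM: "x \<in> M" for x
  proof -
    obtain B where B: "summable B" "\<And>n. C1_size (u n) x \<le> B n"
      using bd[of "{x}"] xM by auto
    have le: "\<bar>u n x\<bar> \<le> B n" "norm (grad M (u n) x) \<le> B n" for n
      using B(2)[of n] norm_ge_zero[of "grad M (u n) x"] abs_ge_zero[of "u n x"] by linarith+
    show "summable (\<lambda>n. u n x)" by (rule summable_comparison_test'[OF B(1)]) (use le in auto)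
    show "summable (\<lambda>n. norm (grad M (u n) x))" by (rule summable_comparison_test'[OF B(1)]) (use le in auto)
    then show "summable (\<lambda>n. grad M (u n) x)" by (rule summable_norm_cancel)
  qed
  have unif: "uniform_limit K (\<lambda>n x. \<Sum>i<n. grad M (u i) x) V sequentially" if K: "compact K" "K \<subseteq> M" for K
  proof -
    obtain B where B: "summable B" "\<And>n x. x \<in> K \<Longrightarrow> C1_size (u n) x \<le> B n"
      using bd[OF K] by metis
    have "norm (grad M (u n) x) \<le> B n" if "x \<in> K" for n x
      using B(2)[OF that, of n] abs_ge_zero[of "u n x"] by linarith
    then show ?thesis unfolding V_def by (intro Weierstrass_m_test[OF _ B(1)]) auto
  qed
  have contV: "continuous_on M V"
  proof (rule continuous_on_locally)
    fix p assume "p \<in> M"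
    have "continuous_on (cball p 1 \<inter> M) V"
      by (rule uniform_limit_theorem[OF _ unif])
        (use compact_cball_Int in \<open>auto intro!: always_eventually continuous_on_sum continuous_on_subset[OF C1_onD(2)[OF u]]\<close>)
    then have "continuous_on (M \<inter> ball p 1) V" by (rule continuous_on_subset) auto
    then show "\<exists>U. open U \<and> p \<in> U \<and> continuous_on (M \<inter> U) V" by (intro exI[of _ "ball p 1"]) auto
  qed
  have der: "has_grad (\<lambda>x. \<Sum>n. u n x) (V p) p" if p: "p \<in> M" for p
  proof -
    obtain U r r' where U: "open U" "p \<in> U" "\<And>u. u \<in> U \<Longrightarrow> r u \<in> M \<inter> U" "\<And>u. u \<in> M \<inter> U \<Longrightarrow> r u = u"
      "\<And>u. u \<in> U \<Longrightarrow> (r has_derivative r' u) (at u)" "\<And>w. continuous_on U (\<lambda>u. r' u w)"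
      "\<And>x. x \<in> M \<inter> U \<Longrightarrow> tangent_space M x = range (r' x)" using retraction[OF p] by metis
    obtain e where e: "e > 0" "cball p e \<subseteq> U" using U(1,2) open_contains_cball by blast
    have cr: "continuous_on U r" using U(5)
      by (auto intro!: continuous_at_imp_continuous_on has_derivative_continuous)
    \<comment> \<open>The retraction sends the ball into this compact part of \<open>M\<close>,
      where the gradient series converges uniformly.\<close>
    let ?K = "r ` cball p e"
    have K: "compact ?K" "?K \<subseteq> M"
      using e(2) U(3) by (auto intro!: compact_continuous_image continuous_on_subset[OF cr])
    have "continuous_on (cball p e) (\<lambda>u. \<Sum>b\<in>Basis. norm (r' u b))"
      using e(2) by (intro continuous_intros continuous_on_subset[OF U(6)])
    then have "bounded ((\<lambda>u. \<Sum>b\<in>Basis. norm (r' u b)) ` cball p e)"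
      by (intro compact_imp_bounded compact_continuous_image compact_cball)
    then obtain R where R: "R > 0" "\<And>u. u \<in> cball p e \<Longrightarrow> \<bar>\<Sum>b\<in>Basis. norm (r' u b)\<bar> \<le> R"
      unfolding bounded_pos by auto
    have nr: "norm (r' u w) \<le> R * norm w" if "u \<in> cball p e" for u w
    proof -
      have lin: "linear (r' u)" using U(5)[of u] that e(2) has_derivative_linear by blast
      have "norm (r' u w) \<le> (\<Sum>b\<in>Basis. \<bar>w \<bullet> b\<bar> * norm (r' u b))"
        unfolding linear_euclidean_sum[OF lin, of w] by (rule order_trans[OF norm_sum]) simp
      also have "\<dots> \<le> (\<Sum>b\<in>Basis. norm w * norm (r' u b))"
        by (intro sum_mono mult_right_mono Basis_le_norm) auto
      also have "\<dots> = norm w * (\<Sum>b\<in>Basis. norm (r' u b))" by (simp add: sum_distrib_left)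
      also have "\<dots> \<le> norm w * R" using R(2)[OF that] by (intro mult_left_mono) auto
      finally show ?thesis by (simp add: mult.commute)
    qed
    let ?B = "ball p e"
    have BU: "u \<in> cball p e" "u \<in> U" "r u \<in> M" if "u \<in> ?B" for u
    proof -
      show *: "u \<in> cball p e" using that by simp
      then show "u \<in> U" using e(2) by blast
      then show "r u \<in> M" using U(3) by blast
    qed
    have "\<exists>g. \<forall>x\<in>?B. (\<lambda>n. u n (r x)) sums g x \<and> (g has_derivative (\<lambda>w. V (r x) \<bullet> r' x w)) (at x within ?B)"
    proof (rule has_derivative_series[where f' = "\<lambda>n x w. grad M (u n) (r x) \<bullet> r' x w"])
      show "convex ?B" "p \<in> ?B" using e(1) by auto
      show "(\<lambda>n. u n (r p)) sums (\<Sum>n. u n (r p))" using sums(1)[of "r p"] BU(3)[of p] e(1) by (simp add: summable_sums)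
      fix n x assume "x \<in> ?B"
      then show "((\<lambda>x. u n (r x)) has_derivative (\<lambda>w. grad M (u n) (r x) \<bullet> r' x w)) (at x within ?B)"
        using retraction_derivative_within[OF U(1,3-5) BU(2) C1_onD(1)[OF u BU(3)]] has_derivative_at_withinI by blast
    next
      \<comment> \<open>Uniform convergence is requested at level \<open>\<epsilon> / R\<close>,
        because a factor \<open>R\<close> is lost when directions pass through
        \<open>r'\<close>.\<close>
      fix \<epsilon> :: real assume \<epsilon>: "\<epsilon> > 0"
      have "\<forall>\<^sub>F n in sequentially. \<forall>x\<in>?K. dist (\<Sum>i<n. grad M (u i) x) (V x) < \<epsilon> / R"
        using unif[OF K] \<epsilon> R(1) by (intro uniform_limitD) auto
      then show "\<forall>\<^sub>F n in sequentially. \<forall>x\<in>?B. \<forall>h. norm ((\<Sum>i<n. grad M (u i) (r x) \<bullet> r' x h) - V (r x) \<bullet> r' x h) \<le> \<epsilon> * norm h"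
      proof (rule eventually_mono, intro ballI allI)
        fix n x h assume *: "\<forall>x\<in>?K. dist (\<Sum>i<n. grad M (u i) x) (V x) < \<epsilon> / R" and x: "x \<in> ?B"
        have "(\<Sum>i<n. grad M (u i) (r x) \<bullet> r' x h) - V (r x) \<bullet> r' x h = ((\<Sum>i<n. grad M (u i) (r x)) - V (r x)) \<bullet> r' x h"
          by (simp add: inner_sum_left inner_diff_left)
        also have "norm \<dots> \<le> norm ((\<Sum>i<n. grad M (u i) (r x)) - V (r x)) * norm (r' x h)"
          by (simp add: Cauchy_Schwarz_ineq2)
        also have "\<dots> \<le> (\<epsilon> / R) * (R * norm h)"
          using *[rule_format, of "r x"] BU(1)[OF x] nr[of x h] R(1) \<epsilon>
          by (intro mult_mono) (auto simp: dist_norm)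
        finally show "norm ((\<Sum>i<n. grad M (u i) (r x) \<bullet> r' x h) - V (r x) \<bullet> r' x h) \<le> \<epsilon> * norm h"
          using R(1) by simp
      qed
    qed
    then obtain g where g: "\<And>x. x \<in> ?B \<Longrightarrow> (\<lambda>n. u n (r x)) sums g x"
      "(g has_derivative (\<lambda>w. V (r p) \<bullet> r' p w)) (at p within ?B)" using e(1) by (metis centre_in_ball)
    have "(g has_derivative (\<lambda>w. V p \<bullet> r' p w)) (at p)"
      using g(2) e(1) U(4)[of p] p U(2) by (simp add: at_within_open[of p ?B])
    then have fr: "((\<lambda>x. \<Sum>n. u n (r x)) has_derivative (\<lambda>w. V p \<bullet> r' p w)) (at p)"
      by (rule has_derivative_transform_locally[of g _ p UNIV ?B]) (use e(1) sums_unique[OF g(1)] in simp_all)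
    show ?thesis
      by (rule has_derivative_within_iff_retraction[OF U(1,3-5) IntI[OF p U(2)] fr bounded_linear_inner_right])
  qed
  show "C1_on M (\<lambda>x. \<Sum>n. u n x)" by (rule C1_onI[OF der contV])
  assume x: "x \<in> M"
  have "norm (grad M (\<lambda>x. \<Sum>n. u n x) x) \<le> norm (V x)" by (rule norm_grad_le[OF x der[OF x]])
  also have "\<dots> \<le> (\<Sum>n. norm (grad M (u n) x))" unfolding V_def by (rule summable_norm[OF sums(2)[OF x]])
  finally show "norm (grad M (\<lambda>x. \<Sum>n. u n x) x) \<le> (\<Sum>n. norm (grad M (u n) x))" .
qed

end

lemma C1_on_imp_continuous_on:
  assumes "C1_on S f"
  shows "continuous_on S f"
proof (rule continuous_on_locally)
  fix p assume p: "p \<in> S"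
  obtain U g where U: "open U" "p \<in> U" "Ck_open 1 U g" "\<forall>x\<in>S \<inter> U. f x = g x"
    using assms[unfolded C1_on_def, rule_format, OF p] by (elim exE conjE) (rule that)
  have "continuous_on U g" using U(3) by (simp add: differentiable_imp_continuous_on)
  then have "continuous_on (S \<inter> U) g" by (rule continuous_on_subset) auto
  then have "continuous_on (S \<inter> U) f" using U(4) continuous_on_cong[of "S \<inter> U" "S \<inter> U" f g] by blast
  with U(1,2) show "\<exists>U. open U \<and> p \<in> U \<and> continuous_on (S \<inter> U) f" by blast
qed

section \<open>The flow and its differential\<close>

locale stable_pdmp = submanifold M
  for M :: "'a::euclidean_space set" +
  fixes \<phi> :: "real \<Rightarrow> 'a \<Rightarrow> 'a"
    and lam :: "'a \<Rightarrow> real"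
    and Q :: "'a \<Rightarrow> 'a measure"
    and G :: "'a \<times> real \<Rightarrow> 'a"
  assumes characteristics: "homogeneous_characteristics M \<phi> lam Q"
    and representation: "represents_kernel M Q G"
    and stability: "stability_property M \<phi> lam Q"
begin

abbreviation "chain \<equiv> jump_chain \<phi> lam G"
abbreviation "proc \<equiv> pdmp \<phi> lam G"
abbreviation "obs \<equiv> pdmp_obs \<phi> lam G"
abbreviation "Pt \<equiv> pdmp_semigroup \<phi> lam G"
abbreviation "supp \<equiv> measure_support M"

lemma flow_in: "0 \<le> t \<Longrightarrow> x \<in> M \<Longrightarrow> \<phi> t x \<in> M"
  using characteristics measurable_space[of "\<lambda>(t, x). \<phi> t x" "borel_of {0..} \<Otimes>\<^sub>M borel_of M" "borel_of M" "(t, x)"]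
  by (auto simp: homogeneous_characteristics_def homogeneous_flow_def space_pair_measure space_restrict_space)

lemma flow_0: "x \<in> M \<Longrightarrow> \<phi> 0 x = x"
  using characteristics by (auto simp: homogeneous_characteristics_def homogeneous_flow_def)

lemma flow_C1: "C1_on ({0..} \<times> M) (\<lambda>(t, x). \<phi> t x)"
  using stability by (simp add: stability_property_def)

lemma continuous_flow:
  assumes "continuous_on S \<tau>" "continuous_on S \<xi>" "\<tau> ` S \<subseteq> {0..}" "\<xi> ` S \<subseteq> M"
  shows "continuous_on S (\<lambda>s. \<phi> (\<tau> s) (\<xi> s))"
proof -
  have "continuous_on S (\<lambda>s. (\<lambda>(t, x). \<phi> t x) (\<tau> s, \<xi> s))"
    by (rule continuous_on_compose2[OF C1_on_imp_continuous_on[OF flow_C1]])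
      (use assms in \<open>auto intro: continuous_on_Pair\<close>)
  then show ?thesis by simp
qed

text \<open>\<open>grad\<close> is defined for real functions, so the flow is treated by
  coordinates. A local extension of the flow in time and space is differentiated in the directions
  \<open>(0, w)\<close>, with \<open>t\<close> frozen.\<close>

lemma C1_family_flow: "C1_family {0..} (\<lambda>t x. \<phi> t x \<bullet> b)"
proof -
  have loc: "\<exists>W v. open W \<and> p \<in> W \<and> continuous_on W v \<and> (\<forall>t x. (t, x) \<in> ({0..} \<times> M) \<inter> W \<longrightarrow>
      has_grad (\<lambda>x. \<phi> t x \<bullet> b) (v (t, x)) x)" if p: "p \<in> {0..} \<times> M" for p
  proof -
    obtain W F where W: "open W" "p \<in> W" "Ck_open 1 W F" "\<forall>q\<in>({0..} \<times> M) \<inter> W. (\<lambda>(t, x). \<phi> t x) q = F q"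
      using flow_C1[unfolded C1_on_def, rule_format, OF p] by (elim exE conjE) (rule that)
    note d = Ck_open_1D[OF W(1,3)]
    define v where "v q = (\<Sum>c\<in>Basis. (frechet_derivative F (at q) (0, c) \<bullet> b) *\<^sub>R c)" for q
    have "continuous_on W v" unfolding v_def by (intro continuous_intros d)
    moreover have "has_grad (\<lambda>x. \<phi> t x \<bullet> b) (v (t, x)) x"
      if tx: "(t, x) \<in> ({0..} \<times> M) \<inter> W" for t x
    proof -
      have "(t, x) \<in> W" using tx by blast
      note dF = d(1)[OF this]
      have dp: "((\<lambda>y. (t, y)) has_derivative (\<lambda>w. (0, w))) (at x)"
        by (intro has_derivative_Pair has_derivative_const has_derivative_ident)
      have "(F \<circ> (\<lambda>y. (t, y)) has_derivative frechet_derivative F (at (t, x)) \<circ> (\<lambda>w. (0, w))) (at x)"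
        by (rule diff_chain_at[OF dp dF])
      from bounded_linear.has_derivative[OF bounded_linear_inner_left[of b] this]
      have D: "((\<lambda>y. F (t, y) \<bullet> b) has_derivative (\<lambda>w. frechet_derivative F (at (t, x)) (0, w) \<bullet> b)) (at x)"
        by (simp add: o_def)
      have "(\<lambda>w. frechet_derivative F (at (t, x)) (0, w) \<bullet> b) = (\<lambda>w. v (t, x) \<bullet> w)"
        unfolding v_def using linear_functional_inner[OF has_derivative_linear[OF D]] by blast
      with D have D': "has_grad (\<lambda>y. F (t, y) \<bullet> b) (v (t, x)) x"
        by (metis has_derivative_at_withinI)
      have "open (Pair t -` W)" by (intro open_vimage W continuous_intros)
      then show ?thesis
      proof (rule has_derivative_transform_locally[OF D'])
        fix y assume "y \<in> M \<inter> Pair t -` W"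
        with tx have "(t, y) \<in> ({0..} \<times> M) \<inter> W" by auto
        from W(4)[rule_format, OF this] show "F (t, y) \<bullet> b = \<phi> t y \<bullet> b" by simp
      qed (use tx in auto)
    qed
    ultimately show ?thesis using W(1,2) by blast
  qed
  have der: "has_grad (\<lambda>x. \<phi> t x \<bullet> b) (grad M (\<lambda>x. \<phi> t x \<bullet> b) x) x"
    if tx: "t \<in> {0..}" "x \<in> M" for t x
  proof -
    have "(t, x) \<in> {0..} \<times> M" using tx by simp
    from loc[OF this] tx have "\<exists>v. has_grad (\<lambda>x. \<phi> t x \<bullet> b) v x" by blast
    then show ?thesis using has_derivative_grad[OF tx(2)] by blast
  qed
  have "continuous_on ({0..} \<times> M) (\<lambda>p. grad M (\<lambda>x. \<phi> (fst p) x \<bullet> b) (snd p))"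
  proof (rule continuous_on_locally)
    fix p :: "real \<times> 'a" assume "p \<in> {0..} \<times> M"
    from loc[OF this] obtain W v where W: "open W" "p \<in> W" "continuous_on W v" "\<And>t x. (t, x) \<in> ({0..} \<times> M) \<inter> W \<Longrightarrow>
      has_grad (\<lambda>x. \<phi> t x \<bullet> b) (v (t, x)) x" by blast
    have 1: "continuous_on (({0..} \<times> M) \<inter> W) (\<lambda>p. tproj (snd p) (v p))"
      by (rule continuous_on_tproj) (use W(3) in \<open>auto intro!: continuous_intros intro: continuous_on_subset\<close>)
    have "grad M (\<lambda>x. \<phi> (fst p) x \<bullet> b) (snd p) = tproj (snd p) (v p)" if "p \<in> ({0..} \<times> M) \<inter> W" for p
      using that W(4)[of "fst p" "snd p"] by (intro grad_eq) (auto simp: mem_Times_iff)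
    with 1 have "continuous_on (({0..} \<times> M) \<inter> W) (\<lambda>p. grad M (\<lambda>x. \<phi> (fst p) x \<bullet> b) (snd p))"
      using continuous_on_cong[of "({0..} \<times> M) \<inter> W" "({0..} \<times> M) \<inter> W"
        "\<lambda>p. grad M (\<lambda>x. \<phi> (fst p) x \<bullet> b) (snd p)" "\<lambda>p. tproj (snd p) (v p)"] by blast
    with W(1,2) show "\<exists>U. open U \<and> p \<in> U \<and>
        continuous_on (({0..} \<times> M) \<inter> U) (\<lambda>p. grad M (\<lambda>x. \<phi> (fst p) x \<bullet> b) (snd p))" by blast
  qed
  then show ?thesis unfolding C1_family_def
    using der by (auto intro!: continuous_intros continuous_flow)
qed

text \<open>For \<open>b\<close> in \<open>Basis\<close> these are the rows of the Jacobian matrix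
  of \<open>\<phi> t\<close>, projected to the tangent space.\<close>

definition flow_grad :: "real \<Rightarrow> 'a \<Rightarrow> 'a \<Rightarrow> 'a" where
  "flow_grad t x b = grad M (\<lambda>x. \<phi> t x \<bullet> b) x"

text \<open>Chain rule: the vector obtained is the transposed differential of the flow applied to
  \<open>v\<close>, assembled from the coordinate gradients.\<close>

lemma has_derivative_flow_grad:
  assumes "0 \<le> t" "x \<in> M" "(g has_derivative (\<lambda>w. v \<bullet> w)) (at (\<phi> t x) within M)"
  shows "has_grad (\<lambda>x. g (\<phi> t x)) (\<Sum>b\<in>Basis. (v \<bullet> b) *\<^sub>R flow_grad t x b) x"
proof -
  have "((\<lambda>x. \<Sum>b\<in>Basis. (\<phi> t x \<bullet> b) *\<^sub>R b) has_derivative (\<lambda>w. \<Sum>b\<in>Basis. (flow_grad t x b \<bullet> w) *\<^sub>R b)) (at x within M)"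
    using C1_familyD(1)[OF C1_family_flow, of t x] assms(1,2)
    by (intro has_derivative_sum has_derivative_scaleR_left) (auto simp: flow_grad_def)
  then have dphi: "(\<phi> t has_derivative (\<lambda>w. \<Sum>b\<in>Basis. (flow_grad t x b \<bullet> w) *\<^sub>R b)) (at x within M)"
    by (simp add: euclidean_representation)
  have "\<phi> t ` M \<subseteq> M" using flow_in assms(1) by blast
  from diff_chain_within[OF dphi has_derivative_subset[OF assms(3) this]]
  show ?thesis
    by (simp add: o_def inner_sum_left inner_sum_right mult.commute)
qed

lemma C1_family_flow_compose:
  assumes "C1_family A g" "continuous_on A \<tau>" "\<tau> ` A \<subseteq> {0..}"
  shows "C1_family A (\<lambda>a x. g a (\<phi> (\<tau> a) x))"
proof (rule C1_familyI[where v = "\<lambda>a x. \<Sum>b\<in>Basis. (grad M (g a) (\<phi> (\<tau> a) x) \<bullet> b) *\<^sub>R flow_grad (\<tau> a) x b"])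
  have c: "continuous_on (A \<times> M) (\<lambda>p. \<tau> (fst p))"
    by (rule continuous_on_compose2[OF assms(2)]) (auto intro: continuous_intros)
  have cf: "continuous_on (A \<times> M) (\<lambda>p. \<phi> (\<tau> (fst p)) (snd p))" "(\<lambda>p. \<phi> (\<tau> (fst p)) (snd p)) ` (A \<times> M) \<subseteq> M"
    using assms(3) by (auto intro!: continuous_flow continuous_intros c flow_in)
  show "continuous_on (A \<times> M) (\<lambda>p. g (fst p) (\<phi> (\<tau> (fst p)) (snd p)))"
    by (rule C1_familyD(2)[OF assms(1) _ cf(1) _ cf(2)]) (auto intro: continuous_intros)
  have "continuous_on (A \<times> M) (\<lambda>p. grad M (g (fst p)) (\<phi> (\<tau> (fst p)) (snd p)))"
    by (rule C1_familyD(3)[OF assms(1) _ cf(1) _ cf(2)]) (auto intro: continuous_intros)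
  moreover have "continuous_on (A \<times> M) (\<lambda>p. flow_grad (\<tau> (fst p)) (snd p) b)" for b
    unfolding flow_grad_def
    by (rule C1_familyD(3)[OF C1_family_flow c]) (use assms(3) in \<open>auto intro: continuous_intros\<close>)
  ultimately show "continuous_on (A \<times> M) (\<lambda>p. \<Sum>b\<in>Basis. (grad M (g (fst p)) (\<phi> (\<tau> (fst p)) (snd p)) \<bullet> b) *\<^sub>R
      flow_grad (\<tau> (fst p)) (snd p) b)" by (intro continuous_intros)
  fix a x assume "a \<in> A" "x \<in> M"
  then show "((\<lambda>x. g a (\<phi> (\<tau> a) x)) has_derivative
      (\<lambda>w. (\<Sum>b\<in>Basis. (grad M (g a) (\<phi> (\<tau> a) x) \<bullet> b) *\<^sub>R flow_grad (\<tau> a) x b) \<bullet> w)) (at x within M)"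
    using assms(3) by (intro has_derivative_flow_grad C1_familyD(1)[OF assms(1)] flow_in) auto
qed

lemma norm_grad_flow_le:
  assumes "C1_on M g" "0 \<le> t" "x \<in> M"
  shows "norm (grad M (\<lambda>x. g (\<phi> t x)) x) \<le> (\<Sum>b\<in>Basis. norm (flow_grad t x b)) * norm (grad M g (\<phi> t x))"
proof -
  let ?v = "grad M g (\<phi> t x)"
  have "norm (grad M (\<lambda>x. g (\<phi> t x)) x) \<le> norm (\<Sum>b\<in>Basis. (?v \<bullet> b) *\<^sub>R flow_grad t x b)"
    by (rule norm_grad_le[OF assms(3) has_derivative_flow_grad[OF assms(2,3) C1_onD(1)[OF assms(1) flow_in[OF assms(2,3)]]]])
  also have "\<dots> \<le> (\<Sum>b\<in>Basis. \<bar>?v \<bullet> b\<bar> * norm (flow_grad t x b))"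
    by (rule order_trans[OF norm_sum]) simp
  also have "\<dots> \<le> (\<Sum>b\<in>Basis. norm ?v * norm (flow_grad t x b))"
    by (intro sum_mono mult_right_mono Basis_le_norm) auto
  finally show ?thesis by (simp add: sum_distrib_left sum_distrib_right mult.commute)
qed


subsection \<open>The jump kernel\<close>

lemma Q_prob: "x \<in> M \<Longrightarrow> prob_space (Q x)"
  and sets_Q: "x \<in> M \<Longrightarrow> sets (Q x) = sets (borel_of M)"
proof -
  assume x: "x \<in> M"
  have "Q \<in> borel_of M \<rightarrow>\<^sub>M prob_algebra (borel_of M)"
    using characteristics by (simp add: homogeneous_characteristics_def markov_kernel_def)
  from measurable_space[OF this, of x] x show "prob_space (Q x)" "sets (Q x) = sets (borel_of M)"
    by (auto simp: space_restrict_space space_prob_algebra)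
qed

lemma space_Q: "x \<in> M \<Longrightarrow> space (Q x) = M"
  using sets_eq_imp_space_eq[OF sets_Q] by (simp add: space_restrict_space)

text \<open>Points outside the support lie in open null sets; by Lindelof countably many of these
  cover the complement.\<close>

lemma AE_Q_support:
  assumes "x \<in> M"
  shows "AE y in Q x. y \<in> supp (Q x)"
proof -
  define F where "F = {U. open U \<and> emeasure (Q x) (U \<inter> M) = 0}"
  have "\<And>U. U \<in> F \<Longrightarrow> open U" by (auto simp: F_def)
  then obtain F' where F': "F' \<subseteq> F" "countable F'" "\<Union>F' = \<Union>F" by (rule Lindelof)
  have "U \<inter> M \<in> null_sets (Q x)" if "U \<in> F'" for U
  proof (rule null_setsI)
    have U: "open U" "emeasure (Q x) (U \<inter> M) = 0" using that F'(1) by (auto simp: F_def)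
    then have "U \<inter> M \<in> sets (borel_of M)" using M_borel by (simp add: sets_restrict_space_iff)
    then show "U \<inter> M \<in> sets (Q x)" by (simp only: sets_Q[OF assms])
    show "emeasure (Q x) (U \<inter> M) = 0" by (rule U)
  qed
  then have "(\<Union>U\<in>F'. U \<inter> M) \<in> null_sets (Q x)" by (intro null_sets_UN' F'(2))
  then have "AE y in Q x. y \<notin> (\<Union>U\<in>F'. U \<inter> M)" by (rule AE_not_in)
  moreover have "AE y in Q x. y \<in> M" using space_Q[OF assms] AE_space[of "Q x"] by simp
  ultimately show ?thesis
  proof eventually_elim
    case (elim y)
    then have "y \<notin> \<Union>F" using F'(3) by blast
    with elim(2) show ?case by (auto simp: measure_support_def F_def zero_less_iff_neq_zero)
  qed
qed

lemma support_nonempty: "x \<in> M \<Longrightarrow> supp (Q x) \<noteq> {}"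
proof
  assume x: "x \<in> M" and "supp (Q x) = {}"
  with AE_Q_support[OF x] have "AE y in Q x. False" by simp
  then show False using prob_space.AE_const[OF Q_prob[OF x]] by simp
qed

text \<open>One-step form of the compatibility, suited to induction on the jumps: the list records
  past waiting times, and a jump after time \<open>s\<close> appends \<open>s\<close>.\<close>

lemma compat_sets:
  assumes "compact K" "K \<subseteq> M" "0 \<le> T"
  obtains K' \<K> where "compact K'" "K' \<subseteq> M" "\<K> [] = K"
    "\<And>ts. (\<forall>t\<in>set ts. 0 \<le> t) \<Longrightarrow> sum_list ts \<le> T \<Longrightarrow> \<K> ts \<subseteq> K'"
    "\<And>ts s x. (\<forall>t\<in>set ts. 0 \<le> t) \<Longrightarrow> 0 \<le> s \<Longrightarrow> sum_list ts + s \<le> T \<Longrightarrow> x \<in> \<K> ts \<Longrightarrow>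
       \<phi> s x \<in> K' \<and> supp (Q (\<phi> s x)) \<subseteq> \<K> (ts @ [s])"
proof -
  have cc: "compactly_compatible M \<phi> Q" using stability by (simp add: stability_property_def)
  have "compact K \<and> K \<subseteq> M \<and> 0 \<le> T" using assms by simp
  from mp[OF spec[OF spec[OF cc[unfolded compactly_compatible_def], of K], of T] this]
  obtain K' \<K> where K: "compact K'" "K' \<subseteq> M" "\<K> [] = K" and
    all: "\<forall>ts::real list. ts \<noteq> [] \<and> (\<forall>t\<in>set ts. 0 \<le> t) \<and> sum_list ts \<le> T \<longrightarrow>
           (\<forall>i\<le>length ts. compact (\<K> (take i ts)) \<and> \<K> (take i ts) \<subseteq> K') \<and>
           (\<forall>i<length ts.
              (\<Union>x\<in>\<K> (take i ts). supp (Q (\<phi> (ts ! i) x))) \<subseteq> \<K> (take (Suc i) ts) \<and>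
              (\<forall>s\<in>{0..ts ! i}. \<phi> s ` \<K> (take i ts) \<subseteq> K')) \<and>
           (\<forall>s\<in>{0..T - sum_list ts}. \<phi> s ` \<K> ts \<subseteq> K')"
    by (elim exE conjE) (rule that)
  have *: "(\<forall>i\<le>length ts. compact (\<K> (take i ts)) \<and> \<K> (take i ts) \<subseteq> K') \<and>
           (\<forall>i<length ts.
              (\<Union>x\<in>\<K> (take i ts). supp (Q (\<phi> (ts ! i) x))) \<subseteq> \<K> (take (Suc i) ts) \<and>
              (\<forall>s\<in>{0..ts ! i}. \<phi> s ` \<K> (take i ts) \<subseteq> K'))"
    if "ts \<noteq> []" "\<forall>t\<in>set ts. 0 \<le> t" "sum_list ts \<le> T" for ts
  proof -
    have "ts \<noteq> [] \<and> (\<forall>t\<in>set ts. 0 \<le> t) \<and> sum_list ts \<le> T" using that by simp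
    from mp[OF spec[OF all] this] show ?thesis by (elim conjE) (intro conjI)
  qed
  show thesis
  proof (rule that[of K' \<K>, OF K])
    fix ts :: "real list" assume "\<forall>t\<in>set ts. 0 \<le> t" "sum_list ts \<le> T"
    \<comment> \<open>The compatibility condition speaks of nonempty lists; appending a zero waiting
      time makes it cover \<open>ts = []\<close>.\<close>
    then have "ts @ [0] \<noteq> []" "\<forall>t\<in>set (ts @ [0]). 0 \<le> t" "sum_list (ts @ [0]) \<le> T" by auto
    from conjunct1[OF *[OF this]] have "\<forall>i\<le>length (ts @ [0]). compact (\<K> (take i (ts @ [0]))) \<and> \<K> (take i (ts @ [0])) \<subseteq> K'" .
    from this[rule_format, of "length ts"] show "\<K> ts \<subseteq> K'" by simp
  next
    fix ts :: "real list" and s :: real and x assume a: "\<forall>t\<in>set ts. 0 \<le> t" "0 \<le> s" "sum_list ts + s \<le> T" "x \<in> \<K> ts"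
    let ?l = "ts @ [s]"
    have "?l \<noteq> []" "\<forall>t\<in>set ?l. 0 \<le> t" "sum_list ?l \<le> T" using a by auto
    from conjunct2[OF *[OF this], rule_format, of "length ts"]
    have "(\<Union>x\<in>\<K> ts. supp (Q (\<phi> s x))) \<subseteq> \<K> (ts @ [s])" "\<forall>u\<in>{0..s}. \<phi> u ` \<K> ts \<subseteq> K'"
      by simp_all
    moreover have "s \<in> {0..s}" using a(2) by simp
    ultimately have "\<phi> s ` \<K> ts \<subseteq> K'" "(\<Union>x\<in>\<K> ts. supp (Q (\<phi> s x))) \<subseteq> \<K> (ts @ [s])" by blast+
    with a(4) show "\<phi> s x \<in> K' \<and> supp (Q (\<phi> s x)) \<subseteq> \<K> (ts @ [s])" by blast
  qed
qed

text \<open>Compatibility with horizon 0: a jump at time 0 starts from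
  \<open>\<phi> 0 x = x\<close>.\<close>

lemma support_compact:
  assumes "compact K" "K \<subseteq> M"
  obtains K' where "compact K'" "K' \<subseteq> M" "\<And>x. x \<in> K \<Longrightarrow> supp (Q x) \<subseteq> K'"
proof -
  obtain K' \<K> where K: "compact K'" "K' \<subseteq> M" "\<K> [] = K"
    "\<And>ts. (\<forall>t\<in>set ts. 0 \<le> t) \<Longrightarrow> sum_list ts \<le> 0 \<Longrightarrow> \<K> ts \<subseteq> K'"
    "\<And>ts s x. (\<forall>t\<in>set ts. 0 \<le> t) \<Longrightarrow> 0 \<le> s \<Longrightarrow> sum_list ts + s \<le> 0 \<Longrightarrow> x \<in> \<K> ts \<Longrightarrow>
       \<phi> s x \<in> K' \<and> supp (Q (\<phi> s x)) \<subseteq> \<K> (ts @ [s])"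
    by (rule compat_sets[OF assms, of 0]) auto
  have "supp (Q x) \<subseteq> K'" if x: "x \<in> K" for x
  proof -
    have "x \<in> M" using x assms(2) by blast
    have "supp (Q (\<phi> 0 x)) \<subseteq> \<K> ([] @ [0])"
      using K(5)[of "[]" 0 x] x K(3) by simp
    moreover have "\<K> [0] \<subseteq> K'" by (rule K(4)) auto
    ultimately show ?thesis using flow_0[OF \<open>x \<in> M\<close>] by simp
  qed
  with K(1,2) show thesis by (rule that)
qed

lemma measurable_continuous: "continuous_on M f \<Longrightarrow> f \<in> borel_measurable (borel_of M)"
  by (rule borel_measurable_continuous_on_restrict)

text \<open>The support of \<open>Q x\<close> lies in a compact set, so a continuous function is
  bounded \<open>Q x\<close>-almost everywhere, whatever its growth on \<open>M\<close>.\<close>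

lemma integrable_Q:
  assumes "x \<in> M" "continuous_on M f"
  shows "integrable (Q x) (f :: 'a \<Rightarrow> real)"
proof -
  interpret prob_space "Q x" by (rule Q_prob[OF assms(1)])
  obtain K' where K': "compact K'" "K' \<subseteq> M" "supp (Q x) \<subseteq> K'"
  proof (rule support_compact[of "{x}"])
    show "compact {x}" "{x} \<subseteq> M" using assms(1) by auto
  qed (rule that, auto)
  have "bounded (f ` K')"
    by (intro compact_imp_bounded compact_continuous_image continuous_on_subset[OF assms(2)] K'(1,2))
  then obtain B where B: "\<And>y. y \<in> K' \<Longrightarrow> norm (f y) \<le> B" unfolding bounded_iff by auto
  have "AE y in Q x. norm (f y) \<le> B" using AE_Q_support[OF assms(1)] by eventually_elim (use B K'(3) in auto)
  moreover have "f \<in> borel_measurable (Q x)"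
    using measurable_continuous[OF assms(2)] measurable_cong_sets[OF sets_Q[OF assms(1)] refl] by blast
  ultimately show ?thesis by (intro integrable_const_bound)
qed

lemma kernel_op_le:
  assumes "x \<in> M" "continuous_on M f" "\<And>y. y \<in> supp (Q x) \<Longrightarrow> \<bar>f y\<bar> \<le> B"
  shows "\<bar>kernel_op Q f x\<bar> \<le> B"
proof -
  interpret prob_space "Q x" by (rule Q_prob[OF assms(1)])
  have "\<bar>kernel_op Q f x\<bar> \<le> (\<integral>y. \<bar>f y\<bar> \<partial>Q x)"
    unfolding kernel_op_def using integral_norm_bound[of "Q x" f] by simp
  also have "\<dots> \<le> (\<integral>y. B \<partial>Q x)"
  proof (rule integral_mono_AE)
    show "AE y in Q x. \<bar>f y\<bar> \<le> B" by (rule eventually_mono[OF AE_Q_support[OF assms(1)] assms(3)])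
  qed (simp_all add: integrable_Q[OF assms(1,2)])
  finally show ?thesis by (simp add: prob_space)
qed

text \<open>The stability property gives smoothness of the product of \<open>lam\<close> and
  \<open>Q g\<close>, not of \<open>Q g\<close> alone, so the differential calculus treats the
  product as one operator.\<close>

definition jump_op :: "('a \<Rightarrow> real) \<Rightarrow> 'a \<Rightarrow> real" where
  "jump_op g x = lam x * kernel_op Q g x"

lemma lam_C1: "C1_on M lam"
  using stability unfolding stability_property_def by (elim conjE)

lemma jump_op_C1: "C1_on M g \<Longrightarrow> C1_on M (jump_op g)"
proof -
  have "\<forall>f. C1_on M f \<longrightarrow> C1_on M (\<lambda>x. lam x * kernel_op Q f x)"
    using stability unfolding stability_property_def by (elim conjE)
  then show "C1_on M g \<Longrightarrow> C1_on M (jump_op g)" unfolding jump_op_def[abs_def] by blast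
qed

lemma lam_nonneg: "x \<in> M \<Longrightarrow> 0 \<le> lam x"
  using characteristics by (auto simp: homogeneous_characteristics_def jump_rate_def)

lemma jump_op_diff:
  assumes "x \<in> M" "continuous_on M f" "continuous_on M g"
  shows "jump_op (\<lambda>y. f y - g y) x = jump_op f x - jump_op g x"
  using integrable_Q[OF assms(1,2)] integrable_Q[OF assms(1,3)]
  by (simp add: jump_op_def kernel_op_def right_diff_distrib)

text \<open>The constant depends on \<open>K\<close> but not on \<open>g\<close>, which makes
  iteration possible: \<open>\<bar>l\<bar>\<close> takes care of the value and
  \<open>\<bar>\<psi>\<bar>\<close> of the gradient.\<close>

lemma jump_op_bound:
  assumes "compact K" "K \<subseteq> M"
  obtains c where "0 \<le> c" "\<And>g x B. C1_on M g \<Longrightarrow> x \<in> K \<Longrightarrow>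
    (\<forall>y\<in>supp (Q x). C1_size g y \<le> B) \<Longrightarrow>
    C1_size (jump_op g) x \<le> c * B"
proof -
  have "\<exists>\<Psi>. (\<forall>x\<in>M. 0 \<le> \<Psi> x) \<and> locally_bounded_on M \<Psi> \<and>
        (\<forall>f K x. C1_on M f \<and> compact K \<and> K \<subseteq> M \<and> x \<in> K \<longrightarrow>
           norm (grad M (jump_op f) x)
             \<le> (SUP z\<in>K. \<bar>\<Psi> z\<bar>) *
                (SUP y\<in>supp (Q x). C1_size f y))"
    using stability unfolding stability_property_def jump_op_def[abs_def] by (elim conjE)
  then obtain \<Psi> where "\<forall>f K x. C1_on M f \<and> compact K \<and> K \<subseteq> M \<and> x \<in> K \<longrightarrow>
           norm (grad M (jump_op f) x)
             \<le> (SUP z\<in>K. \<bar>\<Psi> z\<bar>) *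
                (SUP y\<in>supp (Q x). C1_size f y)"
    by (elim exE conjE) (rule that)
  then have \<Psi>: "norm (grad M (jump_op f) x)
             \<le> (SUP z\<in>K. \<bar>\<Psi> z\<bar>) * (SUP y\<in>supp (Q x). C1_size f y)"
    if "C1_on M f" "x \<in> K" for f x using assms that by blast
  define \<psi> where "\<psi> = (SUP z\<in>K. \<bar>\<Psi> z :: real\<bar>)"
  have "bounded (lam ` K)" using characteristics assms
    by (auto simp: homogeneous_characteristics_def jump_rate_def)
  then obtain l where l: "\<And>x. x \<in> K \<Longrightarrow> \<bar>lam x\<bar> \<le> l" unfolding bounded_iff by auto
  show thesis
  proof (rule that[of "\<bar>l\<bar> + \<bar>\<psi>\<bar>"])
    fix g x B assume g: "C1_on M g" and x: "x \<in> K"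
      and B: "\<forall>y\<in>supp (Q x). C1_size g y \<le> B"
    have xM: "x \<in> M" using x assms(2) by blast
    let ?s = "SUP y\<in>supp (Q x). C1_size g y"
    obtain y0 where y0: "y0 \<in> supp (Q x)" using support_nonempty[OF xM] by blast
    have sB: "?s \<le> B" using B y0 by (intro cSUP_least) auto
    \<comment> \<open>This allows \<open>\<psi>\<close> to be replaced by
      \<open>\<bar>\<psi>\<bar>\<close>; the supremum is over a nonempty bounded set of nonnegative
      numbers.\<close>
    have s0: "0 \<le> ?s"
    proof -
      have "bdd_above ((\<lambda>y. C1_size g y) ` supp (Q x))"
        using B by (auto intro!: bdd_aboveI)
      from cSUP_upper[OF y0 this] show ?thesis by (smt (verit) norm_ge_zero)
    qed
    have "norm (grad M (jump_op g) x) \<le> \<psi> * ?s" using \<Psi>[OF g x] by (simp add: \<psi>_def)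
    also have "\<dots> \<le> \<bar>\<psi>\<bar> * B" using s0 sB by (intro mult_mono) auto
    finally have 1: "norm (grad M (jump_op g) x) \<le> \<bar>\<psi>\<bar> * B" .
    have "\<bar>kernel_op Q g x\<bar> \<le> B"
    proof (rule kernel_op_le[OF xM C1_on_continuous[OF g]])
      fix y assume "y \<in> supp (Q x)"
      from B[rule_format, OF this] show "\<bar>g y\<bar> \<le> B" using norm_ge_zero[of "grad M g y"] by linarith
    qed
    then have "\<bar>jump_op g x\<bar> \<le> \<bar>l\<bar> * B"
      unfolding jump_op_def abs_mult using l[OF x] by (intro mult_mono) auto
    with 1 show "C1_size (jump_op g) x \<le> (\<bar>l\<bar> + \<bar>\<psi>\<bar>) * B"
      by (simp add: distrib_right)
  qed simp
qed

text \<open>The bound of the stability property applies to differences, by linearity, and turns the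
  uniform continuity of \<open>t \<mapsto> g t\<close> in \<open>C\<^sup>1\<close> of a compact set containing the supports into
  that of \<open>t \<mapsto> jump_op (g t)\<close>.\<close>

lemma C1_family_jump_op:
  assumes g: "C1_family {0::real..} g"
  shows "C1_family {0..} (\<lambda>t. jump_op (g t))"
proof -
  have gC1: "C1_on M (g t)" if "t \<in> {0..}" for t using C1_family_imp_C1_on[OF g that] .
  have hC1: "C1_on M (jump_op (g t))" if "t \<in> {0..}" for t using jump_op_C1[OF gC1[OF that]] .
  \<comment> \<open>Values and gradients form one map, so that a single continuity argument covers
    both.\<close>
  define H where "H p = (jump_op (g (fst p)) (snd p), grad M (jump_op (g (fst p))) (snd p))" for p
  have "continuous_on ({0..} \<times> M) H"
    unfolding continuous_on_iff
  proof (intro ballI allI impI)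
    fix p :: "real \<times> 'a" and e :: real assume p: "p \<in> {0..} \<times> M" and e: "0 < e"
    obtain a0 x0 where [simp]: "p = (a0, x0)" by (cases p)
    have a0: "a0 \<in> {0..}" "0 \<le> a0" and x0: "x0 \<in> M" using p by auto
    define N where "N = cball x0 1 \<inter> M"
    have N: "compact N" "N \<subseteq> M" using compact_cball_Int by (auto simp: N_def)
    obtain K' where K': "compact K'" "K' \<subseteq> M" "\<And>x. x \<in> N \<Longrightarrow> supp (Q x) \<subseteq> K'"
      by (fact support_compact[OF N])
    obtain c where c: "0 \<le> c" "\<And>g x B. C1_on M g \<Longrightarrow> x \<in> N \<Longrightarrow>
      (\<forall>y\<in>supp (Q x). C1_size g y \<le> B) \<Longrightarrow>
      C1_size (jump_op g) x \<le> c * B" by (fact jump_op_bound[OF N])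
    \<comment> \<open>Value and gradient of \<open>g\<close> each move by less than
      \<open>\<eta>\<close>, so \<open>jump_op_bound\<close> yields \<open>c * (2 * \<eta>)\<close>,
      which must stay below \<open>e / 2\<close>; the added 1 covers \<open>c = 0\<close>.\<close>
    define \<eta> where "\<eta> = e / (2 * (2 * c + 1))"
    have \<eta>: "\<eta> > 0" using e c(1) by (simp add: \<eta>_def)
    have c\<eta>: "c * (2 * \<eta>) < e / 2"
    proof -
      have "c * (2 * \<eta>) < (2 * c + 1) * \<eta>" using \<eta> by (simp add: algebra_simps)
      also have "\<dots> = e / 2" using c(1) by (simp add: \<eta>_def field_simps)
      finally show ?thesis .
    qed
    let ?Z = "{0..a0 + 1} \<times> K'"
    let ?F = "\<lambda>q. (g (fst q) (snd q), grad M (g (fst q)) (snd q))"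
    have "continuous_on ?Z ?F"
      using K'(2) by (intro continuous_on_Pair C1_familyD(2,3)[OF g] continuous_intros) auto
    then have "uniformly_continuous_on ?Z ?F"
      using K'(1) by (intro compact_uniformly_continuous compact_Times) auto
    then obtain d1 where d1: "d1 > 0" "\<And>q q'. q \<in> ?Z \<Longrightarrow> q' \<in> ?Z \<Longrightarrow> dist q' q < d1 \<Longrightarrow> dist (?F q') (?F q) < \<eta>"
      using \<eta> unfolding uniformly_continuous_on_def by meson
    have "continuous_on M (\<lambda>x. H (a0, x))"
      unfolding H_def using C1_on_continuous[OF hC1[OF a0(1)]] C1_onD(2)[OF hC1[OF a0(1)]]
      by (auto intro: continuous_on_Pair)
    then obtain d2 where d2: "d2 > 0" "\<And>x. x \<in> M \<Longrightarrow> dist x x0 < d2 \<Longrightarrow> dist (H (a0, x)) (H (a0, x0)) < e / 2"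
      using x0 e unfolding continuous_on_iff by (metis half_gt_zero)
    show "\<exists>d>0. \<forall>p'\<in>{0..} \<times> M. dist p' p < d \<longrightarrow> dist (H p') (H p) < e"
    proof (intro exI[of _ "min (min d1 d2) 1"] conjI ballI impI)
      fix p' assume p': "p' \<in> {0..} \<times> M" "dist p' p < min (min d1 d2) 1"
      obtain a x where [simp]: "p' = (a, x)" by (cases p')
      have a: "a \<in> {0..}" "0 \<le> a" and x: "x \<in> M" using p' by auto
      have "dist a a0 \<le> dist p' p" "dist x x0 \<le> dist p' p"
        using dist_fst_le[of p' p] dist_snd_le[of p' p] by simp_all
      with p'(2) have da: "dist a a0 < d1" "dist a a0 < 1" and dx: "dist x x0 < d2" "dist x x0 < 1" by auto
      have xN: "x \<in> N" using dx(2) x by (simp add: N_def dist_commute)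
      have C1d: "C1_on M (\<lambda>y. g a y - g a0 y)" by (intro C1_on_diff gC1 a a0)
      have bd: "C1_size (jump_op (\<lambda>y. g a y - g a0 y)) x \<le> c * (2 * \<eta>)"
      proof (rule c(2)[OF C1d xN], intro ballI)
        fix y assume "y \<in> supp (Q x)"
        then have y: "y \<in> K'" using K'(3)[OF xN] by blast
        then have yM: "y \<in> M" using K'(2) by blast
        have "dist (a, y) (a0, y) = dist a a0" by (simp add: dist_Pair_Pair)
        then have *: "dist (?F (a, y)) (?F (a0, y)) < \<eta>"
          using d1(2)[of "(a0, y)" "(a, y)"] da y a a0 by (auto simp: dist_real_def)
        have "dist (g a y) (g a0 y) < \<eta>" "dist (grad M (g a) y) (grad M (g a0) y) < \<eta>"
          using order_le_less_trans[OF dist_fst_le *] order_le_less_trans[OF dist_snd_le *] by simp_all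
        then show "\<bar>g a y - g a0 y\<bar> + norm (grad M (\<lambda>y. g a y - g a0 y) y) \<le> 2 * \<eta>"
          unfolding grad_diff[OF gC1[OF a(1)] gC1[OF a0(1)] yM] by (simp add: dist_norm)
      qed
      have eq: "jump_op (\<lambda>y. g a y - g a0 y) z = jump_op (g a) z - jump_op (g a0) z" if "z \<in> M" for z
        by (rule jump_op_diff[OF that]) (use gC1 a a0 C1_on_continuous in auto)
      have "((\<lambda>z. jump_op (g a) z - jump_op (g a0) z) has_derivative
          (\<lambda>w. grad M (jump_op (g a)) x \<bullet> w - grad M (jump_op (g a0)) x \<bullet> w)) (at x within M)"
        by (intro has_derivative_diff C1_onD(1)[OF hC1[OF a(1)] x] C1_onD(1)[OF hC1[OF a0(1)] x])
      then have d: "has_grad (\<lambda>z. jump_op (g a) z - jump_op (g a0) z) (grad M (jump_op (g a)) x - grad M (jump_op (g a0)) x) x"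
        by (simp only: inner_diff_left)
      \<comment> \<open>Linearity of \<open>jump_op\<close> is known at points of \<open>M\<close>,
        where both integrals are finite; a derivative within \<open>M\<close> sees nothing
        else.\<close>
      have "has_grad (jump_op (\<lambda>y. g a y - g a0 y)) (grad M (jump_op (g a)) x - grad M (jump_op (g a0)) x) x"
        by (rule has_derivative_transform_locally[OF d open_UNIV UNIV_I x]) (simp add: eq)
      from grad_eq[OF x this] grad_eq[OF x d]
      have "grad M (jump_op (\<lambda>y. g a y - g a0 y)) x = grad M (\<lambda>z. jump_op (g a) z - jump_op (g a0) z) x"
        by simp
      then have gr: "grad M (jump_op (\<lambda>y. g a y - g a0 y)) x = grad M (jump_op (g a)) x - grad M (jump_op (g a0)) x"
        using grad_diff[OF hC1[OF a(1)] hC1[OF a0(1)] x] by simp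
      have "dist (H (a, x)) (H (a0, x)) \<le> dist (jump_op (g a) x) (jump_op (g a0) x)
          + dist (grad M (jump_op (g a)) x) (grad M (jump_op (g a0)) x)"
        by (simp add: H_def dist_Pair_Pair sqrt_sum_squares_le_sum)
      also have "\<dots> \<le> c * (2 * \<eta>)" using bd unfolding gr eq[OF x] by (simp add: dist_norm)
      finally have "dist (H (a, x)) (H (a0, x)) < e / 2" using c\<eta> by linarith
      moreover have "dist (H (a0, x)) (H (a0, x0)) < e / 2" by (rule d2(2)[OF x dx(1)])
      ultimately show "dist (H p') (H p) < e"
        using dist_triangle[of "H (a, x)" "H (a0, x0)" "H (a0, x)"] by simp
    qed (use d1(1) d2(1) in simp)
  qed
  from continuous_on_fst[OF this] continuous_on_snd[OF this]
  show ?thesis unfolding C1_family_def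
    using C1_onD(1)[OF hC1] by (simp add: H_def)
qed

subsection \<open>The expansion of the semigroup in the number of jumps\<close>

text \<open>The integral of the rate along the flow over \<open>{0..t}\<close>, rescaled to a fixed
  interval so that \<open>t\<close> enters through the integrand and
  \<open>C1_family_integral\<close> applies.\<close>

definition cumrate :: "real \<Rightarrow> 'a \<Rightarrow> real" where
  "cumrate t x = integral {0..1} (\<lambda>s. t * lam (\<phi> (t * s) x))"

lemma C1_family_cumrate: "C1_family {0..} cumrate"
proof -
  have "C1_family ({0..} \<times> {0..1}) (\<lambda>p x. fst p * lam (\<phi> (fst p * snd p) x))"
    by (intro C1_family_scale C1_family_flow_compose[where g = "\<lambda>_. lam"] C1_on_imp_C1_family lam_C1)
      (auto intro!: continuous_intros)
  from C1_family_integral(1)[OF this] show ?thesis by (simp add: cumrate_def[abs_def])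
qed

lemma cumrate_nonneg: "0 \<le> t \<Longrightarrow> x \<in> M \<Longrightarrow> 0 \<le> cumrate t x"
  unfolding cumrate_def
  by (intro integral_nonneg integrable_continuous_interval continuous_intros
      continuous_on_compose2[OF C1_on_continuous[OF lam_C1] continuous_flow])
    (auto intro!: mult_nonneg_nonneg lam_nonneg flow_in continuous_intros)

text \<open>The terms of the expansion in rescaled form: the first jump occurs at time
  \<open>t * s\<close>, the time left is \<open>t * (1 - s)\<close>, and the outer factor
  \<open>t\<close> is the Jacobian.\<close>

primrec jump_term :: "nat \<Rightarrow> ('a \<Rightarrow> real) \<Rightarrow> real \<Rightarrow> 'a \<Rightarrow> real" where
  "jump_term 0 f t x = exp (- cumrate t x) * f (\<phi> t x)"
| "jump_term (Suc n) f t x = integral {0..1} (\<lambda>s. t * (exp (- cumrate (t * s) x) *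
     jump_op (jump_term n f (t * (1 - s))) (\<phi> (t * s) x)))"

lemma C1_family_jump_integrand:
  assumes "C1_family {0::real..} g"
  shows "C1_family ({0..} \<times> {0..1}) (\<lambda>p x. fst p * (exp (- cumrate (fst p * snd p) x) *
     jump_op (g (fst p * (1 - snd p))) (\<phi> (fst p * snd p) x)))"
proof -
  have "C1_family ({0..} \<times> {0..1}) (\<lambda>p. cumrate (fst p * snd p))"
    by (rule C1_family_compose_param[OF C1_family_cumrate]) (auto intro!: continuous_intros)
  moreover have "C1_family ({0..} \<times> {0..1}) (\<lambda>p. jump_op (g (fst p * (1 - snd p))))"
    by (rule C1_family_compose_param[OF C1_family_jump_op[OF assms], of _ "\<lambda>p. fst p * (1 - snd p)"])
      (auto intro!: continuous_intros)
  then have "C1_family ({0..} \<times> {0..1}) (\<lambda>p x. jump_op (g (fst p * (1 - snd p))) (\<phi> (fst p * snd p) x))"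
    by (rule C1_family_flow_compose) (auto intro!: continuous_intros)
  ultimately show ?thesis
    by (intro C1_family_scale C1_family_mult C1_family_exp) (auto intro!: continuous_intros)
qed

lemma C1_family_jump_term:
  assumes "C1_on M f"
  shows "C1_family {0..} (jump_term n f)"
proof (induction n)
  case 0
  have "C1_family {0..} (\<lambda>t x. exp (- cumrate t x) * f (\<phi> t x))"
    by (intro C1_family_mult C1_family_exp C1_family_cumrate C1_family_flow_compose[where g = "\<lambda>_. f"]
        C1_on_imp_C1_family assms) (auto intro: continuous_intros)
  then show ?case by (simp add: fun_eq_iff[symmetric] jump_term.simps(1)[abs_def])
next
  case (Suc n)
  from C1_family_integral(1)[OF C1_family_jump_integrand[OF Suc]] show ?case
    by (simp add: jump_term.simps(2)[abs_def])
qed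

text \<open>The factor that turns \<open>fact n\<close> into \<open>fact (Suc n)\<close> in the
  induction for \<open>jump_term_bound\<close>.\<close>

lemma integral_one_minus_power: "integral {0..1} (\<lambda>s::real. (1 - s) ^ n) = 1 / Suc n"
proof -
  have "((\<lambda>s::real. (1 - s) ^ n) has_integral (- ((1 - 1) ^ Suc n / Suc n) - - ((1 - 0) ^ Suc n / Suc n))) {0..1}"
    by (rule fundamental_theorem_of_calculus)
      (auto simp: has_real_derivative_iff_has_vector_derivative[symmetric] simp del: power_Suc of_nat_Suc
        intro!: derivative_eq_intros)
  then show ?thesis by (simp add: integral_unique)
qed

lemma C1_family_bounded:
  assumes "C1_family {0::real..} g" "compact K" "K \<subseteq> M"
  obtains c where "0 \<le> c" "\<And>t x. t \<in> {0..T} \<Longrightarrow> x \<in> K \<Longrightarrow> C1_size (g t) x \<le> c"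
proof -
  have "continuous_on ({0..T} \<times> K) (\<lambda>p. \<bar>g (fst p) (snd p)\<bar> + norm (grad M (g (fst p)) (snd p)))"
    using assms(3) by (intro continuous_intros C1_familyD(2,3)[OF assms(1)]) auto
  then have "bounded ((\<lambda>p. \<bar>g (fst p) (snd p)\<bar> + norm (grad M (g (fst p)) (snd p))) ` ({0..T} \<times> K))"
    using assms(2) by (intro compact_imp_bounded compact_continuous_image compact_Times) auto
  then obtain c where c: "\<forall>z\<in>(\<lambda>p. \<bar>g (fst p) (snd p)\<bar> + norm (grad M (g (fst p)) (snd p))) ` ({0..T} \<times> K). norm z \<le> c"
    unfolding bounded_iff by blast
  show thesis
  proof (rule that[of "\<bar>c\<bar>"])
    fix t x assume "t \<in> {0..T}" "x \<in> K"
    then have "(t, x) \<in> {0..T} \<times> K" by blast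
    from bspec[OF c imageI[OF this]] show "C1_size (g t) x \<le> \<bar>c\<bar>" by simp
  qed simp
qed

text \<open>The induction runs over all \<open>\<K> ts\<close> with
  \<open>sum_list ts + t \<le> T\<close>: a jump at time \<open>u\<close> leads from
  \<open>\<K> ts\<close> to \<open>\<K> (ts @ [u])\<close> and leaves the time \<open>t - u\<close>.
  All these sets lie in \<open>K'\<close>, so the same constants serve at every step.\<close>

lemma jump_term_bound:
  assumes f: "C1_on M f" and K: "compact K" "K \<subseteq> M" and T: "0 \<le> T"
  obtains c C where "0 \<le> c" "0 \<le> C" "\<And>n t x. t \<in> {0..T} \<Longrightarrow> x \<in> K \<Longrightarrow>
     C1_size (jump_term n f t) x \<le> c * ((C * t) ^ n / fact n)"
proof -
  obtain K' \<K> where K': "compact K'" "K' \<subseteq> M" "\<K> [] = K"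
    "\<And>ts. (\<forall>t\<in>set ts. 0 \<le> t) \<Longrightarrow> sum_list ts \<le> T \<Longrightarrow> \<K> ts \<subseteq> K'"
    "\<And>ts s x. (\<forall>t\<in>set ts. 0 \<le> t) \<Longrightarrow> 0 \<le> s \<Longrightarrow> sum_list ts + s \<le> T \<Longrightarrow> x \<in> \<K> ts \<Longrightarrow>
       \<phi> s x \<in> K' \<and> supp (Q (\<phi> s x)) \<subseteq> \<K> (ts @ [s])"
    by (fact compat_sets[OF K T])
  obtain c0 where c0: "0 \<le> c0" "\<And>t x. t \<in> {0..T} \<Longrightarrow> x \<in> K' \<Longrightarrow> C1_size (jump_term 0 f t) x \<le> c0"
    by (fact C1_family_bounded[OF C1_family_jump_term[OF f] K'(1,2), where T = T])
  obtain cL where cL: "0 \<le> cL" "\<And>t x. t \<in> {0..T} \<Longrightarrow> x \<in> K' \<Longrightarrow> C1_size (cumrate t) x \<le> cL"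
    by (fact C1_family_bounded[OF C1_family_cumrate K'(1,2), where T = T])
  have "\<forall>b. \<exists>c. \<forall>t\<in>{0..T}. \<forall>x\<in>K'. norm (flow_grad t x b) \<le> c"
  proof
    fix b
    obtain c where "0 \<le> c" and c: "\<And>t x. t \<in> {0..T} \<Longrightarrow> x \<in> K' \<Longrightarrow> \<bar>\<phi> t x \<bullet> b\<bar> + norm (grad M (\<lambda>x. \<phi> t x \<bullet> b) x) \<le> c"
      by (fact C1_family_bounded[OF C1_family_flow[of b] K'(1,2), where T = T])
    have "norm (flow_grad t x b) \<le> c" if "t \<in> {0..T}" "x \<in> K'" for t x
      unfolding flow_grad_def using c[OF that] by linarith
    then show "\<exists>c. \<forall>t\<in>{0..T}. \<forall>x\<in>K'. norm (flow_grad t x b) \<le> c" by blast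
  qed
  then obtain cb where cb: "\<And>b t x. t \<in> {0..T} \<Longrightarrow> x \<in> K' \<Longrightarrow> norm (flow_grad t x b) \<le> cb b" by metis
  define cJ where "cJ = \<bar>\<Sum>b\<in>Basis. cb b\<bar>"
  have cJ: "(\<Sum>b\<in>Basis. norm (flow_grad t x b)) \<le> cJ" if "t \<in> {0..T}" "x \<in> K'" for t x
    unfolding cJ_def using sum_mono[of Basis "\<lambda>b. norm (flow_grad t x b)" cb] cb[OF that] by fastforce
  obtain cQ where cQ: "0 \<le> cQ" "\<And>g x B. C1_on M g \<Longrightarrow> x \<in> K' \<Longrightarrow>
    (\<forall>y\<in>supp (Q x). C1_size g y \<le> B) \<Longrightarrow>
    C1_size (jump_op g) x \<le> cQ * B" by (fact jump_op_bound[OF K'(1,2)])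
  \<comment> \<open>One step costs \<open>cQ\<close> for the jump operator, times a sum: 1 for the
    value, \<open>cL\<close> for the gradient of the survival factor, \<open>cJ\<close> for the
    differential of the flow.\<close>
  define C where "C = (1 + cL + cJ) * cQ"
  have C0: "0 \<le> C" using cL(1) cQ(1) by (simp add: C_def cJ_def)
  have main: "C1_size (jump_term n f t) x \<le> c0 * ((C * t) ^ n / fact n)"
    if "\<forall>t\<in>set ts. 0 \<le> t" "0 \<le> t" "sum_list ts + t \<le> T" "x \<in> \<K> ts" for n ts t x
    using that
  proof (induction n arbitrary: ts t x)
    case 0
    have "0 \<le> sum_list ts" using 0 by (intro sum_list_nonneg) auto
    then have "\<K> ts \<subseteq> K'" "t \<le> T" using 0 K'(4)[of ts] by auto
    then have "t \<in> {0..T}" "x \<in> K'" using 0 by auto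
    from c0(2)[OF this] show ?case by (simp del: jump_term.simps)
  next
    case (Suc n)
    note prems = Suc.prems
    have "0 \<le> sum_list ts" using prems by (intro sum_list_nonneg) auto
    then have tT: "t \<le> T" and xK: "x \<in> K'" using prems K'(4)[of ts] by auto
    have xM: "x \<in> M" using xK K'(2) by blast
    define k where "k s = (\<lambda>x. t * (exp (- cumrate (t * s) x) *
       jump_op (jump_term n f (t * (1 - s))) (\<phi> (t * s) x)))" for s
    have famk: "C1_family ({t} \<times> {0..1}) (\<lambda>p x. fst p * (exp (- cumrate (fst p * snd p) x) *
       jump_op (jump_term n f (fst p * (1 - snd p))) (\<phi> (fst p * snd p) x)))"
      using C1_family_compose_param[OF C1_family_jump_integrand[OF C1_family_jump_term[OF f]], of "{t} \<times> {0..1}" "\<lambda>p. p"]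
        prems(2) by auto
    have pt: "continuous_on {0..1} (\<lambda>s::real. (t, s))" "continuous_on {0..1} (\<lambda>_::real. x)"
      "(\<lambda>s::real. (t, s)) ` {0..1} \<subseteq> {t} \<times> {0..1}" "(\<lambda>_::real. x) ` {0..1} \<subseteq> M"
      using xM by (auto intro: continuous_on_Pair continuous_intros)
    have contk: "continuous_on {0..1} (\<lambda>s. k s x)" "continuous_on {0..1} (\<lambda>s. grad M (k s) x)"
      using C1_familyD(2,3)[OF famk pt] by (simp_all add: k_def)
    define B where "B s = c0 * ((C * (t * (1 - s))) ^ n / fact n)" for s
    \<comment> \<open>\<open>B s\<close> is the induction bound at the remaining time
      \<open>t * (1 - s)\<close>.\<close>
    have B0: "0 \<le> B s" if "s \<in> {0..1}" for s
      using that c0(1) C0 prems(2) by (auto simp: B_def intro!: mult_nonneg_nonneg divide_nonneg_nonneg)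
    have kb: "C1_size (k s) x \<le> t * (C * B s)" if s: "s \<in> {0..1}" for s
    proof -
      define u where "u = t * s"
      have u: "0 \<le> u" "u \<in> {0..T}" "u \<le> t"
        using s prems(2) tT mult_left_le[of s t] by (auto simp: u_def)
      have tu: "t * (1 - s) = t - u" "0 \<le> t - u" using u by (auto simp: u_def algebra_simps)
      define h where "h = jump_op (jump_term n f (t - u))"
      have gC1: "C1_on M (jump_term n f (t - u))" using C1_family_imp_C1_on[OF C1_family_jump_term[OF f]] tu by auto
      have hC1: "C1_on M h" unfolding h_def by (rule jump_op_C1[OF gC1])
      have cC1: "C1_on M (cumrate u)" using C1_family_imp_C1_on[OF C1_family_cumrate] u by auto
      have comp: "\<phi> u x \<in> K'" "supp (Q (\<phi> u x)) \<subseteq> \<K> (ts @ [u])"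
        using K'(5)[of ts u x] prems u by auto
      have hb: "\<bar>h (\<phi> u x)\<bar> + norm (grad M h (\<phi> u x)) \<le> cQ * B s"
        unfolding h_def
      proof (rule cQ(2)[OF gC1 comp(1)], intro ballI)
        fix y assume "y \<in> supp (Q (\<phi> u x))"
        with comp(2) have "y \<in> \<K> (ts @ [u])" by blast
        then show "C1_size (jump_term n f (t - u)) y \<le> B s"
          unfolding B_def tu(1) using prems u tu(2) by (intro Suc.IH[of "ts @ [u]"]) auto
      qed
      define e where "e = (\<lambda>x. exp (- cumrate u x))"
      define w where "w = (\<lambda>x. h (\<phi> u x))"
      have wfam: "C1_family {u} (\<lambda>a x. h (\<phi> a x))"
        using u by (intro C1_family_flow_compose[where g = "\<lambda>_. h"] C1_on_imp_C1_family hC1) auto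
      have wC1: "C1_on M w" unfolding w_def using C1_family_imp_C1_on[OF wfam, of u] by simp
      have eC1: "C1_on M e" unfolding e_def
        using C1_family_imp_C1_on[OF C1_family_exp[OF C1_on_imp_C1_family[OF cC1]], of "0::nat" UNIV] by simp
      have kt: "k s = (\<lambda>x. t * (e x * w x))" by (simp add: k_def e_def w_def h_def u_def tu(1))
      have ewC1: "C1_on M (\<lambda>x. e x * w x)" by (rule C1_on_mult[OF eC1 wC1])
      have gk: "norm (grad M (k s) x) \<le> t * norm (grad M (\<lambda>x. e x * w x) x)"
        unfolding kt using norm_grad_mult_le[OF C1_on_const[of t] ewC1 xM]
          norm_grad_le[OF xM, of "\<lambda>_. t" 0] prems(2) by simp
      have e1: "\<bar>e x\<bar> \<le> 1" using cumrate_nonneg[OF u(1) xM] by (simp add: e_def)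
      have ge: "norm (grad M e x) \<le> cL"
      proof -
        have "norm (grad M e x) \<le> norm (grad M (cumrate u) x)"
          unfolding e_def by (rule norm_grad_exp_le[OF cC1 xM cumrate_nonneg[OF u(1) xM]])
        also have "\<dots> \<le> cL" using cL(2)[OF u(2) xK] by linarith
        finally show ?thesis .
      qed
      have gw: "norm (grad M w x) \<le> cJ * norm (grad M h (\<phi> u x))"
      proof -
        have "norm (grad M w x) \<le> (\<Sum>b\<in>Basis. norm (flow_grad u x b)) * norm (grad M h (\<phi> u x))"
          unfolding w_def by (rule norm_grad_flow_le[OF hC1 u(1) xM])
        also have "\<dots> \<le> cJ * norm (grad M h (\<phi> u x))" by (intro mult_right_mono cJ[OF u(2) xK]) simp
        finally show ?thesis .
      qed
      have "norm (grad M (\<lambda>x. e x * w x) x) \<le> \<bar>e x\<bar> * norm (grad M w x) + \<bar>w x\<bar> * norm (grad M e x)"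
        by (rule norm_grad_mult_le[OF eC1 wC1 xM])
      also have "\<dots> \<le> 1 * (cJ * norm (grad M h (\<phi> u x))) + \<bar>w x\<bar> * cL"
        using e1 ge gw by (intro add_mono mult_mono) auto
      finally have gew: "norm (grad M (\<lambda>x. e x * w x) x) \<le> 1 * (cJ * norm (grad M h (\<phi> u x))) + \<bar>w x\<bar> * cL" .
      have wx: "\<bar>w x\<bar> = \<bar>h (\<phi> u x)\<bar>" by (simp add: w_def)
      have kx: "\<bar>k s x\<bar> \<le> t * \<bar>h (\<phi> u x)\<bar>"
      proof -
        have "\<bar>e x\<bar> * \<bar>w x\<bar> \<le> 1 * \<bar>w x\<bar>" using e1 by (intro mult_right_mono) auto
        then show ?thesis unfolding kt abs_mult using prems(2) by (auto simp: w_def intro: mult_left_mono)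
      qed
      have "norm (grad M (k s) x) \<le> t * (1 * (cJ * norm (grad M h (\<phi> u x))) + \<bar>h (\<phi> u x)\<bar> * cL)"
        using order_trans[OF gk mult_left_mono[OF gew prems(2)]] unfolding wx .
      with kx have "C1_size (k s) x \<le> t * \<bar>h (\<phi> u x)\<bar>
          + t * (1 * (cJ * norm (grad M h (\<phi> u x))) + \<bar>h (\<phi> u x)\<bar> * cL)"
        by (rule add_mono)
      also have "\<dots> = t * ((1 + cL) * \<bar>h (\<phi> u x)\<bar> + cJ * norm (grad M h (\<phi> u x)))" by (simp add: algebra_simps)
      also have "\<dots> \<le> t * ((1 + cL + cJ) * (\<bar>h (\<phi> u x)\<bar> + norm (grad M h (\<phi> u x))))"
      proof (intro mult_left_mono)
        have "0 \<le> cJ * \<bar>h (\<phi> u x)\<bar>" "0 \<le> (1 + cL) * norm (grad M h (\<phi> u x))"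
          using cL(1) by (auto simp: cJ_def)
        then show "(1 + cL) * \<bar>h (\<phi> u x)\<bar> + cJ * norm (grad M h (\<phi> u x))
            \<le> (1 + cL + cJ) * (\<bar>h (\<phi> u x)\<bar> + norm (grad M h (\<phi> u x)))" by (simp add: algebra_simps)
      qed (rule prems(2))
      also have "\<dots> \<le> t * ((1 + cL + cJ) * (cQ * B s))"
        using hb prems(2) cL(1) by (intro mult_left_mono) (auto simp: cJ_def)
      finally show ?thesis by (simp add: C_def mult.assoc)
    qed
    have "\<bar>jump_term (Suc n) f t x\<bar> \<le> integral {0..1} (\<lambda>s. \<bar>k s x\<bar>)"
      using integral_norm_bound_integral[of "\<lambda>s. k s x" "{0..1}" "\<lambda>s. \<bar>k s x\<bar>"] contk(1)
      by (simp add: k_def integrable_continuous_interval continuous_on_rabs)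
    moreover have "norm (grad M (jump_term (Suc n) f t) x) \<le> integral {0..1} (\<lambda>s. norm (grad M (k s) x))"
      using C1_family_integral(2)[OF famk, of t x] xM by (simp add: k_def jump_term.simps(2)[abs_def])
    ultimately have "C1_size (jump_term (Suc n) f t) x
        \<le> integral {0..1} (\<lambda>s. \<bar>k s x\<bar>) + integral {0..1} (\<lambda>s. norm (grad M (k s) x))" by linarith
    also have "\<dots> = integral {0..1} (\<lambda>s. C1_size (k s) x)"
      by (intro integral_add[symmetric] integrable_continuous_interval continuous_intros contk)
    also have "\<dots> \<le> integral {0..1} (\<lambda>s. t * (C * B s))"
      by (intro integral_le integrable_continuous_interval continuous_intros contk kb)
        (auto simp: B_def intro!: continuous_intros)
    \<comment> \<open>The factor \<open>t\<close> of the rescaling and the new factor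
      \<open>C\<close> complete the power \<open>Suc n\<close>; what depends on \<open>s\<close> is
      \<open>(1 - s) ^ n\<close>.\<close>
    also have "\<dots> = integral {0..1} (\<lambda>s. (c0 * ((C * t) ^ Suc n / fact n)) * (1 - s) ^ n)"
      by (intro integral_cong) (simp add: B_def power_mult_distrib mult_ac)
    also have "\<dots> = c0 * ((C * t) ^ Suc n / fact (Suc n))"
      by (simp add: integral_one_minus_power field_simps del: power_Suc of_nat_Suc)
    finally show ?case .
  qed
  show thesis
    by (rule that[OF c0(1) C0]) (use main[of "[]"] K'(3) in auto)
qed

text \<open>The term bounds sum to \<open>c * exp (C * t)\<close>, which increases with
  \<open>t\<close>; hence the uniform constant \<open>c * exp (C * T)\<close>.\<close>

lemma jump_series:
  assumes f: "C1_on M f"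
  shows "0 \<le> t \<Longrightarrow> x \<in> M \<Longrightarrow> summable (\<lambda>n. jump_term n f t x)"
    "0 \<le> t \<Longrightarrow> C1_on M (\<lambda>x. \<Sum>n. jump_term n f t x)"
    "compact K \<Longrightarrow> K \<subseteq> M \<Longrightarrow> 0 \<le> T \<Longrightarrow> \<exists>C\<ge>0. \<forall>t\<in>{0..T}. \<forall>x\<in>K.
       \<bar>\<Sum>n. jump_term n f t x\<bar> + norm (grad M (\<lambda>x. \<Sum>n. jump_term n f t x) x) \<le> C"
proof -
  have bd: "\<exists>B. summable B \<and> (\<forall>n. \<forall>x\<in>K. C1_size (jump_term n f t) x \<le> B n)"
    if Kt: "compact K" "K \<subseteq> M" "0 \<le> t" for K t
  proof -
    obtain c C where c: "0 \<le> c" "0 \<le> C" "\<And>n s x. s \<in> {0..t} \<Longrightarrow> x \<in> K \<Longrightarrow>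
      C1_size (jump_term n f s) x \<le> c * ((C * s) ^ n / fact n)"
      by (fact jump_term_bound[OF f Kt])
    have "summable (\<lambda>n. c * ((C * t) ^ n / fact n))"
      using summable_exp[of "C * t"] by (intro summable_mult) (simp add: field_simps)
    with c(3)[of t] Kt(3) show ?thesis by auto
  qed
  have C1: "C1_on M (jump_term n f t)" if "0 \<le> t" for n t
    using C1_family_imp_C1_on[OF C1_family_jump_term[OF f]] that by auto
  show sm: "summable (\<lambda>n. jump_term n f t x)" if tx: "0 \<le> t" "x \<in> M" for t x
  proof -
    obtain B where B: "summable B" "\<And>n. C1_size (jump_term n f t) x \<le> B n"
      using bd[of "{x}" t] tx by auto
    have "norm (jump_term n f t x) \<le> B n" for n using B(2)[of n] norm_ge_zero[of "grad M (jump_term n f t) x"]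
      unfolding real_norm_def by linarith
    then show ?thesis by (intro summable_comparison_test'[OF B(1)]) auto
  qed
  show "C1_on M (\<lambda>x. \<Sum>n. jump_term n f t x)" if "0 \<le> t" for t
    by (rule C1_on_series(1)[OF C1[OF that] bd[OF _ _ that]])
  assume K: "compact K" "K \<subseteq> M" and T: "0 \<le> T"
  obtain c C where c: "0 \<le> c" "0 \<le> C" "\<And>n s x. s \<in> {0..T} \<Longrightarrow> x \<in> K \<Longrightarrow>
      C1_size (jump_term n f s) x \<le> c * ((C * s) ^ n / fact n)"
    by (fact jump_term_bound[OF f K T])
  have ex: "(\<lambda>n. c * ((C * t) ^ n / fact n)) sums (c * exp (C * t))" for t
    using exp_converges[of "C * t"] by (intro sums_mult) (simp add: field_simps)
  have "\<bar>\<Sum>n. jump_term n f t x\<bar> + norm (grad M (\<lambda>x. \<Sum>n. jump_term n f t x) x) \<le> c * exp (C * T)"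
    if t: "t \<in> {0..T}" and x: "x \<in> K" for t x
  proof -
    have t0: "0 \<le> t" and xM: "x \<in> M" using t x K(2) by auto
    let ?u = "\<lambda>n. jump_term n f t x" and ?v = "\<lambda>n. norm (grad M (jump_term n f t) x)"
    have le: "\<bar>?u n\<bar> \<le> c * ((C * t) ^ n / fact n)" "?v n \<le> c * ((C * t) ^ n / fact n)" for n
      using c(3)[OF t x, of n] norm_ge_zero[of "grad M (jump_term n f t) x"] by linarith+
    have s: "summable (\<lambda>n. \<bar>?u n\<bar>)" "summable ?v"
      using le by (auto intro!: summable_comparison_test'[OF sums_summable[OF ex[of t]]])
    have "\<bar>\<Sum>n. ?u n\<bar> + norm (grad M (\<lambda>x. \<Sum>n. jump_term n f t x) x) \<le> (\<Sum>n. \<bar>?u n\<bar>) + (\<Sum>n. ?v n)"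
      by (intro add_mono summable_rabs s(1) C1_on_series(2)[OF C1[OF t0] bd[OF _ _ t0] xM])
    also have "\<dots> = (\<Sum>n. \<bar>?u n\<bar> + ?v n)" by (rule suminf_add[OF s])
    also have "\<dots> \<le> (\<Sum>n. c * ((C * t) ^ n / fact n))"
      by (intro suminf_le summable_add s c(3)[OF t x] sums_summable[OF ex])
    also have "\<dots> = c * exp (C * t)" using ex by (simp add: sums_iff)
    also have "\<dots> \<le> c * exp (C * T)" using t c(1,2) by (intro mult_left_mono) (auto intro: mult_left_mono)
    finally show ?thesis .
  qed
  then show "\<exists>C\<ge>0. \<forall>t\<in>{0..T}. \<forall>x\<in>K.
       \<bar>\<Sum>n. jump_term n f t x\<bar> + norm (grad M (\<lambda>x. \<Sum>n. jump_term n f t x) x) \<le> C"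
    using c(1) by (intro exI[of _ "c * exp (C * T)"]) auto
qed


subsection \<open>The law of the first jump time\<close>

text \<open>Negative times are clamped to 0. The flow becomes measurable in time over all of
  \<open>borel\<close>, and the rate along it is continuous on the whole line, which provides
  two-sided derivatives at time 0.\<close>

definition flow_ext :: "real \<Rightarrow> 'a \<Rightarrow> 'a" where "flow_ext t x = \<phi> (max 0 t) x"

lemma flow_ext_in: "x \<in> M \<Longrightarrow> flow_ext t x \<in> M"
  by (simp add: flow_ext_def flow_in)

lemma continuous_rate: "x \<in> M \<Longrightarrow> continuous_on S (\<lambda>s. lam (flow_ext s x))"
  unfolding flow_ext_def
  by (rule continuous_on_compose2[OF C1_on_continuous[OF lam_C1] continuous_flow])
    (auto intro!: continuous_intros flow_in)

lemma cumrate_integral: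
  assumes x: "x \<in> M" and t: "0 \<le> t"
  shows "integral {S..S + t} (\<lambda>s. lam (\<phi> (s - S) x)) = cumrate t x"
proof (cases "t = 0")
  case True
  then show ?thesis by (simp add: cumrate_def)
next
  case False
  then have tp: "t > 0" using t by simp
  have "continuous_on {S..S + t} (\<lambda>s. lam (\<phi> (s - S) x))"
    by (rule continuous_on_compose2[OF C1_on_continuous[OF lam_C1] continuous_flow])
      (use x in \<open>auto intro!: continuous_intros flow_in\<close>)
  then have "(\<lambda>s. lam (\<phi> (s - S) x)) integrable_on cbox S (S + t)"
    by (simp add: integrable_continuous_interval)
  then have "((\<lambda>s. lam (\<phi> (s - S) x)) has_integral integral {S..S + t} (\<lambda>s. lam (\<phi> (s - S) x))) (cbox S (S + t))"
    by (metis box_real(2) integrable_integral)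
  from has_integral_affinity'[OF this tp, of S]
  have "((\<lambda>s. lam (\<phi> (t * s) x)) has_integral integral {S..S + t} (\<lambda>s. lam (\<phi> (s - S) x)) / t) {0..1}"
    using tp by (simp add: divide_inverse mult.commute)
  from has_integral_mult_right[OF this, of t]
  have "((\<lambda>s. t * lam (\<phi> (t * s) x)) has_integral integral {S..S + t} (\<lambda>s. lam (\<phi> (s - S) x))) {0..1}"
    using tp by simp
  then show ?thesis unfolding cumrate_def by (rule integral_unique[symmetric])
qed

text \<open>Integration starts at -1, so that 0 is an interior point; subtracting the integral up to
  0 restores \<open>cumrate\<close> for nonnegative times.\<close>

lemma cumrate_antiderivative:
  assumes x: "x \<in> M"
  obtains g where "\<And>s. -1 < s \<Longrightarrow> s < T \<Longrightarrow> (g has_real_derivative lam (flow_ext s x)) (at s)"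
    "\<And>s. 0 \<le> s \<Longrightarrow> g s = cumrate s x"
proof -
  let ?c = "\<lambda>s. lam (flow_ext s x)"
  define g where "g s = integral {-1..s} ?c - integral {-1..0} ?c" for s
  have "(g has_real_derivative ?c s) (at s)" if s: "-1 < s" "s < T" for s
  proof -
    have "((\<lambda>s. integral {-1..s} ?c) has_real_derivative ?c s) (at s within {-1..T})"
      using s by (intro integral_has_real_derivative continuous_rate x) auto
    then have "((\<lambda>s. integral {-1..s} ?c) has_real_derivative ?c s) (at s)"
      using s by (simp add: at_within_interior[of s "{-1..T}"] interior_atLeastAtMost_real)
    then show ?thesis unfolding g_def by (auto intro!: derivative_eq_intros)
  qed
  moreover have "g s = cumrate s x" if s: "0 \<le> s" for s
  proof -
    have "integral {-1..0} ?c + integral {0..s} ?c = integral {-1..s} ?c"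
      using s by (intro Henstock_Kurzweil_Integration.integral_combine integrable_continuous_interval continuous_rate x) auto
    then have "g s = integral {0..s} ?c" by (simp add: g_def)
    also have "\<dots> = integral {0..s} (\<lambda>u. lam (\<phi> u x))"
      by (intro integral_cong) (auto simp: flow_ext_def max_def)
    also have "\<dots> = cumrate s x" using cumrate_integral[OF x s, of 0] by simp
    finally show ?thesis .
  qed
  ultimately show thesis by (rule that)
qed

lemma cumrate_0: "cumrate 0 x = 0"
  by (simp add: cumrate_def)

lemma cumrate_mono:
  assumes x: "x \<in> M" and st: "0 \<le> s" "s \<le> t"
  shows "cumrate s x \<le> cumrate t x"
proof -
  obtain g where g: "\<And>s. -1 < s \<Longrightarrow> s < t + 1 \<Longrightarrow> (g has_real_derivative lam (flow_ext s x)) (at s)"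
    "\<And>s. 0 \<le> s \<Longrightarrow> g s = cumrate s x" by (fact cumrate_antiderivative[OF x])
  have "g s \<le> g t"
  proof (rule DERIV_nonneg_imp_nondecreasing[OF st(2)])
    fix u assume "s \<le> u" "u \<le> t"
    then show "\<exists>y. (g has_real_derivative y) (at u) \<and> 0 \<le> y"
      using g(1)[of u] lam_nonneg[OF flow_ext_in[OF x]] st by (intro exI[of _ "lam (flow_ext u x)"]) simp
  qed
  then show ?thesis using g(2) st by simp
qed

lemma continuous_cumrate: "x \<in> M \<Longrightarrow> continuous_on {0..} (\<lambda>t. cumrate t x)"
  using C1_familyD(2)[OF C1_family_cumrate, of "{0..}" "\<lambda>t. t" "\<lambda>_. x"] by (auto intro: continuous_intros)

definition jump_time :: "'a \<Rightarrow> real \<Rightarrow> ereal" where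
  "jump_time x e = next_jump \<phi> lam 0 x e"

lemma next_jump_alt:
  assumes x: "x \<in> M"
  shows "next_jump \<phi> lam S x e = Inf {ereal (S + t) | t. 0 \<le> t \<and> e < cumrate t x}"
proof -
  have "(LBINT s:{S..t}. lam (\<phi> (s - S) x)) = cumrate (t - S) x" if t: "S \<le> t" for t
  proof -
    have "continuous_on {S..t} (\<lambda>s. lam (\<phi> (s - S) x))"
      by (rule continuous_on_compose2[OF C1_on_continuous[OF lam_C1] continuous_flow])
        (use x in \<open>auto intro!: continuous_intros flow_in\<close>)
    from set_borel_integral_eq_integral(2)[OF borel_integrable_atLeastAtMost'[OF this]]
    show ?thesis using cumrate_integral[OF x, of "t - S" S] t by simp
  qed
  then have "{ereal t | t. S \<le> t \<and> e < (LBINT s:{S..t}. lam (\<phi> (s - S) x))} =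
      {ereal t | t. S \<le> t \<and> e < cumrate (t - S) x}" by auto
  also have "\<dots> = {ereal (S + t) | t. 0 \<le> t \<and> e < cumrate t x}"
  proof safe
    fix t assume "S \<le> t" "e < cumrate (t - S) x"
    then show "\<exists>t'. ereal t = ereal (S + t') \<and> 0 \<le> t' \<and> e < cumrate t' x"
      by (intro exI[of _ "t - S"]) simp
  next
    fix t assume "0 \<le> t" "e < cumrate t x"
    then show "\<exists>t'. ereal (S + t) = ereal t' \<and> S \<le> t' \<and> e < cumrate (t' - S) x"
      by (intro exI[of _ "S + t"]) simp
  qed
  finally show ?thesis by (simp add: next_jump_def)
qed

text \<open>Time homogeneity of the rate along the flow. Comparing all lower bounds \<open>c\<close>
  treats finite and infinite infima alike.\<close>

lemma next_jump_shift:
  assumes x: "x \<in> M"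
  shows "next_jump \<phi> lam S x e = ereal S + jump_time x e"
proof -
  have "c \<le> next_jump \<phi> lam S x e \<longleftrightarrow> c \<le> ereal S + jump_time x e" for c
  proof -
    have "c \<le> next_jump \<phi> lam S x e \<longleftrightarrow> (\<forall>t. 0 \<le> t \<and> e < cumrate t x \<longrightarrow> c \<le> ereal (S + t))"
      unfolding next_jump_alt[OF x] le_Inf_iff by auto
    also have "\<dots> \<longleftrightarrow> (\<forall>t. 0 \<le> t \<and> e < cumrate t x \<longrightarrow> c - ereal S \<le> ereal t)"
      by (simp add: ereal_minus_le add.commute)
    also have "\<dots> \<longleftrightarrow> c - ereal S \<le> jump_time x e"
      unfolding jump_time_def next_jump_alt[OF x] le_Inf_iff by auto
    also have "\<dots> \<longleftrightarrow> c \<le> ereal S + jump_time x e"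
      by (simp add: ereal_minus_le add.commute)
    finally show ?thesis .
  qed
  then show ?thesis by (meson order_antisym order_refl)
qed

lemma jump_time_nonneg: "0 \<le> jump_time x e"
  unfolding jump_time_def next_jump_def by (auto intro!: Inf_greatest simp: zero_ereal_def)

text \<open>Monotonicity of \<open>cumrate\<close> gives one direction. For the other, continuity
  shows that the level \<open>e\<close> is already exceeded at some time strictly before
  \<open>a\<close>.\<close>

lemma jump_time_less_iff:
  assumes x: "x \<in> M"
  shows "jump_time x e < ereal a \<longleftrightarrow> 0 < a \<and> e < cumrate a x"
proof
  assume "jump_time x e < ereal a"
  then obtain t where "0 \<le> t" "e < cumrate t x" "t < a"
    unfolding jump_time_def next_jump_alt[OF x] Inf_less_iff by auto
  moreover from this have "cumrate t x \<le> cumrate a x" by (intro cumrate_mono[OF x]) auto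
  ultimately show "0 < a \<and> e < cumrate a x" by simp
next
  assume a: "0 < a \<and> e < cumrate a x"
  have "continuous_on {0..a} (\<lambda>t. cumrate t x)" by (rule continuous_on_subset[OF continuous_cumrate[OF x]]) auto
  then obtain d where d: "d > 0" "\<And>t. t \<in> {0..a} \<Longrightarrow> dist t a < d \<Longrightarrow> dist (cumrate t x) (cumrate a x) < cumrate a x - e"
    unfolding continuous_on_iff using a by (metis atLeastAtMost_iff diff_gt_0_iff_gt less_eq_real_def)
  define t where "t = max 0 (a - d / 2)"
  have t: "t \<in> {0..a}" "dist t a < d" "t < a" using a d(1) by (auto simp: t_def dist_real_def max_def)
  from d(2)[OF t(1,2)] have "e < cumrate t x" by (auto simp: dist_real_def)
  then show "jump_time x e < ereal a"
    unfolding jump_time_def next_jump_alt[OF x] Inf_less_iff using t by auto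
qed

text \<open>\<open>cumrate\<close> may be flat, so \<open>jump_time\<close> need not invert it.
  Where the rate is positive, \<open>cumrate\<close> exceeds its value at \<open>s\<close>
  immediately after \<open>s\<close>, which forces the infimum to be \<open>s\<close>.\<close>

lemma jump_time_cumrate:
  assumes x: "x \<in> M" and s: "0 \<le> s" and pos: "0 < lam (\<phi> s x)"
  shows "jump_time x (cumrate s x) = ereal s"
proof (rule antisym)
  show "ereal s \<le> jump_time x (cumrate s x)"
    using jump_time_less_iff[OF x, of "cumrate s x" s] by (simp add: not_less[symmetric])
  obtain g where g: "\<And>u. -1 < u \<Longrightarrow> u < s + 1 \<Longrightarrow> (g has_real_derivative lam (flow_ext u x)) (at u)"
    "\<And>s. 0 \<le> s \<Longrightarrow> g s = cumrate s x" by (fact cumrate_antiderivative[OF x])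
  have "(g has_real_derivative lam (\<phi> s x)) (at s)" using g(1)[of s] s by (simp add: flow_ext_def max_def)
  from DERIV_pos_inc_right[OF this pos] obtain d where d: "d > 0" "\<And>h. 0 < h \<Longrightarrow> h < d \<Longrightarrow> g s < g (s + h)" by blast
  show "jump_time x (cumrate s x) \<le> ereal s"
  proof (rule ereal_le_epsilon2)
    fix \<epsilon> :: real assume "0 < \<epsilon>"
    define h where "h = min (d / 2) \<epsilon>"
    have h: "0 < h" "h < d" "h \<le> \<epsilon>" using \<open>0 < \<epsilon>\<close> d(1) by (auto simp: h_def)
    have "cumrate s x < cumrate (s + h) x" using d(2)[OF h(1,2)] g(2) s h(1) by simp
    then have "jump_time x (cumrate s x) < ereal (s + h)" using jump_time_less_iff[OF x] s h(1) by simp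
    also have "\<dots> \<le> ereal s + ereal \<epsilon>" using h(3) by simp
    finally show "jump_time x (cumrate s x) \<le> ereal s + ereal \<epsilon>" by simp
  qed
qed

lemma measurable_flow_ext:
  "(\<lambda>p. flow_ext (fst p) (snd p)) \<in> borel \<Otimes>\<^sub>M borel_of M \<rightarrow>\<^sub>M borel_of M"
proof -
  have 1: "(\<lambda>(t, x). \<phi> t x) \<in> borel_of {0..} \<Otimes>\<^sub>M borel_of M \<rightarrow>\<^sub>M borel_of M"
    using characteristics by (simp add: homogeneous_characteristics_def homogeneous_flow_def)
  have "(\<lambda>p. (max 0 (fst p), snd p)) \<in> borel \<Otimes>\<^sub>M borel_of M \<rightarrow>\<^sub>M borel_of {0::real..} \<Otimes>\<^sub>M borel_of M"
    by (intro measurable_Pair measurable_restrict_space2 borel_measurable_max measurable_const measurable_fst measurable_snd) auto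
  from measurable_compose[OF this 1] show ?thesis by (simp add: flow_ext_def)
qed

text \<open>By \<open>jump_time_less_iff\<close> the strict sublevel sets at real levels
  \<open>a\<close> are given by \<open>e < cumrate a x\<close>, with \<open>cumrate a\<close>
  continuous.\<close>

lemma measurable_jump_time:
  "(\<lambda>p. jump_time (fst p) (snd p)) \<in> borel_measurable (borel_of M \<Otimes>\<^sub>M borel)"
proof (rule borel_measurableI_less)
  fix y :: ereal
  let ?N = "borel_of M \<Otimes>\<^sub>M (borel :: real measure)"
  have sp: "p \<in> space ?N \<Longrightarrow> fst p \<in> M" for p by (auto simp: space_pair_measure space_restrict_space)
  have *: "{p \<in> space ?N. jump_time (fst p) (snd p) < ereal a} \<in> sets ?N" for a
  proof (cases "0 < a")
    case True
    have "cumrate a \<in> borel_measurable (borel_of M)"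
      using True by (intro measurable_continuous C1_on_continuous C1_family_imp_C1_on[OF C1_family_cumrate]) auto
    then have [measurable]: "(\<lambda>p. cumrate a (fst p)) \<in> borel_measurable ?N"
      by (rule measurable_compose[OF measurable_fst])
    have "{p \<in> space ?N. jump_time (fst p) (snd p) < ereal a} = {p \<in> space ?N. snd p < cumrate a (fst p)}"
      using jump_time_less_iff[OF sp] True by auto
    also have "\<dots> \<in> sets ?N" by measurable
    finally show ?thesis .
  next
    case False
    then have e: "{p \<in> space ?N. jump_time (fst p) (snd p) < ereal a} = {}"
      using jump_time_less_iff[OF sp] by auto
    show ?thesis unfolding e by simp
  qed
  show "{p \<in> space ?N. jump_time (fst p) (snd p) < y} \<in> sets ?N"
  proof (cases y)
    case PInf
    have eq: "{p \<in> space ?N. jump_time (fst p) (snd p) < y} = (\<Union>n::nat. {p \<in> space ?N. jump_time (fst p) (snd p) < ereal n})"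
      unfolding PInf
    proof (intro set_eqI iffI)
      fix p assume "p \<in> {p \<in> space ?N. jump_time (fst p) (snd p) < \<infinity>}"
      then have p: "p \<in> space ?N" "jump_time (fst p) (snd p) \<noteq> \<infinity>" by auto
      obtain n :: nat where "jump_time (fst p) (snd p) < ereal n"
        using less_PInf_Ex_of_nat p(2) by (metis less_ereal.simps(4) ereal_infty_less(1))
      then show "p \<in> (\<Union>n::nat. {p \<in> space ?N. jump_time (fst p) (snd p) < ereal n})" using p(1) by blast
    next
      fix p assume "p \<in> (\<Union>n::nat. {p \<in> space ?N. jump_time (fst p) (snd p) < ereal n})"
      then show "p \<in> {p \<in> space ?N. jump_time (fst p) (snd p) < \<infinity>}"
        by (auto simp: less_ereal.simps)
    qed
    have "(\<Union>n::nat. {p \<in> space ?N. jump_time (fst p) (snd p) < ereal n}) \<in> sets ?N"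
      by (rule sets.countable_nat_UN) (use * in blast)
    then show ?thesis by (simp only: eq)
  next
    case MInf
    then show ?thesis by simp
  qed (use * in simp)
qed

abbreviation exp_law :: "real measure" where
  "exp_law \<equiv> density lborel (exponential_density 1)"

lemma sets_exp_law: "sets exp_law = sets borel" by simp

lemma prob_exp_law: "prob_space exp_law" by (rule prob_space_exponential_density) simp

text \<open>The density vanishes on negative numbers and single points are null; \<open>c\<close>
  will be the level \<open>cumrate t x\<close>.\<close>

lemma AE_exp_law:
  assumes "\<And>e. 0 \<le> e \<Longrightarrow> e \<noteq> c \<Longrightarrow> P e"
  shows "AE e in exp_law. P e"
proof -
  have "AE e in lborel. e \<noteq> c" by (rule AE_lborel_singleton)
  then show ?thesis
    by (subst AE_density) (auto simp: exponential_density_def assms elim!: eventually_mono)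
qed

text \<open>At the excluded level the equivalence can fail: with a positive rate at time
  \<open>t\<close>, the jump occurs at \<open>t\<close> itself although the strict inequality is
  false.\<close>

lemma jump_time_le_iff:
  assumes x: "x \<in> M" and t: "0 \<le> t" and e: "0 \<le> e" "e \<noteq> cumrate t x"
  shows "jump_time x e \<le> ereal t \<longleftrightarrow> e < cumrate t x"
proof
  assume "e < cumrate t x"
  moreover from this have "t \<noteq> 0" using e(1) cumrate_0[of x] by auto
  ultimately have "jump_time x e < ereal t" using jump_time_less_iff[OF x] t by simp
  then show "jump_time x e \<le> ereal t" by simp
next
  assume le: "jump_time x e \<le> ereal t"
  show "e < cumrate t x"
  proof (rule ccontr)
    assume "\<not> e < cumrate t x"
    then have gt: "cumrate t x < e" using e(2) by simp
    have "continuous_on {0..} (\<lambda>t. cumrate t x)" by (rule continuous_cumrate[OF x])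
    then obtain d where d: "d > 0" "\<And>s. s \<in> {0..} \<Longrightarrow> dist s t < d \<Longrightarrow> dist (cumrate s x) (cumrate t x) < e - cumrate t x"
      unfolding continuous_on_iff using t gt by (metis atLeast_iff diff_gt_0_iff_gt)
    have "dist (cumrate (t + d / 2) x) (cumrate t x) < e - cumrate t x"
      using d(1) t by (intro d(2)) (auto simp: dist_real_def)
    then have "\<not> e < cumrate (t + d / 2) x" by (auto simp: dist_real_def)
    then have "\<not> jump_time x e < ereal (t + d / 2)" using jump_time_less_iff[OF x] by blast
    then have "ereal (t + d / 2) \<le> ereal t" using le by (metis not_less order_trans)
    then show False using d(1) by simp
  qed
qed

lemma nn_integral_jump_time_gt:
  assumes x: "x \<in> M" and t: "0 \<le> t"
  shows "(\<integral>\<^sup>+e. (if ereal t < jump_time x e then c else 0) \<partial>exp_law) = ennreal (exp (- cumrate t x)) * c"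
proof -
  interpret E: prob_space exp_law by (rule prob_exp_law)
  let ?L = "cumrate t x"
  have L: "0 \<le> ?L" by (rule cumrate_nonneg[OF t x])
  have "(\<integral>\<^sup>+e. (if ereal t < jump_time x e then c else 0) \<partial>exp_law) = (\<integral>\<^sup>+e. c * indicator (- {..?L}) e \<partial>exp_law)"
  proof (rule nn_integral_cong_AE, rule AE_exp_law)
    fix e assume e: "0 \<le> e" "e \<noteq> ?L"
    show "(if ereal t < jump_time x e then c else 0) = c * indicator (- {..?L}) e"
      using jump_time_le_iff[OF x t e] e(2) by (auto simp: not_le[symmetric] split: split_indicator)
  qed
  also have "\<dots> = c * emeasure exp_law (- {..?L})" by (rule nn_integral_cmult_indicator) simp
  also have "emeasure exp_law (- {..?L}) = ennreal (exp (- ?L))"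
  proof -
    have "emeasure exp_law {..?L} = ennreal (1 - exp (- ?L))"
      using L by (subst emeasure_erlang_density) (auto simp: erlang_CDF_0)
    then have "E.prob {..?L} = 1 - exp (- ?L)" using L by (simp add: measure_def)
    moreover have "E.prob (space exp_law - {..?L}) = 1 - E.prob {..?L}" by (rule E.prob_compl) simp
    ultimately show ?thesis by (simp add: E.emeasure_eq_measure Compl_eq_Diff_UNIV)
  qed
  finally show ?thesis by (simp add: mult.commute)
qed

text \<open>Substitution \<open>e = cumrate (t * s) x\<close>; the points where \<open>cumrate\<close> is not strictly increasing
  do not contribute, since the derivative vanishes there.\<close>

lemma nn_integral_jump_time:
  assumes x: "x \<in> M" and t: "0 \<le> t" and H: "H \<in> borel_measurable borel"
  shows "(\<integral>\<^sup>+e. (if jump_time x e \<le> ereal t then H (real_of_ereal (jump_time x e)) else 0) \<partial>exp_law) =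
    (\<integral>\<^sup>+s. ennreal (t * (exp (- cumrate (t * s) x) * lam (\<phi> (t * s) x))) * H (t * s) * indicator {0..1} s \<partial>lborel)"
proof -
  define F where "F e = ennreal (exp (- e)) * H (real_of_ereal (jump_time x e))" for e
  have jt: "jump_time x \<in> borel_measurable borel"
    using measurable_compose[OF _ measurable_jump_time, of "\<lambda>e. (x, e)" borel] x
    by (simp add: space_restrict_space)
  then have F[measurable]: "F \<in> borel_measurable borel"
    unfolding F_def using H by measurable
  have [measurable]: "jump_time x \<in> borel_measurable borel" by (rule jt)
  note H[measurable]
  have "(\<integral>\<^sup>+e. (if jump_time x e \<le> ereal t then H (real_of_ereal (jump_time x e)) else 0) \<partial>exp_law) =
      (\<integral>\<^sup>+e. H (real_of_ereal (jump_time x e)) * indicator {0..cumrate t x} e \<partial>exp_law)"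
  proof (rule nn_integral_cong_AE, rule AE_exp_law)
    fix e assume e: "0 \<le> e" "e \<noteq> cumrate t x"
    show "(if jump_time x e \<le> ereal t then H (real_of_ereal (jump_time x e)) else 0) =
        H (real_of_ereal (jump_time x e)) * indicator {0..cumrate t x} e"
      using jump_time_le_iff[OF x t e] e by (auto split: split_indicator)
  qed
  also have "\<dots> = (\<integral>\<^sup>+e. ennreal (exponential_density 1 e) * (H (real_of_ereal (jump_time x e)) * indicator {0..cumrate t x} e) \<partial>lborel)"
    by (rule nn_integral_density) measurable
  also have "\<dots> = (\<integral>\<^sup>+e. F e * indicator {0..cumrate t x} e \<partial>lborel)"
    by (intro nn_integral_cong) (auto simp: F_def exponential_density_def split: split_indicator)
  also have "\<dots> = (\<integral>\<^sup>+s. ennreal (t * (exp (- cumrate (t * s) x) * lam (\<phi> (t * s) x))) * H (t * s) * indicator {0..1} s \<partial>lborel)"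
  proof (cases "t = 0")
    case True
    \<comment> \<open>For \<open>t = 0\<close> the interval of levels is the single point 0, a null
      set.\<close>
    have "AE e in lborel. e \<noteq> (0::real)" by (rule AE_lborel_singleton)
    then have "AE e in lborel. F e * indicator {0..cumrate t x} e = 0"
      by (rule eventually_mono) (auto simp: True cumrate_0 split: split_indicator)
    then have "(\<integral>\<^sup>+e. F e * indicator {0..cumrate t x} e \<partial>lborel) = 0"
      by (subst nn_integral_0_iff_AE) auto
    then show ?thesis using True by simp
  next
    case False
    then have tp: "0 < t" using t by simp
    \<comment> \<open>The substitution rule asks for a two-sided derivative at both endpoints;
      \<open>g\<close> continues \<open>cumrate\<close> beyond 0 and beyond
      \<open>t\<close>.\<close>
    obtain g where g: "\<And>s. -1 < s \<Longrightarrow> s < t + 1 \<Longrightarrow> (g has_real_derivative lam (flow_ext s x)) (at s)"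
      "\<And>s. 0 \<le> s \<Longrightarrow> g s = cumrate s x" by (fact cumrate_antiderivative[OF x])
    have "(\<integral>\<^sup>+e. F e * indicator {g (t * 0)..g (t * 1)} e \<partial>lborel) =
        (\<integral>\<^sup>+s. F (g (t * s)) * ennreal (t * lam (flow_ext (t * s) x)) * indicator {0..1} s \<partial>lborel)"
    proof (rule nn_integral_substitution_aux[where g = "\<lambda>s. g (t * s)" and g' = "\<lambda>s. t * lam (flow_ext (t * s) x)" and a = 0 and b = 1])
      fix s :: real assume s: "s \<in> {0..1}"
      have "0 \<le> t * s" "t * s \<le> t" using s tp by (auto intro: mult_left_le)
      then have "-1 < t * s" "t * s < t + 1" by linarith+
      note gd = g(1)[OF this]
      have "((\<lambda>s. t * s) has_real_derivative t) (at s)" by (auto intro!: derivative_eq_intros)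
      from DERIV_chain2[OF gd this]
      show "((\<lambda>s. g (t * s)) has_real_derivative t * lam (flow_ext (t * s) x)) (at s)"
        by (simp only: mult.commute[of "lam (flow_ext (t * s) x)"])
      show "0 \<le> t * lam (flow_ext (t * s) x)" using tp lam_nonneg[OF flow_ext_in[OF x]] by simp
    next
      have "continuous_on {0..1} (\<lambda>s. lam (flow_ext (t * s) x))"
        by (rule continuous_on_compose2[OF continuous_rate[OF x, of UNIV]]) (auto intro!: continuous_intros)
      then show "continuous_on {0..1} (\<lambda>s. t * lam (flow_ext (t * s) x))" by (intro continuous_intros)
    qed (use F in auto)
    also have "\<dots> = (\<integral>\<^sup>+s. ennreal (t * (exp (- cumrate (t * s) x) * lam (\<phi> (t * s) x))) * H (t * s) * indicator {0..1} s \<partial>lborel)"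
    proof (rule nn_integral_cong)
      fix s :: real
      show "F (g (t * s)) * ennreal (t * lam (flow_ext (t * s) x)) * indicator {0..1} s =
        ennreal (t * (exp (- cumrate (t * s) x) * lam (\<phi> (t * s) x))) * H (t * s) * indicator {0..1} s"
      proof (cases "s \<in> {0..1}")
        case True
        then have ts: "0 \<le> t * s" using tp by simp
        have fl: "flow_ext (t * s) x = \<phi> (t * s) x" using ts by (simp add: flow_ext_def max_def)
        have l0: "0 \<le> lam (\<phi> (t * s) x)" by (intro lam_nonneg flow_in ts x)
        show ?thesis
        proof (cases "lam (\<phi> (t * s) x) = 0")
          case True
          then show ?thesis by (simp add: fl)
        next
          case False
          then have j: "jump_time x (cumrate (t * s) x) = ereal (t * s)"
            using l0 by (intro jump_time_cumrate[OF x ts]) simp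
          show ?thesis
            unfolding F_def g(2)[OF ts] fl j real_of_ereal.simps
            using tp l0 by (simp add: ennreal_mult mult_ac)
        qed
      qed simp
    qed
    finally show ?thesis using t by (simp add: g(2) cumrate_0)
  qed
  finally show ?thesis .
qed


subsection \<open>Decomposition according to the number of jumps\<close>

abbreviation mark_law :: "(real \<times> real) measure" where
  "mark_law \<equiv> exp_law \<Otimes>\<^sub>M uniform01"

lemma prob_uniform01: "prob_space uniform01"
  by (rule prob_spaceI) (simp add: space_restrict_space emeasure_restrict_space)

lemma sets_uniform01: "sets uniform01 = sets (borel_of {0..1})"
  by (rule sets_restrict_space_cong) simp

lemma prob_mark_law: "prob_space mark_law"
proof -
  interpret E: prob_space exp_law by (rule prob_exp_law)
  interpret U: prob_space uniform01 by (rule prob_uniform01)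
  interpret pair_prob_space exp_law uniform01 ..
  show ?thesis by (rule prob_space_axioms)
qed

text \<open>Gives access to the splitting of an i.i.d. sequence into its first member and the
  shifted rest.\<close>

sublocale marks: sequence_space mark_law
  by (intro sequence_space.intro product_prob_space.intro product_sigma_finite.intro
      product_prob_space_axioms.intro prob_space_imp_sigma_finite prob_mark_law)

lemma noise_eq: "noise = marks.S"
  by (simp add: noise_def)

lemma prob_noise: "prob_space noise"
  unfolding noise_eq by (rule marks.P.prob_space_axioms)

lemma space_noise: "\<omega> \<in> space noise \<longleftrightarrow> (\<forall>k. snd (\<omega> k) \<in> {0..1})"
  by (auto simp: noise_def space_PiM space_pair_measure space_restrict_space PiE_iff mem_Times_iff)

lemma noise_mark: "\<omega> \<in> space noise \<Longrightarrow> snd (\<omega> k) \<in> {0..1}"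
  using space_noise by blast

lemma noise_shift: "\<omega> \<in> space noise \<Longrightarrow> (\<lambda>k. \<omega> (Suc k)) \<in> space noise"
  unfolding space_noise by blast

text \<open>The contribution of exactly \<open>n\<close> jumps up to time \<open>t\<close>. The
  recursion is on the first jump with shifted marks, as in \<open>jump_term\<close>, while
  \<open>jump_chain\<close> recurses on the last one. Values in \<open>ennreal\<close> make sums and
  integrals unconditional.\<close>

primrec obs_term :: "nat \<Rightarrow> ('a \<Rightarrow> ennreal) \<Rightarrow> real \<Rightarrow> 'a \<Rightarrow> (nat \<Rightarrow> real \<times> real) \<Rightarrow> ennreal" where
  "obs_term 0 f t x \<omega> = (if 0 \<le> t \<and> ereal t < jump_time x (fst (\<omega> 0)) then f (flow_ext t x) else 0)"
| "obs_term (Suc n) f t x \<omega> = (if jump_time x (fst (\<omega> 0)) \<le> ereal t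
     then obs_term n f (t - real_of_ereal (jump_time x (fst (\<omega> 0))))
       (G (flow_ext (real_of_ereal (jump_time x (fst (\<omega> 0)))) x, snd (\<omega> 0))) (\<lambda>k. \<omega> (Suc k))
     else 0)"

lemma G_in: "x \<in> M \<Longrightarrow> u \<in> {0..1} \<Longrightarrow> G (x, u) \<in> M"
  using representation measurable_space[of G "borel_of M \<Otimes>\<^sub>M borel_of {0..1}" "borel_of M" "(x, u)"]
  by (auto simp: represents_kernel_def space_pair_measure space_restrict_space)

lemma jump_chain_in:
  assumes "x \<in> M" "\<omega> \<in> space noise"
  shows "snd (chain x \<omega> k) \<in> M \<and> 0 \<le> fst (chain x \<omega> k)"
proof (induction k)
  case 0
  then show ?case using assms(1) by simp
next
  case (Suc k)
  obtain S y where Sy: "chain x \<omega> k = (S, y)" by (cases "chain x \<omega> k")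
  have y: "y \<in> M" "0 \<le> S" using Suc Sy by auto
  show ?case
  proof (cases "S = \<infinity>")
    case True
    then show ?thesis using Sy y by simp
  next
    case False
    then obtain s where s: "S = ereal s" "0 \<le> s" using y(2) by (cases S) auto
    let ?S' = "next_jump \<phi> lam s y (fst (\<omega> k))"
    have S': "?S' = ereal s + jump_time y (fst (\<omega> k))" by (rule next_jump_shift[OF y(1)])
    show ?thesis
    proof (cases "?S' = \<infinity>")
      case True
      then show ?thesis using Sy s y by (simp add: Let_def)
    next
      case False
      then obtain d where d: "jump_time y (fst (\<omega> k)) = ereal d" "0 \<le> d"
        using S' jump_time_nonneg[of y "fst (\<omega> k)"] by (cases "jump_time y (fst (\<omega> k))") auto
      then have eq: "chain x \<omega> (Suc k) = (ereal (s + d), G (\<phi> d y, snd (\<omega> k)))"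
        using Sy s S' by (simp add: Let_def)
      show ?thesis unfolding eq fst_conv snd_conv
        using s(2) d(2) by (intro conjI G_in flow_in y(1) noise_mark[OF assms(2)]) auto
    qed
  qed
qed

text \<open>With waiting times the next jump is at \<open>S + jump_time\<close>, and the two tests
  for infinity in \<open>jump_chain\<close> become one.\<close>

lemma jump_chain_step:
  assumes "x \<in> M" "\<omega> \<in> space noise" "chain x \<omega> k = (S, y)"
  shows "chain x \<omega> (Suc k) =
    (if S + jump_time y (fst (\<omega> k)) = \<infinity> then (\<infinity>, y)
     else (S + jump_time y (fst (\<omega> k)), G (\<phi> (real_of_ereal (jump_time y (fst (\<omega> k)))) y, snd (\<omega> k))))"
proof -
  have y: "y \<in> M" "0 \<le> S" using jump_chain_in[OF assms(1,2), of k] assms(3) by auto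
  show ?thesis
  proof (cases "S = \<infinity>")
    case True
    then show ?thesis using assms(3) jump_time_nonneg[of y "fst (\<omega> k)"] by simp
  next
    case False
    then obtain s where s: "S = ereal s" "0 \<le> s" using y(2) by (cases S) auto
    have S': "next_jump \<phi> lam s y (fst (\<omega> k)) = ereal s + jump_time y (fst (\<omega> k))" by (rule next_jump_shift[OF y(1)])
    show ?thesis
      using assms(3) s S' jump_time_nonneg[of y "fst (\<omega> k)"]
      by (cases "jump_time y (fst (\<omega> k))") (simp_all add: Let_def)
  qed
qed

text \<open>The waiting time and the new position depend on the current position and mark only, so
  the chain restarts at its first jump. This converts recursion at the last jump into recursion at
  the first.\<close>

lemma jump_chain_shift:
  assumes x: "x \<in> M" and \<omega>: "\<omega> \<in> space noise" and d: "jump_time x (fst (\<omega> 0)) = ereal d"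
  defines "x1 \<equiv> G (\<phi> d x, snd (\<omega> 0))" and "\<omega>1 \<equiv> \<lambda>k. \<omega> (Suc k)"
  shows "chain x \<omega> (Suc k) =
    (ereal d + fst (chain x1 \<omega>1 k), snd (chain x1 \<omega>1 k))"
proof (induction k)
  case 0
  show ?case using jump_chain_step[OF x \<omega>, of 0 0 x] d by (simp add: x1_def zero_ereal_def)
next
  case (Suc k)
  have d0: "0 \<le> d" using jump_time_nonneg[of x "fst (\<omega> 0)"] d by simp
  have x1: "x1 \<in> M" unfolding x1_def by (intro G_in flow_in d0 x noise_mark[OF \<omega>])
  have \<omega>1: "\<omega>1 \<in> space noise" unfolding \<omega>1_def by (rule noise_shift[OF \<omega>])
  obtain S y where Sy: "chain x1 \<omega>1 k = (S, y)" by (cases "chain x1 \<omega>1 k")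
  have S0: "0 \<le> S" using jump_chain_in[OF x1 \<omega>1, of k] Sy by simp
  have "chain x \<omega> (Suc k) = (ereal d + S, y)" using Suc Sy by simp
  from jump_chain_step[OF x \<omega> this] jump_chain_step[OF x1 \<omega>1 Sy]
  show ?case using S0 jump_time_nonneg[of y "fst (\<omega> (Suc k))"]
    by (cases S; cases "jump_time y (fst (\<omega> (Suc k)))") (simp_all add: \<omega>1_def add.assoc)
qed

lemma jump_chain_infinite:
  assumes x: "x \<in> M" and \<omega>: "\<omega> \<in> space noise" and d: "jump_time x (fst (\<omega> 0)) = \<infinity>"
  shows "fst (chain x \<omega> (Suc k)) = \<infinity>"
proof (induction k)
  case 0
  show ?case using jump_chain_step[OF x \<omega>, of 0 0 x] d by simp
next
  case (Suc k)
  obtain y where "chain x \<omega> (Suc k) = (\<infinity>, y)"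
    using Suc by (cases "chain x \<omega> (Suc k)") auto
  then show ?case by (simp only: jump_chain.simps(2)[of _ _ _ _ _ "Suc k"] Let_def case_prod_conv) simp
qed

text \<open>Reconciles the two recursions: a first jump at \<open>d\<close> delays all later jump
  times by \<open>d\<close> and leaves \<open>n\<close> jumps for the time
  \<open>t - d\<close>.\<close>

lemma obs_term_eq:
  assumes "x \<in> M" "\<omega> \<in> space noise" "0 \<le> t"
  shows "obs_term n f t x \<omega> =
    (if fst (chain x \<omega> n) \<le> ereal t \<and> ereal t < fst (chain x \<omega> (Suc n))
     then f (\<phi> (t - real_of_ereal (fst (chain x \<omega> n))) (snd (chain x \<omega> n))) else 0)"
  using assms
proof (induction n arbitrary: t x \<omega>)
  case 0
  have "fst (chain x \<omega> (Suc 0)) = jump_time x (fst (\<omega> 0))"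
    using jump_chain_step[OF 0(1,2), of 0 0 x] by simp
  then show ?case using 0(3) by (simp add: flow_ext_def max_def zero_ereal_def)
next
  case (Suc n)
  let ?\<tau> = "jump_time x (fst (\<omega> 0))"
  show ?case
  proof (cases ?\<tau>)
    case PInf
    then show ?thesis using jump_chain_infinite[OF Suc.prems(1,2) PInf] by simp
  next
    case MInf
    then show ?thesis using jump_time_nonneg[of x "fst (\<omega> 0)"] by simp
  next
    case (real d)
    have d0: "0 \<le> d" using jump_time_nonneg[of x "fst (\<omega> 0)"] real by simp
    define x1 where "x1 = G (\<phi> d x, snd (\<omega> 0))"
    define \<omega>1 where "\<omega>1 = (\<lambda>k. \<omega> (Suc k))"
    have x1: "x1 \<in> M" unfolding x1_def by (intro G_in flow_in d0 Suc.prems noise_mark[OF Suc.prems(2)])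
    have \<omega>1: "\<omega>1 \<in> space noise" unfolding \<omega>1_def by (rule noise_shift[OF Suc.prems(2)])
    note sh = jump_chain_shift[OF Suc.prems(1,2) real, folded x1_def \<omega>1_def]
    let ?S = "fst (chain x1 \<omega>1 n)" and ?S' = "fst (chain x1 \<omega>1 (Suc n))"
    have S0: "0 \<le> ?S" using jump_chain_in[OF x1 \<omega>1] by blast
    have S0': "0 \<le> ?S'" using jump_chain_in[OF x1 \<omega>1] by blast
    have le: "ereal d + ?S \<le> ereal t \<longleftrightarrow> ?S \<le> ereal (t - d)" by (cases ?S) auto
    have lt: "ereal t < ereal d + ?S' \<longleftrightarrow> ereal (t - d) < ?S'" by (cases ?S') auto
    have fl: "flow_ext d x = \<phi> d x" using d0 by (simp add: flow_ext_def max_def)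
    show ?thesis
    proof (cases "d \<le> t")
      case True
      then have td: "0 \<le> t - d" by simp
      have "obs_term (Suc n) f t x \<omega> = obs_term n f (t - d) x1 \<omega>1"
        using True by (simp add: real fl x1_def \<omega>1_def)
      also have "\<dots> = (if ?S \<le> ereal (t - d) \<and> ereal (t - d) < ?S'
          then f (\<phi> (t - d - real_of_ereal ?S) (snd (chain x1 \<omega>1 n))) else 0)"
        by (rule Suc.IH[OF x1 \<omega>1 td])
      also have "\<dots> = (if fst (chain x \<omega> (Suc n)) \<le> ereal t \<and> ereal t < fst (chain x \<omega> (Suc (Suc n)))
        then f (\<phi> (t - real_of_ereal (fst (chain x \<omega> (Suc n)))) (snd (chain x \<omega> (Suc n)))) else 0)"
        unfolding sh fst_conv snd_conv le lt
        using S0 by (cases ?S) (auto simp: algebra_simps)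
      finally show ?thesis .
    next
      case False
      then have "\<not> ereal d + ?S \<le> ereal t" using S0 by (cases ?S) auto
      then show ?thesis using False unfolding sh fst_conv snd_conv by (simp add: real)
    qed
  qed
qed

lemma jump_chain_mono:
  assumes "x \<in> M" "\<omega> \<in> space noise"
  shows "mono (\<lambda>k. fst (chain x \<omega> k))"
proof (rule incseq_SucI)
  fix k
  obtain S y where Sy: "chain x \<omega> k = (S, y)" by (cases "chain x \<omega> k")
  have "fst (chain x \<omega> (Suc k)) = S + jump_time y (fst (\<omega> k))"
    using jump_chain_step[OF assms Sy] by simp
  then show "fst (chain x \<omega> k) \<le> fst (chain x \<omega> (Suc k))"
    using Sy jump_time_nonneg[of y "fst (\<omega> k)"] by (simp add: ereal_le_add_self)
qed

text \<open>Jump times are nondecreasing, so at most one index has \<open>t\<close> between its jump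
  time and the next. If there is none, the path is in the cemetery and both sides are 0.\<close>

lemma suminf_obs_term:
  assumes x: "x \<in> M" and \<omega>: "\<omega> \<in> space noise" and t: "0 \<le> t"
  shows "(\<Sum>n. obs_term n f t x \<omega>) = case_option 0 f (proc x \<omega> t)"
proof -
  define S where "S k = fst (chain x \<omega> k)" for k
  define act where "act k \<longleftrightarrow> S k \<le> ereal t \<and> ereal t < S (Suc k)" for k
  have mono: "mono S" unfolding S_def by (rule jump_chain_mono[OF x \<omega>])
  have uniq: "j = k" if "act j" "act k" for j k
  proof (rule ccontr)
    assume "j \<noteq> k"
    then have "Suc j \<le> k \<or> Suc k \<le> j" by auto
    then show False
    proof
      assume "Suc j \<le> k"
      then have "S (Suc j) \<le> S k" by (rule monoD[OF mono])
      then show False using that by (auto simp: act_def)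
    next
      assume "Suc k \<le> j"
      then have "S (Suc k) \<le> S j" by (rule monoD[OF mono])
      then show False using that by (auto simp: act_def)
    qed
  qed
  have obs_n: "obs_term n f t x \<omega> = (if act n then f (\<phi> (t - real_of_ereal (S n)) (snd (chain x \<omega> n))) else 0)" for n
    unfolding obs_term_eq[OF x \<omega> t] by (simp add: act_def S_def)
  show ?thesis
  proof (cases "\<exists>k. act k")
    case True
    then obtain k where k: "act k" by blast
    have L: "(LEAST k. act k) = k" using k uniq by (metis LeastI)
    have "(\<Sum>n. obs_term n f t x \<omega>) = (\<Sum>n\<in>{k}. obs_term n f t x \<omega>)"
      by (rule suminf_finite) (use uniq k in \<open>auto simp: obs_n\<close>)
    moreover have "proc x \<omega> t = Some (\<phi> (t - real_of_ereal (S k)) (snd (chain x \<omega> k)))"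
      unfolding pdmp_def Let_def S_def[symmetric] act_def[symmetric] using True L by simp
    ultimately show ?thesis using k by (simp add: obs_n)
  next
    case False
    then have "proc x \<omega> t = None"
      unfolding pdmp_def Let_def S_def[symmetric] act_def[symmetric] by simp
    then show ?thesis using False by (simp add: obs_n)
  qed
qed

lemma measurable_shift: "(\<lambda>\<omega> k. \<omega> (Suc k)) \<in> noise \<rightarrow>\<^sub>M noise"
  unfolding noise_def
  by (rule measurable_PiM_single') (auto simp: space_PiM)

lemma measurable_mark: "(\<lambda>\<omega>. \<omega> k) \<in> noise \<rightarrow>\<^sub>M mark_law"
  unfolding noise_def by (rule measurable_component_singleton) simp

lemma measurable_mark1: "(\<lambda>\<omega>. fst (\<omega> k)) \<in> borel_measurable noise"
  using measurable_compose[OF measurable_mark measurable_fst] measurable_cong_sets[OF refl sets_exp_law] by blast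

lemma measurable_mark2: "(\<lambda>\<omega>. snd (\<omega> k)) \<in> noise \<rightarrow>\<^sub>M borel_of {0..1}"
  using measurable_compose[OF measurable_mark measurable_snd] measurable_cong_sets[OF refl sets_uniform01] by blast

text \<open>Joint in time, position and marks, because the recursive call changes all three.\<close>

lemma measurable_obs_term:
  assumes f: "f \<in> borel_measurable (borel_of M)"
  shows "(\<lambda>p. obs_term n f (fst p) (fst (snd p)) (snd (snd p))) \<in> borel_measurable (borel \<Otimes>\<^sub>M (borel_of M \<Otimes>\<^sub>M noise))"
proof (induction n)
  let ?N = "(borel :: real measure) \<Otimes>\<^sub>M (borel_of M \<Otimes>\<^sub>M noise)"
  have [measurable]: "(\<lambda>p. fst p) \<in> ?N \<rightarrow>\<^sub>M borel" by (rule measurable_fst)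
  have mx: "(\<lambda>p. fst (snd p)) \<in> ?N \<rightarrow>\<^sub>M borel_of M"
    by (rule measurable_compose[OF measurable_snd measurable_fst])
  have m\<omega>: "(\<lambda>p. snd (snd p)) \<in> ?N \<rightarrow>\<^sub>M noise"
    by (rule measurable_compose[OF measurable_snd measurable_snd])
  have mj[measurable]: "(\<lambda>p. jump_time (fst (snd p)) (fst (snd (snd p) 0))) \<in> borel_measurable ?N"
    using measurable_compose[OF measurable_Pair[OF mx measurable_compose[OF m\<omega> measurable_mark1[of 0]]] measurable_jump_time]
    by simp
  {
    case 0
    have [measurable]: "(\<lambda>p. f (flow_ext (fst p) (fst (snd p)))) \<in> borel_measurable ?N"
      using measurable_compose[OF measurable_compose[OF measurable_Pair[OF measurable_fst mx] measurable_flow_ext] f] by simp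
    show ?case unfolding obs_term.simps by measurable
  next
    case (Suc n)
    let ?s = "\<lambda>p. real_of_ereal (jump_time (fst (snd p)) (fst (snd (snd p) 0)))"
    have ms[measurable]: "?s \<in> borel_measurable ?N" by measurable
    have mf: "(\<lambda>p. flow_ext (?s p) (fst (snd p))) \<in> ?N \<rightarrow>\<^sub>M borel_of M"
      using measurable_compose[OF measurable_Pair[OF ms mx] measurable_flow_ext] by simp
    have G: "G \<in> borel_of M \<Otimes>\<^sub>M borel_of {0..1} \<rightarrow>\<^sub>M borel_of M"
      using representation by (simp add: represents_kernel_def)
    have mG: "(\<lambda>p. G (flow_ext (?s p) (fst (snd p)), snd (snd (snd p) 0))) \<in> ?N \<rightarrow>\<^sub>M borel_of M"
      by (rule measurable_compose[OF measurable_Pair[OF mf measurable_compose[OF m\<omega> measurable_mark2]] G])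
    have mt: "(\<lambda>p. fst p - ?s p) \<in> borel_measurable ?N" by measurable
    have [measurable]: "(\<lambda>p. obs_term n f (fst p - ?s p) (G (flow_ext (?s p) (fst (snd p)), snd (snd (snd p) 0)))
        (\<lambda>k. snd (snd p) (Suc k))) \<in> borel_measurable ?N"
      using measurable_compose[OF measurable_Pair[OF mt measurable_Pair[OF mG measurable_compose[OF m\<omega> measurable_shift]]] Suc]
      by simp
    show ?case unfolding obs_term.simps by measurable
  }
qed

section \<open>Expectations of the individual terms\<close>

definition obs_mean :: "nat \<Rightarrow> ('a \<Rightarrow> ennreal) \<Rightarrow> real \<Rightarrow> 'a \<Rightarrow> ennreal" where
  "obs_mean n f t x = (\<integral>\<^sup>+\<omega>. obs_term n f t x \<omega> \<partial>noise)"

lemma measurable_obs_term_noise: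
  assumes "f \<in> borel_measurable (borel_of M)" "x \<in> M"
  shows "obs_term n f t x \<in> borel_measurable noise"
  using measurable_compose[OF _ measurable_obs_term[OF assms(1)], of "\<lambda>\<omega>. (t, x, \<omega>)" noise n] assms(2)
  by (simp add: space_restrict_space)

lemma measurable_obs_mean:
  assumes "f \<in> borel_measurable (borel_of M)"
  shows "(\<lambda>p. obs_mean n f (fst p) (snd p)) \<in> borel_measurable (borel \<Otimes>\<^sub>M borel_of M)"
proof -
  interpret N: prob_space noise by (rule prob_noise)
  have "(\<lambda>q. (fst (fst q), snd (fst q), snd q)) \<in> (borel \<Otimes>\<^sub>M borel_of M) \<Otimes>\<^sub>M noise \<rightarrow>\<^sub>M (borel :: real measure) \<Otimes>\<^sub>M (borel_of M \<Otimes>\<^sub>M noise)"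
    by measurable
  from measurable_compose[OF this measurable_obs_term[OF assms, of n]]
  have "(\<lambda>(p, \<omega>). obs_term n f (fst p) (snd p) \<omega>) \<in> borel_measurable ((borel \<Otimes>\<^sub>M borel_of M) \<Otimes>\<^sub>M noise)"
    by (simp add: case_prod_unfold)
  from N.borel_measurable_nn_integral[OF this] show ?thesis by (simp add: obs_mean_def)
qed

lemma Q_distr:
  assumes "x \<in> M"
  shows "Q x = distr uniform01 (borel_of M) (\<lambda>u. G (x, u))"
proof (rule measure_eqI)
  have G: "G \<in> borel_of M \<Otimes>\<^sub>M borel_of {0..1} \<rightarrow>\<^sub>M borel_of M"
    using representation by (simp add: represents_kernel_def)
  have "(\<lambda>u. (x, u)) \<in> borel_of {0..1} \<rightarrow>\<^sub>M borel_of M \<Otimes>\<^sub>M borel_of {0..1}"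
    using assms by (intro measurable_Pair measurable_const measurable_ident_sets) (auto simp: space_restrict_space)
  from measurable_compose[OF this G] have m: "(\<lambda>u. G (x, u)) \<in> uniform01 \<rightarrow>\<^sub>M borel_of M"
    using measurable_cong_sets[OF sets_uniform01 refl] by blast
  show "sets (Q x) = sets (distr uniform01 (borel_of M) (\<lambda>u. G (x, u)))" by (simp add: sets_Q[OF assms])
  fix A assume "A \<in> sets (Q x)"
  then have A: "A \<in> sets (borel_of M)" using sets_Q[OF assms] by simp
  have "emeasure (Q x) A = emeasure uniform01 {u \<in> {0..1}. G (x, u) \<in> A}"
    using representation assms A by (simp add: represents_kernel_def)
  also have "\<dots> = emeasure (distr uniform01 (borel_of M) (\<lambda>u. G (x, u))) A"
    using emeasure_distr[OF m A]
    by (simp add: vimage_def Int_def space_restrict_space conj_commute)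
  finally show "emeasure (Q x) A = emeasure (distr uniform01 (borel_of M) (\<lambda>u. G (x, u))) A" .
qed

lemma nn_integral_mark:
  assumes "x \<in> M" "f \<in> borel_measurable (borel_of M)"
  shows "(\<integral>\<^sup>+u. f (G (x, u)) \<partial>uniform01) = (\<integral>\<^sup>+y. f y \<partial>Q x)"
proof -
  have G: "G \<in> borel_of M \<Otimes>\<^sub>M borel_of {0..1} \<rightarrow>\<^sub>M borel_of M"
    using representation by (simp add: represents_kernel_def)
  have "(\<lambda>u. (x, u)) \<in> borel_of {0..1} \<rightarrow>\<^sub>M borel_of M \<Otimes>\<^sub>M borel_of {0..1}"
    using assms by (intro measurable_Pair measurable_const measurable_ident_sets) (auto simp: space_restrict_space)
  from measurable_compose[OF this G] have m: "(\<lambda>u. G (x, u)) \<in> uniform01 \<rightarrow>\<^sub>M borel_of M"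
    using measurable_cong_sets[OF sets_uniform01 refl] by blast
  show ?thesis unfolding Q_distr[OF assms(1)] by (rule nn_integral_distr[OF m, symmetric]) (simp add: assms(2))
qed

text \<open>The first mark is independent of the shifted sequence, which again has the law
  \<open>noise\<close>.\<close>

lemma nn_integral_noise_split:
  assumes "F \<in> borel_measurable noise"
  shows "(\<integral>\<^sup>+\<omega>. F \<omega> \<partial>noise) = (\<integral>\<^sup>+e. \<integral>\<^sup>+u. \<integral>\<^sup>+\<omega>. F (case_nat (e, u) \<omega>) \<partial>noise \<partial>uniform01 \<partial>exp_law)"
proof -
  interpret N: prob_space noise by (rule prob_noise)
  interpret U: prob_space uniform01 by (rule prob_uniform01)
  have m: "(\<lambda>(s, \<omega>). case_nat s \<omega>) \<in> mark_law \<Otimes>\<^sub>M noise \<rightarrow>\<^sub>M noise"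
    unfolding noise_def by measurable
  have mF: "(\<lambda>p. F (case_nat (fst p) (snd p))) \<in> borel_measurable (mark_law \<Otimes>\<^sub>M noise)"
    using measurable_compose[OF m assms] by (simp add: case_prod_unfold)
  have "(\<integral>\<^sup>+\<omega>. F \<omega> \<partial>noise) = (\<integral>\<^sup>+\<omega>. F \<omega> \<partial>distr (mark_law \<Otimes>\<^sub>M noise) noise (\<lambda>(s, \<omega>). case_nat s \<omega>))"
    using marks.PiM_iter by (simp add: noise_eq)
  also have "\<dots> = (\<integral>\<^sup>+p. F (case_nat (fst p) (snd p)) \<partial>(mark_law \<Otimes>\<^sub>M noise))"
    by (subst nn_integral_distr[OF m]) (use assms in \<open>simp_all add: case_prod_unfold\<close>)
  also have "\<dots> = (\<integral>\<^sup>+s. \<integral>\<^sup>+\<omega>. F (case_nat s \<omega>) \<partial>noise \<partial>mark_law)"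
    using N.nn_integral_fst[OF mF] by simp
  also have "\<dots> = (\<integral>\<^sup>+e. \<integral>\<^sup>+u. \<integral>\<^sup>+\<omega>. F (case_nat (e, u) \<omega>) \<partial>noise \<partial>uniform01 \<partial>exp_law)"
  proof -
    have "(\<lambda>(s, \<omega>). F (case_nat s \<omega>)) \<in> borel_measurable (mark_law \<Otimes>\<^sub>M noise)"
      using mF by (simp add: case_prod_unfold)
    from U.nn_integral_fst[OF N.borel_measurable_nn_integral[OF this]] show ?thesis by simp
  qed
  finally show ?thesis .
qed

lemma obs_mean_0:
  assumes f: "f \<in> borel_measurable (borel_of M)" and x: "x \<in> M" and t: "0 \<le> t"
  shows "obs_mean 0 f t x = ennreal (exp (- cumrate t x)) * f (\<phi> t x)"
proof -
  interpret N: prob_space noise by (rule prob_noise)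
  interpret U: prob_space uniform01 by (rule prob_uniform01)
  have U1: "emeasure uniform01 {0..1} = 1" using U.emeasure_space_1 by (simp add: space_restrict_space)
  have fl: "flow_ext t x = \<phi> t x" using t by (simp add: flow_ext_def max_def)
  have "obs_mean 0 f t x = (\<integral>\<^sup>+e. (if ereal t < jump_time x e then f (flow_ext t x) else 0) \<partial>exp_law)"
    unfolding obs_mean_def nn_integral_noise_split[OF measurable_obs_term_noise[OF f x]]
    using t by (simp add: N.emeasure_space_1 U1)
  then show ?thesis using nn_integral_jump_time_gt[OF x t] by (simp add: fl)
qed

text \<open>Integrate over the first mark: \<open>e\<close> determines the jump time,
  \<open>u\<close> the new position with law \<open>Q\<close>, and the remaining marks restart the
  process, which yields \<open>obs_mean n\<close>.\<close>

lemma obs_mean_Suc: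
  assumes f: "f \<in> borel_measurable (borel_of M)" and x: "x \<in> M" and t: "0 \<le> t"
  shows "obs_mean (Suc n) f t x =
    (\<integral>\<^sup>+s. ennreal (t * (exp (- cumrate (t * s) x) * lam (\<phi> (t * s) x))) *
       (\<integral>\<^sup>+y. obs_mean n f (t * (1 - s)) y \<partial>Q (\<phi> (t * s) x)) * indicator {0..1} s \<partial>lborel)"
proof -
  interpret N: prob_space noise by (rule prob_noise)
  interpret U: prob_space uniform01 by (rule prob_uniform01)
  \<comment> \<open>The expected contribution of \<open>n\<close> further jumps when the first one
    happens at time \<open>s\<close>.\<close>
  define H where "H s = (\<integral>\<^sup>+y. obs_mean n f (t - s) y \<partial>Q (flow_ext s x))" for s
  have mm: "(\<lambda>y. obs_mean n f s y) \<in> borel_measurable (borel_of M)" for s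
    using measurable_compose[OF _ measurable_obs_mean[OF f, of n], of "\<lambda>y. (s, y)" "borel_of M"] by simp
  have Qm: "Q \<in> borel_of M \<rightarrow>\<^sub>M subprob_algebra (borel_of M)"
    using characteristics by (auto simp: homogeneous_characteristics_def markov_kernel_def intro: measurable_prob_algebraD)
  have "(\<lambda>s. flow_ext s x) \<in> borel \<rightarrow>\<^sub>M borel_of M"
    using measurable_compose[OF _ measurable_flow_ext, of "\<lambda>s. (s, x)" borel] x by (simp add: space_restrict_space)
  from measurable_compose[OF this Qm] have K: "(\<lambda>s. Q (flow_ext s x)) \<in> borel \<rightarrow>\<^sub>M subprob_algebra (borel_of M)" .
  have "(\<lambda>q. (t - fst q, snd q)) \<in> borel \<Otimes>\<^sub>M borel_of M \<rightarrow>\<^sub>M (borel :: real measure) \<Otimes>\<^sub>M borel_of M"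
    by measurable
  from measurable_compose[OF this measurable_obs_mean[OF f, of n]]
  have "(\<lambda>(s, y). obs_mean n f (t - s) y) \<in> borel_measurable (borel \<Otimes>\<^sub>M borel_of M)"
    by (simp add: case_prod_unfold)
  from nn_integral_measurable_subprob_algebra2[OF this K]
  have Hm: "H \<in> borel_measurable borel" by (simp add: H_def[abs_def])
  have "obs_mean (Suc n) f t x = (\<integral>\<^sup>+e. (if jump_time x e \<le> ereal t then H (real_of_ereal (jump_time x e)) else 0) \<partial>exp_law)"
    unfolding obs_mean_def nn_integral_noise_split[OF measurable_obs_term_noise[OF f x]]
  proof (rule nn_integral_cong)
    fix e
    let ?s = "real_of_ereal (jump_time x e)"
    show "(\<integral>\<^sup>+u. \<integral>\<^sup>+\<omega>. obs_term (Suc n) f t x (case_nat (e, u) \<omega>) \<partial>noise \<partial>uniform01) =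
      (if jump_time x e \<le> ereal t then H ?s else 0)"
    proof (cases "jump_time x e \<le> ereal t")
      case True
      then have "(\<integral>\<^sup>+u. \<integral>\<^sup>+\<omega>. obs_term (Suc n) f t x (case_nat (e, u) \<omega>) \<partial>noise \<partial>uniform01) =
        (\<integral>\<^sup>+u. obs_mean n f (t - ?s) (G (flow_ext ?s x, u)) \<partial>uniform01)" by (simp add: obs_mean_def)
      also have "\<dots> = H ?s" unfolding H_def by (rule nn_integral_mark[OF flow_ext_in[OF x] mm])
      finally show ?thesis using True by simp
    qed simp
  qed
  also have "\<dots> = (\<integral>\<^sup>+s. ennreal (t * (exp (- cumrate (t * s) x) * lam (\<phi> (t * s) x))) * H (t * s) * indicator {0..1} s \<partial>lborel)"
    by (rule nn_integral_jump_time[OF x t Hm])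
  also have "\<dots> = (\<integral>\<^sup>+s. ennreal (t * (exp (- cumrate (t * s) x) * lam (\<phi> (t * s) x))) *
       (\<integral>\<^sup>+y. obs_mean n f (t * (1 - s)) y \<partial>Q (\<phi> (t * s) x)) * indicator {0..1} s \<partial>lborel)"
    using t by (intro nn_integral_cong) (auto simp: H_def flow_ext_def max_def algebra_simps split: split_indicator)
  finally show ?thesis .
qed


lemma measurable_ennreal_continuous:
  "continuous_on M f \<Longrightarrow> (\<lambda>y. ennreal (f y)) \<in> borel_measurable (borel_of M)"
  using measurable_compose[OF measurable_continuous measurable_ennreal] .

text \<open>Both sides obey the same recursion. Nonnegativity is carried through the induction
  because each passage from \<open>ennreal\<close> integrals to real ones requires it.\<close>

lemma obs_mean_eq_jump_term:
  assumes f: "C1_on M f" "\<And>y. 0 \<le> f y" and t: "0 \<le> t" and x: "x \<in> M"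
  shows "obs_mean n (\<lambda>y. ennreal (f y)) t x = ennreal (jump_term n f t x) \<and> 0 \<le> jump_term n f t x"
  using t x
proof (induction n arbitrary: t x)
  case 0
  then show ?case
    using obs_mean_0[OF measurable_ennreal_continuous[OF C1_on_continuous[OF f(1)]] 0(2,1)] f(2)
    by (simp add: ennreal_mult)
next
  case (Suc n)
  note t = Suc.prems(1) and x = Suc.prems(2)
  define k where "k s = t * (exp (- cumrate (t * s) x) * jump_op (jump_term n f (t * (1 - s))) (\<phi> (t * s) x))" for s
  have pt: "continuous_on {0..1} (\<lambda>s::real. (t, s))" "continuous_on {0..1} (\<lambda>_::real. x)"
    "(\<lambda>s::real. (t, s)) ` {0..1} \<subseteq> {0..} \<times> {0..1}" "(\<lambda>_::real. x) ` {0..1} \<subseteq> M"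
    using x t by (auto intro: continuous_on_Pair continuous_intros)
  have "continuous_on {0..1} k"
    using C1_familyD(2)[OF C1_family_jump_integrand[OF C1_family_jump_term[OF f(1)]] pt] by (simp add: k_def[abs_def])
  then have "k integrable_on {0..1}" by (rule integrable_continuous_interval)
  then have "(k has_integral integral {0..1} k) {0..1}" by (rule integrable_integral)
  then have hi: "(k has_integral jump_term (Suc n) f t x) {0..1}"
    unfolding jump_term.simps(2) k_def[abs_def] .
  have inner: "(\<integral>\<^sup>+y. obs_mean n (\<lambda>y. ennreal (f y)) (t * (1 - s)) y \<partial>Q z) =
      ennreal (kernel_op Q (jump_term n f (t * (1 - s))) z) \<and> 0 \<le> kernel_op Q (jump_term n f (t * (1 - s))) z"
    if s: "s \<in> {0..1}" and z: "z \<in> M" for s z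
  proof -
    have ts: "0 \<le> t * (1 - s)" using s t by simp
    have IH: "obs_mean n (\<lambda>y. ennreal (f y)) (t * (1 - s)) y = ennreal (jump_term n f (t * (1 - s)) y)"
      "0 \<le> jump_term n f (t * (1 - s)) y" if "y \<in> space (Q z)" for y
      using Suc.IH[OF ts, of y] that space_Q[OF z] by auto
    have cont: "continuous_on M (jump_term n f (t * (1 - s)))"
      using C1_family_imp_C1_on[OF C1_family_jump_term[OF f(1)], of "t * (1 - s)"] ts by (intro C1_on_continuous) simp
    have "(\<integral>\<^sup>+y. obs_mean n (\<lambda>y. ennreal (f y)) (t * (1 - s)) y \<partial>Q z) = (\<integral>\<^sup>+y. ennreal (jump_term n f (t * (1 - s)) y) \<partial>Q z)"
      by (rule nn_integral_cong) (rule IH(1))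
    also have "\<dots> = ennreal (kernel_op Q (jump_term n f (t * (1 - s))) z)"
      unfolding kernel_op_def by (rule nn_integral_eq_integral[OF integrable_Q[OF z cont]]) (auto intro: IH(2))
    moreover have "0 \<le> kernel_op Q (jump_term n f (t * (1 - s))) z"
      unfolding kernel_op_def by (rule Bochner_Integration.integral_nonneg_AE) (auto intro: IH(2))
    ultimately show ?thesis by simp
  qed
  have k: "ennreal (t * (exp (- cumrate (t * s) x) * lam (\<phi> (t * s) x))) *
      (\<integral>\<^sup>+y. obs_mean n (\<lambda>y. ennreal (f y)) (t * (1 - s)) y \<partial>Q (\<phi> (t * s) x)) = ennreal (k s) \<and> 0 \<le> k s"
    if s: "s \<in> {0..1}" for s
  proof -
    have z: "\<phi> (t * s) x \<in> M" using s t x by (intro flow_in) auto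
    show ?thesis using inner[OF s z] lam_nonneg[OF z] t
      by (simp add: k_def jump_op_def ennreal_mult[symmetric] mult.assoc)
  qed
  have "obs_mean (Suc n) (\<lambda>y. ennreal (f y)) t x = (\<integral>\<^sup>+s. ennreal (k s) * indicator {0..1} s \<partial>lborel)"
    unfolding obs_mean_Suc[OF measurable_ennreal_continuous[OF C1_on_continuous[OF f(1)]] x t]
    using k by (intro nn_integral_cong) (simp split: split_indicator)
  also have "\<dots> = ennreal (jump_term (Suc n) f t x)"
    using k by (intro nn_integral_has_integral_lebesgue'[OF _ hi]) blast
  finally show ?case using has_integral_nonneg[OF hi] k by blast
qed

lemma case_option_ennreal: "case_option 0 (\<lambda>y. ennreal (f y)) z = ennreal (case_option 0 f z)"
  by (cases z) auto

section \<open>The series for the semigroup and confinement of paths\<close>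

lemma measurable_pdmp_obs_nonneg:
  assumes f: "f \<in> borel_measurable (borel_of M)" "\<And>y. 0 \<le> f y" and t: "0 \<le> t" and x: "x \<in> M"
  shows "obs t f x \<in> borel_measurable noise"
proof -
  have [measurable]: "obs_term n (\<lambda>y. ennreal (f y)) t x \<in> borel_measurable noise" for n
    by (rule measurable_obs_term_noise) (use f x in simp_all)
  have "(\<lambda>\<omega>. enn2real (\<Sum>n. obs_term n (\<lambda>y. ennreal (f y)) t x \<omega>)) \<in> borel_measurable noise"
    by measurable
  moreover have "enn2real (\<Sum>n. obs_term n (\<lambda>y. ennreal (f y)) t x \<omega>) = obs t f x \<omega>"
    if "\<omega> \<in> space noise" for \<omega>
    unfolding suminf_obs_term[OF x that t] case_option_ennreal pdmp_obs_def
    by (rule enn2real_ennreal) (simp add: f(2) split: option.split)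
  ultimately show ?thesis by (simp cong: measurable_cong)
qed

lemma pdmp_obs_diff:
  "obs t (\<lambda>y. f y - g y) x \<omega> = obs t f x \<omega> - obs t g x \<omega>"
  by (simp add: pdmp_obs_def split: option.split)

lemma measurable_pdmp_obs:
  assumes f: "f \<in> borel_measurable (borel_of M)" and t: "0 \<le> t" and x: "x \<in> M"
  shows "obs t f x \<in> borel_measurable noise"
proof -
  have [measurable]: "obs t (\<lambda>y. max 0 (f y)) x \<in> borel_measurable noise"
    "obs t (\<lambda>y. max 0 (- f y)) x \<in> borel_measurable noise"
    using f by (auto intro!: measurable_pdmp_obs_nonneg t x)
  have "f = (\<lambda>y. max 0 (f y) - max 0 (- f y))" by (auto simp: max_def)
  then have "obs t f x = (\<lambda>\<omega>. obs t (\<lambda>y. max 0 (f y)) x \<omega> - obs t (\<lambda>y. max 0 (- f y)) x \<omega>)"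
    using pdmp_obs_diff by metis
  then show ?thesis by simp
qed

lemma nn_integral_pdmp:
  assumes f: "f \<in> borel_measurable (borel_of M)" and t: "0 \<le> t" and x: "x \<in> M"
  shows "(\<integral>\<^sup>+\<omega>. case_option 0 f (proc x \<omega> t) \<partial>noise) = (\<Sum>n. obs_mean n f t x)"
proof -
  have "(\<integral>\<^sup>+\<omega>. case_option 0 f (proc x \<omega> t) \<partial>noise) = (\<integral>\<^sup>+\<omega>. (\<Sum>n. obs_term n f t x \<omega>) \<partial>noise)"
    by (rule nn_integral_cong) (simp add: suminf_obs_term[OF x _ t])
  also have "\<dots> = (\<Sum>n. obs_mean n f t x)"
    unfolding obs_mean_def by (rule nn_integral_suminf) (rule measurable_obs_term_noise[OF f x])
  finally show ?thesis .
qed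

text \<open>For nonnegative \<open>f\<close>, sum and expectation commute unconditionally;
  summability of \<open>jump_term\<close> then makes the expectation finite.\<close>

lemma semigroup_series:
  assumes f: "C1_on M f" "\<And>y. 0 \<le> f y" and t: "0 \<le> t" and x: "x \<in> M"
  shows "integrable noise (obs t f x)"
    "Pt t f x = (\<Sum>n. jump_term n f t x)"
proof -
  note cont = C1_on_continuous[OF f(1)]
  have jt: "0 \<le> jump_term n f t x" for n using obs_mean_eq_jump_term[OF f t x] by blast
  have sm: "summable (\<lambda>n. jump_term n f t x)" by (rule jump_series(1)[OF f(1) t x])
  have nn: "0 \<le> obs t f x \<omega>" for \<omega>
    by (simp add: pdmp_obs_def f(2) split: option.split)
  have m: "obs t f x \<in> borel_measurable noise"
    by (rule measurable_pdmp_obs[OF measurable_continuous[OF cont] t x])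
  have "(\<integral>\<^sup>+\<omega>. ennreal (obs t f x \<omega>) \<partial>noise) = (\<Sum>n. ennreal (jump_term n f t x))"
    using nn_integral_pdmp[OF measurable_ennreal_continuous[OF cont] t x] obs_mean_eq_jump_term[OF f t x]
    by (simp add: pdmp_obs_def case_option_ennreal)
  also have "\<dots> = ennreal (\<Sum>n. jump_term n f t x)" by (rule suminf_ennreal2[OF jt sm])
  finally have I: "(\<integral>\<^sup>+\<omega>. ennreal (obs t f x \<omega>) \<partial>noise) = ennreal (\<Sum>n. jump_term n f t x)" .
  show "integrable noise (obs t f x)"
    by (rule integrableI_nn_integral_finite[OF m _ I]) (simp add: nn)
  show "Pt t f x = (\<Sum>n. jump_term n f t x)"
    unfolding pdmp_semigroup_def
    by (subst integral_eq_nn_integral[OF m]) (simp_all add: nn I suminf_nonneg[OF sm jt])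
qed

text \<open>For the indicator of the complement of \<open>K'\<close> every term of the expansion
  vanishes: started in a set \<open>\<K> ts\<close> with enough time left, neither flow nor jump
  leaves \<open>K'\<close>. A nonnegative function with integral 0 is 0 almost everywhere.\<close>

lemma confinement:
  assumes "compact K" "K \<subseteq> M" "0 \<le> T"
  obtains K' where "compact K'" "K' \<subseteq> M"
    "\<And>t x. t \<in> {0..T} \<Longrightarrow> x \<in> K \<Longrightarrow> AE \<omega> in noise. case_option True (\<lambda>y. y \<in> K') (proc x \<omega> t)"
proof -
  obtain K' \<K> where K': "compact K'" "K' \<subseteq> M" "\<K> [] = K"
    "\<And>ts. (\<forall>t\<in>set ts. 0 \<le> t) \<Longrightarrow> sum_list ts \<le> T \<Longrightarrow> \<K> ts \<subseteq> K'"
    "\<And>ts s x. (\<forall>t\<in>set ts. 0 \<le> t) \<Longrightarrow> 0 \<le> s \<Longrightarrow> sum_list ts + s \<le> T \<Longrightarrow> x \<in> \<K> ts \<Longrightarrow>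
       \<phi> s x \<in> K' \<and> supp (Q (\<phi> s x)) \<subseteq> \<K> (ts @ [s])"
    by (fact compat_sets[OF assms])
  let ?f = "\<lambda>y. indicator (- K') y :: ennreal"
  have f: "?f \<in> borel_measurable (borel_of M)"
    using K'(1) by (intro measurable_restrict_space1 borel_measurable_indicator) (simp add: compact_imp_closed borel_closed)
  have zero: "obs_mean n ?f t x = 0"
    if "\<forall>t\<in>set ts. 0 \<le> t" "0 \<le> t" "sum_list ts + t \<le> T" "x \<in> \<K> ts" for n ts t x
    using that
  proof (induction n arbitrary: ts t x)
    case 0
    then have "sum_list ts \<le> T" by simp
    then have "x \<in> M" using K'(2) K'(4)[OF 0(1)] 0(4) by blast
    from obs_mean_0[OF f this 0(2)] K'(5)[OF 0] show ?case by simp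
  next
    case (Suc n)
    note prems = Suc.prems
    have "sum_list ts \<le> T" using prems by simp
    then have x: "x \<in> M" using K'(2) K'(4)[OF prems(1)] prems(4) by blast
    have "(\<integral>\<^sup>+y. obs_mean n ?f (t * (1 - s)) y \<partial>Q (\<phi> (t * s) x)) = 0" if s: "s \<in> {0..1}" for s
    proof -
      have ts: "0 \<le> t * s" "t * s \<le> t" using s prems(2) by (auto intro: mult_left_le)
      have z: "\<phi> (t * s) x \<in> M" by (rule flow_in[OF ts(1) x])
      have sum: "sum_list ts + t * s \<le> T" using ts(2) prems(3) by linarith
      have "AE y in Q (\<phi> (t * s) x). obs_mean n ?f (t * (1 - s)) y = 0"
      proof (rule eventually_mono[OF AE_Q_support[OF z]])
        fix y assume "y \<in> supp (Q (\<phi> (t * s) x))"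
        then have y: "y \<in> \<K> (ts @ [t * s])" using K'(5)[OF prems(1) ts(1) sum prems(4)] by blast
        show "obs_mean n ?f (t * (1 - s)) y = 0"
        proof (rule Suc.IH[OF _ _ _ y])
          show "\<forall>t\<in>set (ts @ [t * s]). 0 \<le> t" using prems(1) ts(1) by auto
          show "0 \<le> t * (1 - s)" using s prems(2) by simp
          show "sum_list (ts @ [t * s]) + t * (1 - s) \<le> T" using prems(3) by (simp add: algebra_simps)
        qed
      qed
      then have "(\<integral>\<^sup>+y. obs_mean n ?f (t * (1 - s)) y \<partial>Q (\<phi> (t * s) x)) = (\<integral>\<^sup>+y. 0 \<partial>Q (\<phi> (t * s) x))"
        by (rule nn_integral_cong_AE)
      then show ?thesis by simp
    qed
    then have "(\<lambda>s. ennreal (t * (exp (- cumrate (t * s) x) * lam (\<phi> (t * s) x))) *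
       (\<integral>\<^sup>+y. obs_mean n ?f (t * (1 - s)) y \<partial>Q (\<phi> (t * s) x)) * indicator {0..1} s) = (\<lambda>s. 0)"
      by (simp add: fun_eq_iff split: split_indicator)
    then show ?case unfolding obs_mean_Suc[OF f x prems(2)] by simp
  qed
  show thesis
  proof (rule that[OF K'(1,2)])
    fix t x assume t: "t \<in> {0..T}" and x: "x \<in> K"
    have t0: "0 \<le> t" and xM: "x \<in> M" using t x assms(2) by auto
    have "obs_mean n ?f t x = 0" for n by (rule zero[of "[]"]) (use t x K'(3) in auto)
    then have I: "(\<integral>\<^sup>+\<omega>. case_option 0 ?f (proc x \<omega> t) \<partial>noise) = 0"
      unfolding nn_integral_pdmp[OF f t0 xM] by simp
    have "(\<lambda>\<omega>. \<Sum>n. obs_term n ?f t x \<omega>) \<in> borel_measurable noise"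
      by (rule borel_measurable_suminf_order) (rule measurable_obs_term_noise[OF f xM])
    then have m: "(\<lambda>\<omega>. case_option 0 ?f (proc x \<omega> t)) \<in> borel_measurable noise"
      using measurable_cong[of noise "\<lambda>\<omega>. \<Sum>n. obs_term n ?f t x \<omega>" "\<lambda>\<omega>. case_option 0 ?f (proc x \<omega> t)" borel]
        suminf_obs_term[OF xM _ t0] by blast
    have "AE \<omega> in noise. case_option 0 ?f (proc x \<omega> t) = 0"
      using I nn_integral_0_iff_AE[OF m] by simp
    then show "AE \<omega> in noise. case_option True (\<lambda>y. y \<in> K') (proc x \<omega> t)"
      by (rule eventually_mono) (simp split: option.splits split_indicator_asm)
  qed
qed

lemma integrable_pdmp_obs:
  assumes f: "continuous_on M f" and t: "0 \<le> t" and x: "x \<in> M"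
  shows "integrable noise (obs t f x)"
proof -
  interpret N: prob_space noise by (rule prob_noise)
  have "compact {x}" "{x} \<subseteq> M" using x by auto
  from confinement[OF this t] obtain K' where K': "compact K'" "K' \<subseteq> M"
    "AE \<omega> in noise. case_option True (\<lambda>y. y \<in> K') (proc x \<omega> t)" using t by (metis atLeastAtMost_iff order_refl singletonI)
  have "bounded (f ` K')"
    by (intro compact_imp_bounded compact_continuous_image continuous_on_subset[OF f] K'(1,2))
  then obtain B where B: "\<And>y. y \<in> K' \<Longrightarrow> norm (f y) \<le> B" unfolding bounded_iff by blast
  \<comment> \<open>The cemetery value 0 needs a nonnegative bound, while \<open>B\<close> could be
    negative if \<open>K'\<close> were empty.\<close>
  have "AE \<omega> in noise. norm (obs t f x \<omega>) \<le> \<bar>B\<bar>"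
    using K'(3)
  proof eventually_elim
    case (elim \<omega>)
    then show ?case using B by (cases "proc x \<omega> t") (fastforce simp: pdmp_obs_def)+
  qed
  then show ?thesis by (rule N.integrable_const_bound[OF _ measurable_pdmp_obs[OF measurable_continuous[OF f] t x]])
qed

lemma semigroup_diff:
  assumes "continuous_on M f" "continuous_on M g" "0 \<le> t" "x \<in> M"
  shows "Pt t (\<lambda>y. f y - g y) x = Pt t f x - Pt t g x"
  unfolding pdmp_semigroup_def pdmp_obs_diff
  by (intro Bochner_Integration.integral_diff integrable_pdmp_obs assms)

section \<open>Regularity for data of arbitrary sign\<close>

lemma C1_on_cong: "(\<And>x. x \<in> M \<Longrightarrow> f x = g x) \<Longrightarrow> C1_on M f \<longleftrightarrow> C1_on M g"
  unfolding C1_on_def by (metis IntD1)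

lemma grad_cong:
  assumes "\<And>x. x \<in> M \<Longrightarrow> f x = g x" "x \<in> M"
  shows "grad M f x = grad M g x"
proof -
  have "(f has_derivative D) (at x within M) \<longleftrightarrow> (g has_derivative D) (at x within M)" for D
    using has_derivative_transform[OF assms(2), of f g D] has_derivative_transform[OF assms(2), of g f D] assms(1) by metis
  then show ?thesis by (simp add: grad_def)
qed

text \<open>The series is available for nonnegative data, and positive parts would destroy
  differentiability. The identity \<open>f = ((f + 1) / 2)^2 - ((f - 1) / 2)^2\<close> splits
  \<open>f\<close> into nonnegative functions of class C1.\<close>

lemma semigroup_C1:
  assumes f: "C1_on M f"
  shows "0 \<le> t \<Longrightarrow> C1_on M (Pt t f)"
    "compact K \<Longrightarrow> K \<subseteq> M \<Longrightarrow> 0 \<le> T \<Longrightarrow> \<exists>C\<ge>0. \<forall>t\<in>{0..T}. \<forall>x\<in>K.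
       C1_size (Pt t f) x \<le> C"
proof -
  define a where "a y = ((f y + 1) / 2) * ((f y + 1) / 2)" for y
  define b where "b y = ((f y + (- 1)) / 2) * ((f y + (- 1)) / 2)" for y
  have "C1_on M (\<lambda>y. (f y + c) / 2)" for c
    using C1_on_mult[OF C1_on_const[of "1 / 2"] C1_on_add[OF f C1_on_const[of c]]] by simp
  then have C1: "C1_on M a" "C1_on M b" unfolding a_def b_def by (intro C1_on_mult; blast)+
  have nn: "0 \<le> a y" "0 \<le> b y" for y by (simp_all add: a_def b_def)
  have fab: "f = (\<lambda>y. a y - b y)" by (auto simp: a_def b_def field_simps)
  define A where "A t x = (\<Sum>n. jump_term n a t x)" for t x
  define B where "B t x = (\<Sum>n. jump_term n b t x)" for t x
  have eq: "Pt t f x = A t x - B t x" if "0 \<le> t" "x \<in> M" for t x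
    unfolding fab A_def B_def
    using semigroup_diff[OF C1_on_continuous[OF C1(1)] C1_on_continuous[OF C1(2)] that]
      semigroup_series(2)[OF C1(1) nn(1) that] semigroup_series(2)[OF C1(2) nn(2) that] by simp
  have AB: "C1_on M (A t)" "C1_on M (B t)" if "0 \<le> t" for t
    using jump_series(2)[OF C1(1) that] jump_series(2)[OF C1(2) that] by (simp_all add: A_def[abs_def] B_def[abs_def])
  show "C1_on M (Pt t f)" if "0 \<le> t" for t
    using C1_on_cong[of "Pt t f" "\<lambda>x. A t x - B t x"] eq[OF that] C1_on_diff[OF AB[OF that]] by blast
  assume K: "compact K" "K \<subseteq> M" "0 \<le> T"
  obtain CA where CA: "0 \<le> CA" "\<forall>t\<in>{0..T}. \<forall>x\<in>K. C1_size (A t) x \<le> CA"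
    using jump_series(3)[OF C1(1) K] unfolding A_def[abs_def] by blast
  obtain CB where CB: "0 \<le> CB" "\<forall>t\<in>{0..T}. \<forall>x\<in>K. C1_size (B t) x \<le> CB"
    using jump_series(3)[OF C1(2) K] unfolding B_def[abs_def] by blast
  have "C1_size (Pt t f) x \<le> CA + CB"
    if t: "t \<in> {0..T}" and x: "x \<in> K" for t x
  proof -
    have t0: "0 \<le> t" and xM: "x \<in> M" using t x K(2) by auto
    have "grad M (Pt t f) x = grad M (\<lambda>x. A t x - B t x) x"
      by (rule grad_cong[OF eq[OF t0] xM])
    also have "\<dots> = grad M (A t) x - grad M (B t) x" by (rule grad_diff[OF AB[OF t0] xM])
    finally have g: "norm (grad M (Pt t f) x) \<le> norm (grad M (A t) x) + norm (grad M (B t) x)"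
      by (simp add: norm_triangle_ineq4)
    have "\<bar>A t x - B t x\<bar> \<le> \<bar>A t x\<bar> + \<bar>B t x\<bar>" by simp
    with g CA(2)[rule_format, OF t x] CB(2)[rule_format, OF t x] show ?thesis
      unfolding eq[OF t0 xM] by linarith
  qed
  then show "\<exists>C\<ge>0. \<forall>t\<in>{0..T}. \<forall>x\<in>K.
       C1_size (Pt t f) x \<le> C"
    using CA(1) CB(1) by (intro exI[of _ "CA + CB"]) simp
qed

text \<open>By confinement, only the values of \<open>f\<close> on a compact set matter, where \<open>f\<close> is a uniform
  limit of polynomials.\<close>

lemma semigroup_continuous:
  assumes f: "continuous_on M f" and t: "0 \<le> t"
  shows "continuous_on M (Pt t f)"
proof (rule continuous_on_locally)
  interpret N: prob_space noise by (rule prob_noise)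
  fix p assume p: "p \<in> M"
  \<comment> \<open>Continuity is local, and on this compact neighbourhood of \<open>p\<close> in
    \<open>M\<close> one set \<open>K'\<close> confines all paths, so the approximation is
    uniform.\<close>
  define K where "K = cball p 1 \<inter> M"
  have K: "compact K" "K \<subseteq> M" using compact_cball_Int by (auto simp: K_def)
  obtain K' where K': "compact K'" "K' \<subseteq> M"
    "\<And>s x. s \<in> {0..t} \<Longrightarrow> x \<in> K \<Longrightarrow> AE \<omega> in noise. case_option True (\<lambda>y. y \<in> K') (proc x \<omega> s)"
    by (fact confinement[OF K t])
  have "\<exists>g. real_polynomial_function g \<and> (\<forall>y\<in>K'. \<bar>f y - g y\<bar> < 1 / Suc n)" for n
    using Stone_Weierstrass_real_polynomial_function[OF K'(1) continuous_on_subset[OF f K'(2)], of "1 / Suc n"]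
    by (metis of_nat_0_less_iff zero_less_Suc zero_less_divide_1_iff)
  then obtain g where g: "\<And>n. real_polynomial_function (g n)" "\<And>n y. y \<in> K' \<Longrightarrow> \<bar>f y - g n y\<bar> < 1 / Suc n"
    by metis
  have gC1: "C1_on M (g n)" for n by (rule C1_on_polynomial[OF g(1)])
  have close: "\<bar>Pt t f x - Pt t (g n) x\<bar> \<le> 1 / Suc n" if x: "x \<in> K" for n x
  proof -
    have xM: "x \<in> M" using x K(2) by blast
    have tt: "t \<in> {0..t}" using t by simp
    have "AE \<omega> in noise. \<bar>obs t (\<lambda>y. f y - g n y) x \<omega>\<bar> \<le> 1 / Suc n"
      using K'(3)[OF tt x]
    proof eventually_elim
      case (elim \<omega>)
      then show ?case using g(2)[of _ n]
        by (cases "proc x \<omega> t") (auto simp: pdmp_obs_def intro: less_imp_le)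
    qed
    moreover have I: "integrable noise (obs t (\<lambda>y. f y - g n y) x)"
      by (intro integrable_pdmp_obs continuous_intros f C1_on_continuous gC1 t xM)
    ultimately have "(\<integral>\<omega>. \<bar>obs t (\<lambda>y. f y - g n y) x \<omega>\<bar> \<partial>noise) \<le> (\<integral>\<omega>. 1 / Suc n \<partial>noise)"
      by (intro integral_mono_AE) auto
    moreover have "\<bar>Pt t (\<lambda>y. f y - g n y) x\<bar> \<le> (\<integral>\<omega>. \<bar>obs t (\<lambda>y. f y - g n y) x \<omega>\<bar> \<partial>noise)"
      unfolding pdmp_semigroup_def using integral_norm_bound[of noise "obs t (\<lambda>y. f y - g n y) x"] by simp
    ultimately show ?thesis
      using semigroup_diff[OF f C1_on_continuous[OF gC1[of n]] t xM] by (simp add: N.prob_space)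
  qed
  have "uniform_limit K (\<lambda>n. Pt t (g n)) (Pt t f) sequentially"
  proof (rule uniform_limitI)
    fix e :: real assume "0 < e"
    then obtain N where N: "inverse (Suc N) < e" using reals_Archimedean by blast
    show "\<forall>\<^sub>F n in sequentially. \<forall>x\<in>K. dist (Pt t (g n) x) (Pt t f x) < e"
    proof (rule eventually_sequentiallyI[of N], intro ballI)
      fix n x assume n: "N \<le> n" and x: "x \<in> K"
      have "1 / Suc n \<le> inverse (Suc N)" using n by (simp add: field_simps)
      then show "dist (Pt t (g n) x) (Pt t f x) < e"
        using close[OF x, of n] N by (simp add: dist_real_def abs_minus_commute)
    qed
  qed
  then have "continuous_on K (Pt t f)"
    by (rule uniform_limit_theorem[rotated])
      (auto intro!: always_eventually continuous_on_subset[OF C1_on_continuous[OF semigroup_C1(1)[OF gC1 t]] K(2)])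
  then have "continuous_on (M \<inter> ball p 1) (Pt t f)"
    by (rule continuous_on_subset) (auto simp: K_def)
  then show "\<exists>U. open U \<and> p \<in> U \<and> continuous_on (M \<inter> U) (Pt t f)"
    by (intro exI[of _ "ball p 1"]) simp
qed

end

text \<open>The Bochner integral of a non-integrable function is 0 by convention; the first conjunct
  certifies that \<open>pdmp_semigroup\<close> is a genuine expectation.\<close>

theorem theorem17:
  fixes M :: "'a::euclidean_space set"
    and \<phi> :: "real \<Rightarrow> 'a \<Rightarrow> 'a"
    and lam :: "'a \<Rightarrow> real"
    and Q :: "'a \<Rightarrow> 'a measure"
    and G :: "'a \<times> real \<Rightarrow> 'a"
  assumes "closed_submanifold M"
    and "homogeneous_characteristics M \<phi> lam Q"
    and "represents_kernel M Q G"
    and "non_explosive M \<phi> lam G"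
    and "stability_property M \<phi> lam Q"
  shows "(\<forall>f T x. continuous_on M f \<and> 0 \<le> T \<and> x \<in> M \<longrightarrow>
            integrable noise (pdmp_obs \<phi> lam G T f x)) \<and>
         (\<forall>f T. continuous_on M f \<and> 0 \<le> T \<longrightarrow> continuous_on M (pdmp_semigroup \<phi> lam G T f)) \<and>
         (\<forall>f T. C1_on M f \<and> 0 \<le> T \<longrightarrow> C1_on M (pdmp_semigroup \<phi> lam G T f)) \<and>
         (\<forall>f K T. C1_on M f \<and> compact K \<and> K \<subseteq> M \<and> 0 \<le> T \<longrightarrow>
            (\<exists>C\<ge>0. \<forall>t\<in>{0..T}. \<forall>x\<in>K.
               \<bar>pdmp_semigroup \<phi> lam G t f x\<bar> + norm (grad M (pdmp_semigroup \<phi> lam G t f) x) \<le> C))"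
proof -
  interpret stable_pdmp M \<phi> lam Q G
    using assms by unfold_locales
  show ?thesis
    by (intro conjI allI impI; elim conjE)
      (rule integrable_pdmp_obs semigroup_continuous semigroup_C1; assumption)+
qed

end
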